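(* Let $n$ be a positive integer, $G$ a finite group and $S$ a finite set with a $G$-action, and exclude the case $n=1$, $G=\{e\}$, $S=\varnothing$. Let $\epsilon=0$ if $S\neq\varnothing$ and $\epsilon=1$ if $S=\varnothing$. Then the order complex of $\mathcal{D}_n(G,S)\setminus\{\hat 0\}$ is homotopy equivalent to a wedge of \[(-1)^\epsilon\prod_{i=0}^{n-1}\bigl(|S|-1+|G|\,i\bigr)\] spheres of dimension $n-1-\epsilon$.
   Context: Let $[n]=\{1,\dots,n\}$. A partial $G$-partition of $[n]$ is a set $\tilde\beta=\{\tilde B_1,\dots,\tilde B_\ell\}$ where $\{B_1,\dots,B_\ell\}$ is a partition of a subset $\bigcup B_i\subseteq[n]$ into nonempty blocks, and each $\tilde B_i$ consists of $B_i$ together with a function $b_i\colon B_i\to G$ considered up to the equivalence $b_i\sim b_i g$ ($g\in G$). The zero block is $Z=[n]\setminus\bigcup B_i$. The $S$-Dowling poset $\mathcal{D}_n(G,S)$ is the set of pairs $(\tilde\beta,z)$ with $\tilde\beta$ a partial $G$-partition of $[n]$ and $z\colon Z\to S$. Its partial order is generated by the covering relations: (merge) $(\tilde\beta\cup\{\tilde A,\tilde B\},z)\prec(\tilde\beta\cup\{\tilde C\},z)$ where $C=A\cup B$, $c|_A=a$, $c|_B=b\cdot g$ for some $g\in G$; (color) $(\tilde\beta\cup\{\tilde B\},z)\prec(\tilde\beta,z')$ where $z'$ extends $z$ to $Z\cup B$ with $z'(i)=b(i)\cdot s$ for all $i\in B$, for some $s\in S$. Its bottom element $\hat 0$ is the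 partition of $[n]$ into singletons with empty zero block. A wedge of $0$ spheres means a contractible space. *)

theory Defs
  imports "HOL-Analysis.Analysis" "HOL-Algebra.Group_Action"
begin

section \<open>The S-Dowling poset\<close>

text \<open>
  The $G$-block given by a representative \<open>b\<close>: the set \<open>B\<close> together with the class of \<open>b\<close> under
  \<open>b \<sim> b g\<close>. The set \<open>B\<close> is stored explicitly because it cannot be read off an extensional
  function (\<open>undefined\<close> may lie in the carrier of \<open>G\<close>).
\<close>

definition gblock ::
  "('g, 'm) monoid_scheme \<Rightarrow> nat set \<Rightarrow> (nat \<Rightarrow> 'g) \<Rightarrow> nat set \<times> (nat \<Rightarrow> 'g) set"
  where "gblock G B b = (B, {\<lambda>i\<in>B. b i \<otimes>\<^bsub>G\<^esub> g | g. g \<in> carrier G})"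

definition partial_G_partitions ::
  "('g, 'm) monoid_scheme \<Rightarrow> nat \<Rightarrow> (nat set \<times> (nat \<Rightarrow> 'g) set) set set"
  where "partial_G_partitions G n =
    {\<beta>. (\<forall>X\<in>\<beta>. \<exists>B b. B \<subseteq> {1..n} \<and> B \<noteq> {} \<and> b \<in> B \<rightarrow> carrier G \<and> X = gblock G B b)
       \<and> (\<forall>X\<in>\<beta>. \<forall>Y\<in>\<beta>. X \<noteq> Y \<longrightarrow> fst X \<inter> fst Y = {})}"

definition zero_block :: "nat \<Rightarrow> (nat set \<times> 'c) set \<Rightarrow> nat set"
  where "zero_block n \<beta> = {1..n} - (\<Union>X\<in>\<beta>. fst X)"

type_synonym ('g, 's) dowling_elem =
  "(nat set \<times> (nat \<Rightarrow> 'g) set) set \<times> (nat \<Rightarrow> 's)"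

definition dowling ::
  "nat \<Rightarrow> ('g, 'm) monoid_scheme \<Rightarrow> 's set \<Rightarrow> ('g, 's) dowling_elem set"
  where "dowling n G S =
    {(\<beta>, z). \<beta> \<in> partial_G_partitions G n \<and> z \<in> zero_block n \<beta> \<rightarrow>\<^sub>E S}"

inductive dowling_cover ::
  "nat \<Rightarrow> ('g, 'm) monoid_scheme \<Rightarrow> 's set \<Rightarrow> ('g \<Rightarrow> 's \<Rightarrow> 's)
    \<Rightarrow> ('g, 's) dowling_elem \<Rightarrow> ('g, 's) dowling_elem \<Rightarrow> bool"
  for n :: nat and G :: "('g, 'm) monoid_scheme" and S :: "'s set" and act :: "'g \<Rightarrow> 's \<Rightarrow> 's"
  where
    merge: "\<lbrakk>(\<beta> \<union> {gblock G A a, gblock G B b}, z) \<in> dowling n G S;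
        (\<beta> \<union> {gblock G C c}, z) \<in> dowling n G S;
        gblock G A a \<notin> \<beta>; gblock G B b \<notin> \<beta>; gblock G A a \<noteq> gblock G B b;
        a \<in> A \<rightarrow> carrier G; b \<in> B \<rightarrow> carrier G; g \<in> carrier G;
        C = A \<union> B; \<forall>i\<in>A. c i = a i; \<forall>i\<in>B. c i = b i \<otimes>\<^bsub>G\<^esub> g\<rbrakk>
      \<Longrightarrow> dowling_cover n G S act
            (\<beta> \<union> {gblock G A a, gblock G B b}, z) (\<beta> \<union> {gblock G C c}, z)"
  | color: "\<lbrakk>(\<beta> \<union> {gblock G B b}, z) \<in> dowling n G S; (\<beta>, z') \<in> dowling n G S;
        gblock G B b \<notin> \<beta>; b \<in> B \<rightarrow> carrier G; s \<in> S;
        \<forall>i\<in>zero_block n (\<beta> \<union> {gblock G B b}). z' i = z i; \<forall>i\<in>B. z' i = act (b i) s\<rbrakk>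
      \<Longrightarrow> dowling_cover n G S act (\<beta> \<union> {gblock G B b}, z) (\<beta>, z')"

definition dowling_le ::
  "nat \<Rightarrow> ('g, 'm) monoid_scheme \<Rightarrow> 's set \<Rightarrow> ('g \<Rightarrow> 's \<Rightarrow> 's)
    \<Rightarrow> ('g, 's) dowling_elem \<Rightarrow> ('g, 's) dowling_elem \<Rightarrow> bool"
  where "dowling_le n G S act = (dowling_cover n G S act)\<^sup>*\<^sup>*"

text \<open>The second component is the only element of \<open>{} \<rightarrow>\<^sub>E S\<close>.\<close>

definition dowling_bot :: "nat \<Rightarrow> ('g, 'm) monoid_scheme \<Rightarrow> ('g, 's) dowling_elem"
  where "dowling_bot n G =
    ((\<lambda>i. gblock G {i} (\<lambda>_. \<one>\<^bsub>G\<^esub>)) ` {1..n}, \<lambda>_. undefined)"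

lemma dowling_bot_in_dowling:
  assumes "group G"
  shows "dowling_bot n G \<in> dowling n G S"
proof -
  interpret group G by fact
  have "\<exists>B b. B \<subseteq> {1..n} \<and> B \<noteq> {} \<and> b \<in> B \<rightarrow> carrier G \<and>
          gblock G {i} (\<lambda>_. \<one>\<^bsub>G\<^esub>) = gblock G B b" if "i \<in> {1..n}" for i
    using that by (intro exI[of _ "{i}"] exI[of _ "\<lambda>_. \<one>\<^bsub>G\<^esub>"]) auto
  then show ?thesis
    by (auto simp: dowling_bot_def dowling_def partial_G_partitions_def zero_block_def gblock_def)
qed


section \<open>Order complexes and their realization\<close>

text \<open>Simplicial complexes are given by their nonempty faces.\<close>

definition order_complex :: "'a set \<Rightarrow> ('a \<Rightarrow> 'a \<Rightarrow> bool) \<Rightarrow> 'a set set"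
  where "order_complex P r =
    {C. C \<subseteq> P \<and> finite C \<and> C \<noteq> {} \<and> (\<forall>x\<in>C. \<forall>y\<in>C. r x y \<or> r y x)}"

text \<open>
  Points are given by barycentric coordinates. The topology of pointwise convergence is the usual
  one when the complex has finitely many vertices; for infinite complexes it is in general coarser
  than the weak topology.
\<close>

definition geometric_realization :: "'a set set \<Rightarrow> ('a \<Rightarrow> real) topology"
  where "geometric_realization K = subtopology (powertop_real UNIV)
    {x. (\<forall>v. 0 \<le> x v) \<and> {v. x v \<noteq> 0} \<in> K \<and> (\<Sum>v | x v \<noteq> 0. x v) = 1}"


section \<open>Wedges of spheres\<close>

definition wedge_map :: "('i \<Rightarrow> 'a) \<Rightarrow> 'i \<times> 'a \<Rightarrow> ('i \<times> 'a) option"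
  where "wedge_map p y = (if snd y = p (fst y) then None else Some y)"

text \<open>
  The quotient of the disjoint union identifying all base points \<open>p i\<close> to the point \<open>None\<close>. This
  point is present even for empty \<open>I\<close>, so that the empty wedge is a single point.
\<close>

definition wedge_sum :: "('i \<Rightarrow> 'a topology) \<Rightarrow> ('i \<Rightarrow> 'a) \<Rightarrow> 'i set \<Rightarrow> ('i \<times> 'a) option topology"
  where "wedge_sum X p I = topology (\<lambda>U.
    U \<subseteq> insert None (wedge_map p ` topspace (sum_topology X I)) \<and>
    openin (sum_topology X I) {y \<in> topspace (sum_topology X I). wedge_map p y \<in> U})"

lemma openin_wedge_sum:
  "openin (wedge_sum X p I) U \<longleftrightarrow>
    U \<subseteq> insert None (wedge_map p ` topspace (sum_topology X I)) \<and>
    openin (sum_topology X I) {y \<in> topspace (sum_topology X I). wedge_map p y \<in> U}"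
proof -
  let ?T = "sum_topology X I"
  let ?pre = "\<lambda>U. {y \<in> topspace ?T. wedge_map p y \<in> U}"
  have "?pre (U \<inter> V) = ?pre U \<inter> ?pre V" for U V
    by auto
  moreover have "?pre (\<Union>\<K>) = \<Union>(?pre ` \<K>)" for \<K>
    by auto
  ultimately have "istopology (\<lambda>U. U \<subseteq> insert None (wedge_map p ` topspace ?T) \<and> openin ?T (?pre U))"
    unfolding istopology_def by (auto simp del: mem_Collect_eq intro!: openin_Union)
  then show ?thesis
    by (simp add: wedge_sum_def topology_inverse')
qed

lemma topspace_wedge_sum:
  "topspace (wedge_sum X p I) = insert None (wedge_map p ` topspace (sum_topology X I))"
  (is "_ = ?W")
proof -
  have "{y \<in> topspace (sum_topology X I). wedge_map p y \<in> ?W} = topspace (sum_topology X I)"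
    by auto
  then have "openin (wedge_sum X p I) ?W"
    unfolding openin_wedge_sum by (simp only: openin_topspace subset_refl simp_thms)
  moreover have "topspace (wedge_sum X p I) \<subseteq> ?W"
    using openin_topspace[of "wedge_sum X p I"] unfolding openin_wedge_sum by (rule conjunct1)
  ultimately show ?thesis
    by (intro subset_antisym openin_subset)
qed

lemma quotient_map_wedge_sum:
  assumes "I \<noteq> {}" and "\<And>i. i \<in> I \<Longrightarrow> p i \<in> topspace (X i)"
  shows "quotient_map (sum_topology X I) (wedge_sum X p I) (wedge_map p)"
proof -
  obtain i where i: "i \<in> I"
    using assms(1) by blast
  then have "(i, p i) \<in> topspace (sum_topology X I)"
    using assms(2) by (simp add: topspace_sum_topology)
  then have "None \<in> wedge_map p ` topspace (sum_topology X I)"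
    by (force simp: wedge_map_def)
  then show ?thesis
    by (auto simp: quotient_map_def topspace_wedge_sum openin_wedge_sum insert_absorb)
qed

text \<open>
  The sphere of dimension \<open>-1\<close> is the empty space; it has no base point, and the wedge of one copy
  of it is the empty space itself. (Wedges of two or more copies are not meaningful.)
\<close>

definition sphere_wedge :: "nat \<Rightarrow> int \<Rightarrow> (nat \<times> (nat \<Rightarrow> real)) option topology"
  where "sphere_wedge k d =
    (if k \<noteq> 0 \<and> d < 0 then trivial_topology
     else wedge_sum (\<lambda>_. nsphere (nat d)) (\<lambda>_ i. if i = 0 then 1 else 0) {..<k})"

end

theory Submission
  imports Defs
begin

text \<open>
  Write \<open>D\<^sub>n\<close> for the Dowling poset without its bottom element and let \<open>A\<close> be the set of atoms of \<open>D\<^sub>n\<close>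
  that involve the point \<open>n\<close>, so \<open>|A| = |S| + |G| (n - 1)\<close>. Isolating \<open>n\<close> is an order-preserving
  decreasing map from \<open>D\<^sub>n - A\<close> onto a copy of \<open>D\<^sub>n\<^sub>-\<^sub>1\<close>, and it restricts to an isomorphism on the elements
  strictly above any fixed atom in \<open>A\<close>. Hence the order complex of \<open>D\<^sub>n\<close> is homotopy equivalent to the join
  of the discrete set \<open>A\<close> with the order complex of \<open>D\<^sub>n\<^sub>-\<^sub>1\<close>, and by induction to a join of finite discrete sets.

  All homotopies are written down on open cones: a join becomes a product of cones, and a homotopy
  equivalence that hits the apex only from the apex restricts to the punctured cones. The cone over
  \<open>k + 1\<close> points is a star with \<open>k + 1\<close> rays; the product of stars with \<open>p + 1\<close> and \<open>q + 1\<close> rays is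
  equivalent to the product of a line and a star with \<open>p q + 1\<close> rays, and the punctured product of a star
  with \<open>k + 1\<close> rays and a \<open>d\<close>-dimensional space is a wedge of \<open>k\<close> spheres of dimension \<open>d\<close>.
\<close>

section \<open>Homotopy equivalences of open cones\<close>

text \<open>Straight-line homotopies towards a decreasing map \<open>f\<close> can leave an order
  complex: for \<open>u\<close> below \<open>v\<close> the points \<open>u\<close> and
  \<open>f v\<close> may be incomparable. Mass therefore has to move from the bottom of the chain
  upwards. An atom \<open>a\<close> causes the same trouble: mass on \<open>W\<close> is lifted
  above \<open>a\<close> from the top down, and \<open>a\<close> may carry mass only once everything
  has been lifted. So the mass at \<open>a\<close> serves as a budget that first pays for the
  lifting. On cones the total mass is not normalised, so these maps are built from sums,
  \<open>min\<close> and \<open>max\<close>, and continuity is checked coordinate by coordinate.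

  Each factor of the product is the number of points of \<open>A\<close> minus one, because one
  point becomes the unlabelled ray of a star. For \<open>S = {}\<close> there are no atoms at the
  first stage and its factor \<open>-1\<close> counts nothing; the induction then starts one stage
  later, which costs one dimension and is matched by the sign \<open>(-1) ^ \<epsilon>\<close>. A
  single atom gives a star without labelled rays and hence the empty wedge, so contractible
  complexes are covered by the same argument.\<close>

text \<open>The points \<open>p\<close> and \<open>q\<close> are the apexes.\<close>

definition cone_map ::
  "'a::topological_space set \<Rightarrow> 'a \<Rightarrow> 'b::topological_space set \<Rightarrow> 'b \<Rightarrow> ('a \<Rightarrow> 'b) \<Rightarrow> bool"
  where "cone_map X p Y q f \<longleftrightarrow>
    continuous_on X f \<and> (\<forall>x\<in>X. f x \<in> Y) \<and> (\<forall>x\<in>X. f x = q \<longleftrightarrow> x = p)"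

definition cone_homotopic ::
  "'a::topological_space set \<Rightarrow> 'a \<Rightarrow> ('a \<Rightarrow> 'a) \<Rightarrow> ('a \<Rightarrow> 'a) \<Rightarrow> bool"
  where "cone_homotopic X p f g \<longleftrightarrow>
    homotopic_with_canon (\<lambda>h. \<forall>x\<in>X. h x = p \<longleftrightarrow> x = p) X X f g"

definition cone_equiv ::
  "'a::topological_space set \<Rightarrow> 'a \<Rightarrow> 'b::topological_space set \<Rightarrow> 'b \<Rightarrow> bool"
  where "cone_equiv X p Y q \<longleftrightarrow> (\<exists>f g. cone_map X p Y q f \<and> cone_map Y q X p g \<and>
    cone_homotopic X p (g \<circ> f) id \<and> cone_homotopic Y q (f \<circ> g) id)"

lemma cone_mapI:
  assumes "continuous_on X f" "\<And>x. x \<in> X \<Longrightarrow> f x \<in> Y" "\<And>x. x \<in> X \<Longrightarrow> f x = q \<longleftrightarrow> x = p"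
  shows "cone_map X p Y q f"
  using assms unfolding cone_map_def by blast

lemma cone_homotopic_iff:
  "cone_homotopic X p f g \<longleftrightarrow> (\<exists>h. continuous_on ({0..1::real} \<times> X) (\<lambda>z. h (fst z) (snd z)) \<and>
    (\<forall>t\<in>{0..1}. \<forall>x\<in>X. h t x \<in> X \<and> (h t x = p \<longleftrightarrow> x = p)) \<and> (\<forall>x\<in>X. h 0 x = f x \<and> h 1 x = g x))"
    (is "_ \<longleftrightarrow> (\<exists>h. ?P h)")
proof -
  have *: "cone_homotopic X p f g \<longleftrightarrow>
    (\<exists>k. continuous_map (prod_topology (top_of_set {0..1::real}) (top_of_set X)) (top_of_set X) k \<and>
      (\<forall>x\<in>X. k (0,x) = f x) \<and> (\<forall>x\<in>X. k (1,x) = g x) \<and>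
      (\<forall>t\<in>{0..1}. \<forall>x\<in>X. k (t,x) = p \<longleftrightarrow> x = p))"
    unfolding cone_homotopic_def by (subst homotopic_with) auto
  show ?thesis
  proof
    assume "cone_homotopic X p f g"
    then obtain k where "continuous_map (prod_topology (top_of_set {0..1::real}) (top_of_set X)) (top_of_set X) k"
      "\<forall>x\<in>X. k (0,x) = f x" "\<forall>x\<in>X. k (1,x) = g x"
      "\<forall>t\<in>{0..1}. \<forall>x\<in>X. k (t,x) = p \<longleftrightarrow> x = p"
      using * by blast
    then have "?P (\<lambda>t x. k (t, x))"
      by (auto simp: Pi_iff)
    then show "\<exists>h. ?P h" by (rule exI[of _ "\<lambda>t x. k (t, x)"])
  next
    assume "\<exists>h. ?P h"
    then obtain h where "?P h" by blast
    then show "cone_homotopic X p f g"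
      unfolding * by (intro exI[of _ "\<lambda>z. h (fst z) (snd z)"]) auto
  qed
qed

lemma cone_homotopicI:
  assumes "continuous_on ({0..1::real} \<times> X) (\<lambda>z. h (fst z) (snd z))"
    and "\<And>t x. t \<in> {0..1} \<Longrightarrow> x \<in> X \<Longrightarrow> h t x \<in> X"
    and "\<And>t x. t \<in> {0..1} \<Longrightarrow> x \<in> X \<Longrightarrow> h t x = p \<longleftrightarrow> x = p"
    and "\<And>x. x \<in> X \<Longrightarrow> h 0 x = f x" and "\<And>x. x \<in> X \<Longrightarrow> h 1 x = g x"
  shows "cone_homotopic X p f g"
  unfolding cone_homotopic_iff using assms by (intro exI[of _ h]) blast

lemma cone_homotopic_idE:
  assumes "cone_homotopic X p f id"
  obtains h where "continuous_on ({0..1::real} \<times> X) (\<lambda>z. h (fst z) (snd z))"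
    and "\<And>t x. t \<in> {0..1} \<Longrightarrow> x \<in> X \<Longrightarrow> h t x \<in> X \<and> (h t x = p \<longleftrightarrow> x = p)"
    and "\<And>x. x \<in> X \<Longrightarrow> h 0 x = f x \<and> h 1 x = x"
proof -
  obtain h where "continuous_on ({0..1::real} \<times> X) (\<lambda>z. h (fst z) (snd z))"
    "\<forall>t\<in>{0..1}. \<forall>x\<in>X. h t x \<in> X \<and> (h t x = p \<longleftrightarrow> x = p)"
    "\<forall>x\<in>X. h 0 x = f x \<and> h 1 x = id x"
    using assms unfolding cone_homotopic_iff by blast
  then show ?thesis
    by (intro that[of h]) auto
qed

lemma cone_equivI_inverse:
  assumes f: "cone_map X p Y q f" and g: "continuous_on Y g"
    and gY: "\<And>y. y \<in> Y \<Longrightarrow> g y \<in> X" and gf: "\<And>x. x \<in> X \<Longrightarrow> g (f x) = x" 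
    and fg: "\<And>y. y \<in> Y \<Longrightarrow> f (g y) = y"
  shows "cone_equiv X p Y q"
proof -
  have g': "cone_map Y q X p g"
    unfolding cone_map_def using f g gY gf fg by (metis cone_map_def)
  have "cone_homotopic X p (g \<circ> f) id"
    by (rule cone_homotopicI[where h = "\<lambda>_ x. x"]) (auto simp: gf intro!: continuous_intros)
  moreover have "cone_homotopic Y q (f \<circ> g) id"
    by (rule cone_homotopicI[where h = "\<lambda>_ x. x"]) (auto simp: fg intro!: continuous_intros)
  ultimately show ?thesis
    using f g' unfolding cone_equiv_def by blast
qed

lemma cone_equiv_refl: "cone_equiv X p X p"
  by (rule cone_equivI_inverse[where f = id and g = id]) (auto simp: cone_map_def)

lemma cone_equiv_sym: "cone_equiv X p Y q \<Longrightarrow> cone_equiv Y q X p"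
  unfolding cone_equiv_def by blast

lemma cone_map_compose:
  "cone_map X p Y q f \<Longrightarrow> cone_map Y q Z r g \<Longrightarrow> cone_map X p Z r (g \<circ> f)"
  unfolding cone_map_def by (auto intro!: continuous_on_compose2[of Y g X f])

text \<open>Serves transitivity, where \<open>k\<close> is the round trip through the third space:
  the homotopy from \<open>k\<close> to the identity is run between \<open>f\<close> and
  \<open>g\<close>, and then the homotopy for \<open>g \<circ> f\<close> takes over.\<close>

lemma cone_homotopic_conj:
  assumes f: "cone_map X p Y q f" and g: "cone_map Y q X p g"
    and gf: "cone_homotopic X p (g \<circ> f) id" and k: "cone_homotopic Y q k id"
  shows "cone_homotopic X p (g \<circ> k \<circ> f) id"
proof -
  obtain h where h: "continuous_on ({0..1::real} \<times> Y) (\<lambda>z. h (fst z) (snd z))"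
    "\<And>t y. t \<in> {0..1} \<Longrightarrow> y \<in> Y \<Longrightarrow> h t y \<in> Y \<and> (h t y = q \<longleftrightarrow> y = q)"
    "\<And>y. y \<in> Y \<Longrightarrow> h 0 y = k y \<and> h 1 y = y"
    using k by (auto elim: cone_homotopic_idE)
  have fX: "continuous_on X f" "\<And>x. x \<in> X \<Longrightarrow> f x \<in> Y" "\<And>x. x \<in> X \<Longrightarrow> f x = q \<longleftrightarrow> x = p"
    and gY: "continuous_on Y g" "\<And>y. y \<in> Y \<Longrightarrow> g y \<in> X" "\<And>y. y \<in> Y \<Longrightarrow> g y = p \<longleftrightarrow> y = q"
    using f g by (auto simp: cone_map_def)
  have "cone_homotopic X p (g \<circ> k \<circ> f) (g \<circ> f)"
  proof (rule cone_homotopicI[where h = "\<lambda>t x. g (h t (f x))"])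
    have "continuous_on ({0..1} \<times> X) (\<lambda>z. (\<lambda>w. h (fst w) (snd w)) (fst z, f (snd z)))"
      using fX(2) by (intro continuous_on_compose2[OF h(1)] continuous_intros continuous_on_compose2[OF fX(1)]) auto
    then have "continuous_on ({0..1} \<times> X) (\<lambda>z. h (fst z) (f (snd z)))"
      by simp
    then show "continuous_on ({0..1} \<times> X) (\<lambda>z. g (h (fst z) (f (snd z))))"
      by (rule continuous_on_compose2[OF gY(1)]) (use fX h in auto)
  qed (use fX gY h in auto)
  then show ?thesis
    using gf unfolding cone_homotopic_def by (rule homotopic_with_trans)
qed

lemma cone_equiv_trans:
  assumes "cone_equiv X p Y q" "cone_equiv Y q Z r"
  shows "cone_equiv X p Z r"
proof -
  obtain f g where fg: "cone_map X p Y q f" "cone_map Y q X p g"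
    "cone_homotopic X p (g \<circ> f) id" "cone_homotopic Y q (f \<circ> g) id"
    using assms(1) unfolding cone_equiv_def by blast
  obtain f' g' where fg': "cone_map Y q Z r f'" "cone_map Z r Y q g'"
    "cone_homotopic Y q (g' \<circ> f') id" "cone_homotopic Z r (f' \<circ> g') id"
    using assms(2) unfolding cone_equiv_def by blast
  have "cone_homotopic X p ((g \<circ> g') \<circ> (f' \<circ> f)) id"
    using cone_homotopic_conj[OF fg(1,2,3) fg'(3)] by (simp add: o_assoc)
  moreover have "cone_homotopic Z r ((f' \<circ> f) \<circ> (g \<circ> g')) id"
    using cone_homotopic_conj[OF fg'(2,1,4) fg(4)] by (simp add: o_assoc)
  ultimately show ?thesis
    using cone_map_compose[OF fg(1) fg'(1)] cone_map_compose[OF fg'(2) fg(2)]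
    unfolding cone_equiv_def by blast
qed

lemma continuous_on_map_prod:
  assumes "continuous_on X f" "continuous_on Y g"
  shows "continuous_on (X \<times> Y) (map_prod f g)"
  unfolding map_prod_def split_def
  by (intro continuous_intros continuous_on_compose2[OF assms(1)] continuous_on_compose2[OF assms(2)]) auto

lemma cone_map_Times:
  assumes "cone_map X p X' p' f" "cone_map Y q Y' q' g"
  shows "cone_map (X \<times> Y) (p, q) (X' \<times> Y') (p', q') (map_prod f g)"
  using assms by (auto simp: cone_map_def intro: continuous_on_map_prod)

lemma cone_homotopic_Times:
  assumes "cone_homotopic X p f id" "cone_homotopic Y q g id"
  shows "cone_homotopic (X \<times> Y) (p, q) (map_prod f g) id"
proof -
  obtain h where h: "continuous_on ({0..1::real} \<times> X) (\<lambda>z. h (fst z) (snd z))"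
    "\<And>t y. t \<in> {0..1} \<Longrightarrow> y \<in> X \<Longrightarrow> h t y \<in> X \<and> (h t y = p \<longleftrightarrow> y = p)"
    "\<And>y. y \<in> X \<Longrightarrow> h 0 y = f y \<and> h 1 y = y"
    using assms(1) by (auto elim: cone_homotopic_idE)
  obtain k where k: "continuous_on ({0..1::real} \<times> Y) (\<lambda>z. k (fst z) (snd z))"
    "\<And>t y. t \<in> {0..1} \<Longrightarrow> y \<in> Y \<Longrightarrow> k t y \<in> Y \<and> (k t y = q \<longleftrightarrow> y = q)"
    "\<And>y. y \<in> Y \<Longrightarrow> k 0 y = g y \<and> k 1 y = y"
    using assms(2) by (auto elim: cone_homotopic_idE)
  show ?thesis
  proof (rule cone_homotopicI[where h = "\<lambda>t x. (h t (fst x), k t (snd x))"])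
    have "continuous_on ({0..1} \<times> X \<times> Y) (\<lambda>z. (\<lambda>w. h (fst w) (snd w)) (fst z, fst (snd z)))"
      by (intro continuous_on_compose2[OF h(1)] continuous_intros) auto
    moreover have "continuous_on ({0..1} \<times> X \<times> Y) (\<lambda>z. (\<lambda>w. k (fst w) (snd w)) (fst z, snd (snd z)))"
      by (intro continuous_on_compose2[OF k(1)] continuous_intros) auto
    ultimately show "continuous_on ({0..1} \<times> X \<times> Y) (\<lambda>z. (h (fst z) (fst (snd z)), k (fst z) (snd (snd z))))"
      by (intro continuous_on_Pair) simp_all
    show "(h t (fst x), k t (snd x)) = (p, q) \<longleftrightarrow> x = (p, q)" if "t \<in> {0..1}" "x \<in> X \<times> Y" for t x
      using h(2)[of t "fst x"] k(2)[of t "snd x"] that by (metis Pair_inject mem_Times_iff prod.collapse)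
  qed (use h k in auto)
qed

text \<open>The cone over a join is the product of the cones, so this is the invariance of joins
  under homotopy equivalence. A pair is at the apex exactly when both components are, hence the apex
  condition passes to products at every stage of a homotopy.\<close>

lemma cone_equiv_Times:
  assumes "cone_equiv X p X' p'" "cone_equiv Y q Y' q'"
  shows "cone_equiv (X \<times> Y) (p, q) (X' \<times> Y') (p', q')"
proof -
  obtain f g where fg: "cone_map X p X' p' f" "cone_map X' p' X p g"
    "cone_homotopic X p (g \<circ> f) id" "cone_homotopic X' p' (f \<circ> g) id"
    using assms(1) unfolding cone_equiv_def by blast
  obtain f' g' where fg': "cone_map Y q Y' q' f'" "cone_map Y' q' Y q g'"
    "cone_homotopic Y q (g' \<circ> f') id" "cone_homotopic Y' q' (f' \<circ> g') id"
    using assms(2) unfolding cone_equiv_def by blast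
  show ?thesis
    unfolding cone_equiv_def
    using cone_map_Times[OF fg(1) fg'(1)] cone_map_Times[OF fg(2) fg'(2)]
      cone_homotopic_Times[OF fg(3) fg'(3)] cone_homotopic_Times[OF fg(4) fg'(4)]
    by (metis map_prod_compose)
qed

section \<open>Removing the apexes\<close>

lemma homotopy_eqvI:
  fixes X :: "'a::topological_space set" and Y :: "'b::topological_space set"
  assumes f: "continuous_on X f" "\<And>x. x \<in> X \<Longrightarrow> f x \<in> Y"
    and g: "continuous_on Y g" "\<And>y. y \<in> Y \<Longrightarrow> g y \<in> X"
    and h: "continuous_on ({0..1::real} \<times> X) (\<lambda>z. h (fst z) (snd z))"
      "\<And>t x. t \<in> {0..1} \<Longrightarrow> x \<in> X \<Longrightarrow> h t x \<in> X"
      "\<And>x. x \<in> X \<Longrightarrow> h 0 x = g (f x)" "\<And>x. x \<in> X \<Longrightarrow> h 1 x = x"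
    and k: "continuous_on ({0..1::real} \<times> Y) (\<lambda>z. k (fst z) (snd z))"
      "\<And>t y. t \<in> {0..1} \<Longrightarrow> y \<in> Y \<Longrightarrow> k t y \<in> Y"
      "\<And>y. y \<in> Y \<Longrightarrow> k 0 y = f (g y)" "\<And>y. y \<in> Y \<Longrightarrow> k 1 y = y"
  shows "X homotopy_eqv Y"
proof -
  have "homotopic_with_canon (\<lambda>_. True) X X (g \<circ> f) id"
    by (subst homotopic_with, simp, rule exI[of _ "\<lambda>z. h (fst z) (snd z)"])
      (use h in \<open>auto\<close>)
  moreover have "homotopic_with_canon (\<lambda>_. True) Y Y (f \<circ> g) id"
    by (subst homotopic_with, simp, rule exI[of _ "\<lambda>z. k (fst z) (snd z)"])
      (use k in \<open>auto\<close>)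
  ultimately show ?thesis
    unfolding homotopy_equivalent_space_def using f g
    by (intro exI[of _ f] exI[of _ g]) auto
qed

lemma cone_equiv_imp_punctured_homotopy_eqv:
  assumes "cone_equiv X p Y q"
  shows "(X - {p}) homotopy_eqv (Y - {q})"
proof -
  obtain f g where fg: "cone_map X p Y q f" "cone_map Y q X p g"
    "cone_homotopic X p (g \<circ> f) id" "cone_homotopic Y q (f \<circ> g) id"
    using assms(1) unfolding cone_equiv_def by blast
  obtain h where h: "continuous_on ({0..1::real} \<times> X) (\<lambda>z. h (fst z) (snd z))"
    "\<And>t y. t \<in> {0..1} \<Longrightarrow> y \<in> X \<Longrightarrow> h t y \<in> X \<and> (h t y = p \<longleftrightarrow> y = p)"
    "\<And>y. y \<in> X \<Longrightarrow> h 0 y = g (f y) \<and> h 1 y = y"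
    using fg(3) by (auto elim: cone_homotopic_idE)
  obtain k where k: "continuous_on ({0..1::real} \<times> Y) (\<lambda>z. k (fst z) (snd z))"
    "\<And>t y. t \<in> {0..1} \<Longrightarrow> y \<in> Y \<Longrightarrow> k t y \<in> Y \<and> (k t y = q \<longleftrightarrow> y = q)"
    "\<And>y. y \<in> Y \<Longrightarrow> k 0 y = f (g y) \<and> k 1 y = y"
    using fg(4) by (auto elim: cone_homotopic_idE)
  show ?thesis
    using fg(1,2) h k unfolding cone_map_def
    by (intro homotopy_eqvI[where f = f and g = g and h = h and k = k])
      (auto intro: continuous_on_subset)
qed

section \<open>Stars\<close>

text \<open>
  The star on \<open>I\<close> has one ray for each element of \<open>I\<close>, where the coordinate \<open>s\<close> is positive, and one further
  unlabelled ray \<open>s \<le> 0\<close>. For \<open>s \<le> 0\<close> the label of \<open>star_point\<close> is irrelevant.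
\<close>

definition star_point :: "'i \<Rightarrow> real \<Rightarrow> real \<times> ('i \<Rightarrow> real)"
  where "star_point l s = (s, \<lambda>i. if i = l then max s 0 else 0)"

definition star :: "'i set \<Rightarrow> (real \<times> ('i \<Rightarrow> real)) set"
  where "star I = {star_point l s | l s. s > 0 \<longrightarrow> l \<in> I}"

definition star_centre :: "real \<times> ('i \<Rightarrow> real)"
  where "star_centre = (0, \<lambda>_. 0)"

text \<open>Translation by \<open>c\<close> along each ray towards the centre and from there out
  along the unlabelled ray. It is written in coordinates, without reference to a label, so that
  continuity is visible. This needs \<open>c \<ge> 0\<close>: a negative \<open>c\<close> would make
  all label coordinates positive at once.\<close>

definition star_shrink :: "real \<Rightarrow> real \<times> ('i \<Rightarrow> real) \<Rightarrow> real \<times> ('i \<Rightarrow> real)"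
  where "star_shrink c x = (fst x - c, \<lambda>i. max (snd x i - c) 0)"

lemma star_point_eq_centre_iff: "star_point l s = star_centre \<longleftrightarrow> s = 0"
  by (auto simp: star_point_def star_centre_def)

lemma fst_star_point [simp]: "fst (star_point l s) = s"
  by (simp add: star_point_def)

lemma star_pointI: "(s > 0 \<Longrightarrow> l \<in> I) \<Longrightarrow> star_point l s \<in> star I"
  by (auto simp: star_def)

lemma starE:
  assumes "x \<in> star I"
  obtains l s where "x = star_point l s" "s > 0 \<Longrightarrow> l \<in> I"
  using assms by (auto simp: star_def)

lemma star_shrink_star_point: "c \<ge> 0 \<Longrightarrow> star_shrink c (star_point l s) = star_point l (s - c)"
  by (auto simp: star_shrink_def star_point_def fun_eq_iff)

lemma star_shrink_in_star: "x \<in> star I \<Longrightarrow> c \<ge> 0 \<Longrightarrow> star_shrink c x \<in> star I"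
  by (auto elim!: starE simp: star_shrink_star_point intro!: star_pointI)

lemma star_eq_centre_iff: "x \<in> star I \<Longrightarrow> x = star_centre \<longleftrightarrow> fst x = 0"
  by (auto elim!: starE simp: star_point_eq_centre_iff)

lemma continuous_on_coordinate [continuous_intros]:
  "continuous_on S (\<lambda>x. x i)"
  by (rule continuous_on_product_then_coordinatewise) (rule continuous_on_id)

lemma continuous_on_if_const [continuous_intros]:
  "continuous_on S f \<Longrightarrow> continuous_on S g \<Longrightarrow> continuous_on S (\<lambda>x. if P then f x else g x)"
  by (cases P) auto

lemma continuous_on_fst_coordinate [continuous_intros]:
  "continuous_on S f \<Longrightarrow> continuous_on S (\<lambda>x. fst (f x) i)"
  by (rule continuous_on_product_then_coordinatewise) (rule continuous_on_fst)

lemma continuous_on_snd_coordinate [continuous_intros]: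
  "continuous_on S f \<Longrightarrow> continuous_on S (\<lambda>x. snd (f x) i)"
  by (rule continuous_on_product_then_coordinatewise) (rule continuous_on_snd)

lemma continuous_on_star_shrink:
  assumes "continuous_on X c" "continuous_on X f"
  shows "continuous_on X (\<lambda>x. star_shrink (c x) (f x))"
  unfolding star_shrink_def by (intro continuous_intros assms)

text \<open>A pair of points is recorded by the lower of the two heights and their difference
  \<open>d\<close>. The lower height is positive only if both points lie on labelled rays, which is
  why the new labels are pairs. The exact inverse on heights would raise one of the points, but
  below the centre no label is known along which to raise it; \<open>g\<close> lowers the other one
  instead, which costs \<open>\<bar>d\<bar>\<close> of height and is undone by a homotopy.\<close>

lemma cone_equiv_star_Times_star:
  fixes I :: "'i set" and J :: "'j set"
  assumes "finite I" "finite J"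
  shows "cone_equiv (star I \<times> star J) (star_centre, star_centre)
    (star (I \<times> J) \<times> (UNIV :: real set)) (star_centre, 0)"
proof -
  define f where "f = (\<lambda>z :: (real \<times> ('i \<Rightarrow> real)) \<times> (real \<times> ('j \<Rightarrow> real)).
    ((min (fst (fst z)) (fst (snd z)), \<lambda>p. min (snd (fst z) (fst p)) (snd (snd z) (snd p))),
      fst (fst z) - fst (snd z)))"
  \<comment> \<open>Summing over one index recovers the label in the other, since at most one pair
    has a nonzero coordinate.\<close>
  define g where "g = (\<lambda>z :: (real \<times> ('i \<times> 'j \<Rightarrow> real)) \<times> real.
    (star_shrink (max (- snd z) 0) (fst (fst z), \<lambda>i. \<Sum>j\<in>J. snd (fst z) (i, j)),
     star_shrink (max (snd z) 0) (fst (fst z), \<lambda>j. \<Sum>i\<in>I. snd (fst z) (i, j))))"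
  have f: "f (star_point l s, star_point k t) = (star_point (l, k) (min s t), s - t)" for l s k t
    by (auto simp: f_def star_point_def fun_eq_iff)
  have g: "g (star_point (l, k) m, d) = (star_point l (m - max (- d) 0), star_point k (m - max d 0))"
    if "m > 0 \<Longrightarrow> l \<in> I \<and> k \<in> J" for l k m d
  proof -
    have "(\<Sum>j\<in>J. snd (star_point (l, k) m) (i, j)) = snd (star_point l m) i" for i
      using that assms by (auto simp: star_point_def max_def sum.delta)
    moreover have "(\<Sum>i\<in>I. snd (star_point (l, k) m) (i, j)) = snd (star_point k m) j" for j
      using that assms by (auto simp: star_point_def max_def sum.delta)
    ultimately have "g (star_point (l, k) m, d) =
      (star_shrink (max (- d) 0) (star_point l m), star_shrink (max d 0) (star_point k m))"
      unfolding g_def by (simp add: star_point_def)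
    then show ?thesis
      by (simp add: star_shrink_star_point)
  qed
  have fmap: "cone_map (star I \<times> star J) (star_centre, star_centre) (star (I \<times> J) \<times> UNIV) (star_centre, 0) f"
  proof (rule cone_mapI)
    show "continuous_on (star I \<times> star J) f"
      unfolding f_def by (intro continuous_intros)
    fix x :: "(real \<times> ('i \<Rightarrow> real)) \<times> (real \<times> ('j \<Rightarrow> real))"
    assume "x \<in> star I \<times> star J"
    then obtain l a k b where x: "x = (star_point l a, star_point k b)" "a > 0 \<Longrightarrow> l \<in> I" "b > 0 \<Longrightarrow> k \<in> J"
      by (cases x) (auto elim!: starE)
    show "f x \<in> star (I \<times> J) \<times> UNIV"
      using x(2,3) unfolding x(1) by (auto simp: f intro!: star_pointI)
    show "f x = (star_centre, 0) \<longleftrightarrow> x = (star_centre, star_centre)"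
      unfolding x(1) f by (auto simp: star_point_eq_centre_iff)
  qed
  have gmap: "cone_map (star (I \<times> J) \<times> UNIV) (star_centre, 0) (star I \<times> star J) (star_centre, star_centre) g"
  proof (rule cone_mapI)
    show "continuous_on (star (I \<times> J) \<times> UNIV) g"
      unfolding g_def by (intro continuous_intros continuous_on_star_shrink)
    fix x :: "(real \<times> ('i \<times> 'j \<Rightarrow> real)) \<times> real" assume "x \<in> star (I \<times> J) \<times> UNIV"
    then obtain l k m d where x: "x = (star_point (l, k) m, d)" "m > 0 \<Longrightarrow> l \<in> I \<and> k \<in> J"
      by (cases x) (auto elim!: starE)
    show "g x \<in> star I \<times> star J"
      unfolding x(1) using x(2) by (subst g) (auto intro!: star_pointI simp: max_def split: if_splits)
    show "g x = (star_centre, star_centre) \<longleftrightarrow> x = (star_centre, 0)"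
      unfolding x(1) using x(2) by (subst g) (auto simp: star_point_eq_centre_iff max_def)
  qed
  \<comment> \<open>Both points are lowered by the same amount, so the difference of their heights
    is constant; both can be at the centre only if it is zero, and then nothing moves.\<close>
  have "cone_homotopic (star I \<times> star J) (star_centre, star_centre) (g \<circ> f) id"
  proof (rule cone_homotopicI[where h = "\<lambda>t z. let c = (1 - t) * \<bar>fst (fst z) - fst (snd z)\<bar>
        in (star_shrink c (fst z), star_shrink c (snd z))"])
    show "continuous_on ({0..1} \<times> star I \<times> star J) (\<lambda>z. let c = (1 - fst z) * \<bar>fst (fst (snd z)) - fst (snd (snd z))\<bar>
        in (star_shrink c (fst (snd z)), star_shrink c (snd (snd z))))"
      unfolding Let_def by (intro continuous_intros continuous_on_star_shrink)
    fix t :: real and x :: "(real \<times> ('i \<Rightarrow> real)) \<times> (real \<times> ('j \<Rightarrow> real))"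
    assume t: "t \<in> {0..1}" and "x \<in> star I \<times> star J"
    then obtain l a k b where x: "x = (star_point l a, star_point k b)" "a > 0 \<Longrightarrow> l \<in> I" "b > 0 \<Longrightarrow> k \<in> J"
      by (cases x) (auto elim!: starE)
    let ?H = "let c = (1 - t) * \<bar>fst (fst x) - fst (snd x)\<bar> in (star_shrink c (fst x), star_shrink c (snd x))"
    show "?H \<in> star I \<times> star J"
      using t x by (auto simp: Let_def intro!: star_shrink_in_star star_pointI)
    show "?H = (star_centre, star_centre) \<longleftrightarrow> x = (star_centre, star_centre)"
      using t x by (auto simp: Let_def star_shrink_star_point star_point_eq_centre_iff)
  next
    fix x :: "(real \<times> ('i \<Rightarrow> real)) \<times> (real \<times> ('j \<Rightarrow> real))"
    assume "x \<in> star I \<times> star J"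
    then obtain l a k b where x: "x = (star_point l a, star_point k b)" "a > 0 \<Longrightarrow> l \<in> I" "b > 0 \<Longrightarrow> k \<in> J"
      by (cases x) (auto elim!: starE)
    have "g (f x) = (star_point l (min a b - max (- (a - b)) 0), star_point k (min a b - max (a - b) 0))"
      unfolding x(1) f using x(2,3) by (intro g) auto
    also have "min a b - max (- (a - b)) 0 = a - \<bar>a - b\<bar>"
      by (auto simp: max_def min_def)
    also have "min a b - max (a - b) 0 = b - \<bar>a - b\<bar>"
      by (auto simp: max_def min_def)
    finally show "(let c = (1 - 0) * \<bar>fst (fst x) - fst (snd x)\<bar> in (star_shrink c (fst x), star_shrink c (snd x)))
      = (g \<circ> f) x"
      by (simp add: Let_def x star_shrink_star_point)
    show "(let c = (1 - 1) * \<bar>fst (fst x) - fst (snd x)\<bar> in (star_shrink c (fst x), star_shrink c (snd x))) = id x"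
      by (simp add: Let_def x star_shrink_star_point)
  qed
  moreover have "cone_homotopic (star (I \<times> J) \<times> UNIV) (star_centre, 0) (f \<circ> g) id"
  proof (rule cone_homotopicI[where h = "\<lambda>t z. (star_shrink ((1 - t) * \<bar>snd z\<bar>) (fst z), snd z)"])
    show "continuous_on ({0..1} \<times> star (I \<times> J) \<times> (UNIV :: real set))
      (\<lambda>z. (star_shrink ((1 - fst z) * \<bar>snd (snd z)\<bar>) (fst (snd z)), snd (snd z)))"
      by (intro continuous_intros continuous_on_star_shrink)
    fix t :: real and x :: "(real \<times> ('i \<times> 'j \<Rightarrow> real)) \<times> real"
    assume t: "t \<in> {0..1}" and "x \<in> star (I \<times> J) \<times> UNIV"
    then obtain l k m d where x: "x = (star_point (l, k) m, d)" "m > 0 \<Longrightarrow> l \<in> I \<and> k \<in> J"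
      by (cases x) (auto elim!: starE)
    show "(star_shrink ((1 - t) * \<bar>snd x\<bar>) (fst x), snd x) \<in> star (I \<times> J) \<times> UNIV"
      using t x by (auto intro!: star_shrink_in_star star_pointI)
    show "(star_shrink ((1 - t) * \<bar>snd x\<bar>) (fst x), snd x) = (star_centre, 0) \<longleftrightarrow> x = (star_centre, 0)"
      using t x by (auto simp: star_shrink_star_point star_point_eq_centre_iff)
  next
    fix x :: "(real \<times> ('i \<times> 'j \<Rightarrow> real)) \<times> real"
    assume "x \<in> star (I \<times> J) \<times> UNIV"
    then obtain l k m d where x: "x = (star_point (l, k) m, d)" "m > 0 \<Longrightarrow> l \<in> I \<and> k \<in> J"
      by (cases x) (auto elim!: starE)
    have "f (g x) = f (star_point l (m - max (- d) 0), star_point k (m - max d 0))"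
      unfolding x(1) using x(2) by (subst g) auto
    also have "\<dots> = (star_point (l, k) (m - \<bar>d\<bar>), d)"
      unfolding f by (auto simp: max_def min_def abs_if)
    finally show "(star_shrink ((1 - 0) * \<bar>snd x\<bar>) (fst x), snd x) = (f \<circ> g) x"
      by (simp add: x star_shrink_star_point)
    show "(star_shrink ((1 - 1) * \<bar>snd x\<bar>) (fst x), snd x) = id x"
      by (simp add: x star_shrink_star_point)
  qed
  ultimately show ?thesis
    using fmap gmap unfolding cone_equiv_def by blast
qed

lemma cone_equiv_star_bij:
  fixes I :: "'i set" and J :: "'j set"
  assumes "bij_betw h I J"
  shows "cone_equiv (star I) star_centre (star J) star_centre"
proof -
  have h: "\<And>i. i \<in> I \<Longrightarrow> h i \<in> J" "\<And>i. i \<in> I \<Longrightarrow> inv_into I h (h i) = i"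
    "\<And>j. j \<in> J \<Longrightarrow> inv_into I h j \<in> I" "\<And>j. j \<in> J \<Longrightarrow> h (inv_into I h j) = j"
    using assms by (auto simp: bij_betw_def inv_into_into f_inv_into_f)
  define f where "f = (\<lambda>x :: real \<times> ('i \<Rightarrow> real). (fst x, \<lambda>j. if j \<in> J then snd x (inv_into I h j) else 0))"
  define g where "g = (\<lambda>x :: real \<times> ('j \<Rightarrow> real). (fst x, \<lambda>i. if i \<in> I then snd x (h i) else 0))"
  have f: "f (star_point l s) = star_point (h l) s" if "s > 0 \<Longrightarrow> l \<in> I" for l s
    using that h by (cases "s > 0") (auto simp: f_def star_point_def fun_eq_iff)
  have g: "g (star_point l s) = star_point (inv_into I h l) s" if "s > 0 \<Longrightarrow> l \<in> J" for l s
    using that h by (cases "s > 0") (auto simp: g_def star_point_def fun_eq_iff)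
  have f0: "f star_centre = star_centre"
    by (simp add: f_def star_centre_def fun_eq_iff)
  have star_point_cong: "star_point l s = star_point k s" if "s > 0 \<Longrightarrow> l = k" for l k and s
    using that by (cases "s > 0") (auto simp: star_point_def)
  show ?thesis
  proof (rule cone_equivI_inverse)
    show "cone_map (star I) star_centre (star J) star_centre f"
    proof (rule cone_mapI)
      show "continuous_on (star I) f"
        unfolding f_def by (intro continuous_intros)
    qed (auto elim!: starE simp: f f0 h star_point_eq_centre_iff intro!: star_pointI)
    show "continuous_on (star J) g"
      unfolding g_def by (intro continuous_intros)
  qed (auto elim!: starE simp: f g h intro!: star_pointI star_point_cong)
qed

definition euclid :: "nat \<Rightarrow> (nat \<Rightarrow> real) set"
  where "euclid d = {x. \<forall>i\<ge>d. x i = 0}"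

lemma cone_equiv_real_Times_euclid:
  "cone_equiv ((UNIV :: real set) \<times> euclid d) (0, \<lambda>_. 0) (euclid (Suc d)) (\<lambda>_. 0)"
proof (rule cone_equivI_inverse)
  show "cone_map (UNIV \<times> euclid d) (0, \<lambda>_. 0) (euclid (Suc d)) (\<lambda>_. 0)
    (\<lambda>z i. case i of 0 \<Rightarrow> fst z | Suc j \<Rightarrow> snd z j)"
  proof (rule cone_mapI)
    show "continuous_on (UNIV \<times> euclid d) (\<lambda>z i. case i of 0 \<Rightarrow> fst z | Suc j \<Rightarrow> snd z j)"
    proof (rule continuous_on_coordinatewise_then_product)
      show "continuous_on (UNIV \<times> euclid d) (\<lambda>z. case i of 0 \<Rightarrow> fst z | Suc j \<Rightarrow> snd z j)" for i
        by (cases i) (auto intro!: continuous_intros)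
    qed
  qed (auto simp: euclid_def fun_eq_iff split: nat.splits)
  show "continuous_on (euclid (Suc d)) (\<lambda>x. (x 0, \<lambda>i. x (Suc i)))"
    by (intro continuous_intros)
qed (auto simp: euclid_def fun_eq_iff split: nat.splits)

lemma cone_equiv_Times_assoc:
  "cone_equiv (X \<times> Y \<times> Z) (p, q, r) ((X \<times> Y) \<times> Z) ((p, q), r)"
  by (rule cone_equivI_inverse[where f = "\<lambda>z. ((fst z, fst (snd z)), snd (snd z))"
        and g = "\<lambda>z. (fst (fst z), snd (fst z), snd z)"])
    (auto simp: cone_map_def intro!: continuous_intros)

text \<open>Merging two star factors leaves a line over; this is how the dimension grows by one with
  each further discrete set in the join.\<close>

lemma cone_equiv_star_Times_star_euclid:
  assumes "finite I" "finite J"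
  shows "cone_equiv (star I \<times> star J \<times> euclid d) (star_centre, star_centre, \<lambda>_. 0)
    (star (I \<times> J) \<times> euclid (Suc d)) (star_centre, \<lambda>_. 0)"
proof -
  have 1: "cone_equiv ((star I \<times> star J) \<times> euclid d) ((star_centre, star_centre), \<lambda>_. 0)
    ((star (I \<times> J) \<times> UNIV) \<times> euclid d) ((star_centre, 0::real), \<lambda>_. 0)"
    by (intro cone_equiv_Times cone_equiv_star_Times_star cone_equiv_refl assms)
  have 2: "cone_equiv (star (I \<times> J) \<times> (UNIV :: real set) \<times> euclid d) (star_centre, 0, \<lambda>_. 0)
    (star (I \<times> J) \<times> euclid (Suc d)) (star_centre, \<lambda>_. 0)"
    by (intro cone_equiv_Times cone_equiv_refl cone_equiv_real_Times_euclid)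
  show ?thesis
    by (rule cone_equiv_trans[OF cone_equiv_Times_assoc
          cone_equiv_trans[OF 1 cone_equiv_trans[OF cone_equiv_sym[OF cone_equiv_Times_assoc] 2]]])
qed

section \<open>Wedges of spheres as punctured products\<close>

lemma continuous_on_coordinate2 [continuous_intros]:
  "continuous_on S (\<lambda>x. x l i)"
  by (rule continuous_on_product_then_coordinatewise) (rule continuous_on_coordinate)

lemma continuous_on_snd_coordinate2 [continuous_intros]:
  "continuous_on S f \<Longrightarrow> continuous_on S (\<lambda>x. snd (f x) l i)"
  by (rule continuous_on_product_then_coordinatewise) (rule continuous_on_snd_coordinate)

lemma continuous_on_case_nat_const [continuous_intros]:
  assumes "continuous_on S f" "\<And>j. continuous_on S (g j)"
  shows "continuous_on S (\<lambda>x. case i of 0 \<Rightarrow> f x | Suc j \<Rightarrow> g j x)"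
  using assms by (cases i) auto

definition unit_sphere :: "nat \<Rightarrow> (nat \<Rightarrow> real) set"
  where "unit_sphere d = {x. (\<Sum>i\<le>d. (x i)\<^sup>2) = 1 \<and> (\<forall>i>d. x i = 0)}"

definition sphere_base :: "nat \<Rightarrow> real"
  where "sphere_base = (\<lambda>i. if i = 0 then 1 else 0)"

definition wedge_point :: "nat \<Rightarrow> (nat \<Rightarrow> real) \<Rightarrow> nat \<Rightarrow> nat \<Rightarrow> real"
  where "wedge_point l x = (\<lambda>i. if i = l then x else sphere_base)"

text \<open>The wedge as the union of the coordinate axes in a product of spheres; as a subset of a
  function space it is accessible to \<open>continuous_on\<close>. The factors are indexed by all
  naturals, so the ambient space does not depend on \<open>k\<close>, and the clause for
  \<open>sphere_base\<close> keeps the base point when \<open>k = 0\<close>.\<close>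

definition wedge_model :: "nat \<Rightarrow> nat \<Rightarrow> (nat \<Rightarrow> nat \<Rightarrow> real) set"
  where "wedge_model k d =
    {wedge_point l x | l x. x \<in> unit_sphere d \<and> (l < k \<or> x = sphere_base)}"

lemma nsphere_eq_top_of_set: "nsphere d = top_of_set (unit_sphere d)"
  by (simp add: nsphere unit_sphere_def euclidean_product_topology)

lemma sum_atMost_split_0: "(\<Sum>i\<le>d. f i) = f 0 + (\<Sum>i<d. f (Suc i))" for f :: "nat \<Rightarrow> real"
  by (metis sum.atMost_shift)

lemma unit_sphere_iff:
  "x \<in> unit_sphere d \<longleftrightarrow> (x 0)\<^sup>2 + (\<Sum>i<d. (x (Suc i))\<^sup>2) = 1 \<and> (\<forall>i\<ge>d. x (Suc i) = 0)"
proof -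
  have "(\<forall>i>d. x i = 0) \<longleftrightarrow> (\<forall>i\<ge>d. x (Suc i) = 0)"
    by (metis Suc_le_D Suc_le_eq Suc_le_mono)
  then show ?thesis
    by (simp add: unit_sphere_def sum_atMost_split_0)
qed

lemma sphere_base_in_unit_sphere: "sphere_base \<in> unit_sphere d"
  by (simp add: unit_sphere_iff sphere_base_def)

lemma wedge_point_sphere_base: "wedge_point l sphere_base = (\<lambda>_. sphere_base)"
  by (simp add: wedge_point_def)

lemma wedge_model_coordinate: "F \<in> wedge_model k d \<Longrightarrow> F l \<in> unit_sphere d"
  by (auto simp: wedge_model_def wedge_point_def sphere_base_in_unit_sphere)

text \<open>Closed in a cube, which is compact by Tychonoff's theorem.\<close>

lemma compact_unit_sphere: "compact (unit_sphere d)"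
proof -
  have "compactin (powertop_real UNIV) (PiE UNIV (\<lambda>_. {-1..1::real}))"
    by (simp add: compactin_PiE)
  then have c: "compact (PiE UNIV (\<lambda>_::nat. {-1..1::real}))"
    by (simp add: euclidean_product_topology)
  have "unit_sphere d = {x. (\<Sum>i\<le>d. (x i)\<^sup>2) = 1} \<inter> (\<Inter>i\<in>{d<..}. {x. x i = 0})"
    by (auto simp: unit_sphere_def)
  moreover have "closed {x :: nat \<Rightarrow> real. (\<Sum>i\<le>d. (x i)\<^sup>2) = 1}"
    by (intro closed_Collect_eq continuous_intros)
  moreover have "closed {x :: nat \<Rightarrow> real. x i = 0}" for i
    by (intro closed_Collect_eq continuous_intros)
  ultimately have "closed (unit_sphere d)"
    by (metis (no_types, lifting) closed_INT closed_Int)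
  moreover have "unit_sphere d \<subseteq> PiE UNIV (\<lambda>_. {-1..1})"
  proof
    fix x assume x: "x \<in> unit_sphere d"
    have "\<bar>x i\<bar> \<le> 1" for i
    proof (cases "i \<le> d")
      case True
      then have "(x i)\<^sup>2 \<le> (\<Sum>i\<le>d. (x i)\<^sup>2)"
        by (intro member_le_sum) auto
      then show ?thesis
        using x by (simp add: unit_sphere_def abs_square_le_1)
    qed (use x in \<open>auto simp: unit_sphere_def\<close>)
    then show "x \<in> PiE UNIV (\<lambda>_. {-1..1})"
      by (auto simp: abs_le_iff minus_le_iff)
  qed
  ultimately show ?thesis
    using c by (metis compact_Int_closed inf.absorb_iff2)
qed

text \<open>A continuous bijection from a compact to a Hausdorff space is a homeomorphism;
  compactness comes from the finite number of spheres. The assumption excludes the empty space that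
  \<open>sphere_wedge\<close> returns for a positive number of spheres of negative
  dimension.\<close>

lemma sphere_wedge_homeomorphic_wedge_model:
  assumes "k = 0 \<or> d \<ge> 0"
  shows "sphere_wedge k d homeomorphic_space top_of_set (wedge_model k (nat d))"
proof -
  define W where "W = wedge_sum (\<lambda>_. top_of_set (unit_sphere (nat d))) (\<lambda>_. sphere_base) {..<k}"
  have W: "sphere_wedge k d = W"
    using assms by (auto simp: sphere_wedge_def W_def nsphere_eq_top_of_set sphere_base_def)
  define \<omega> where "\<omega> = (\<lambda>w. case w of None \<Rightarrow> \<lambda>_. sphere_base | Some (l, x) \<Rightarrow> wedge_point l x)"
  have \<omega>: "\<omega> (wedge_map (\<lambda>_. sphere_base) (l, x)) = wedge_point l x" for l x
    by (auto simp: \<omega>_def wedge_map_def wedge_point_sphere_base)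
  have \<omega>_None: "\<omega> None = wedge_point 0 sphere_base"
    by (simp add: \<omega>_def wedge_point_sphere_base)
  let ?S = "unit_sphere (nat d)"
  have topW: "topspace W = insert None (\<Union>l<k. (\<lambda>x. wedge_map (\<lambda>_. sphere_base) (l, x)) ` ?S)"
    unfolding W_def topspace_wedge_sum by auto
  have "continuous_map (top_of_set ?S) W (\<lambda>x. wedge_map (\<lambda>_. sphere_base) (l, x))" if "l < k" for l
    unfolding continuous_map_def
  proof (intro conjI allI impI)
    show "(\<lambda>x. wedge_map (\<lambda>_. sphere_base) (l, x)) \<in> topspace (top_of_set ?S) \<rightarrow> topspace W"
      using that by (auto simp: topW)
    fix U assume "openin W U"
    then have "openin (sum_topology (\<lambda>_. top_of_set ?S) {..<k})
      {y \<in> topspace (sum_topology (\<lambda>_. top_of_set ?S) {..<k}). wedge_map (\<lambda>_. sphere_base) y \<in> U}"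
      by (simp add: W_def openin_wedge_sum)
    then show "openin (top_of_set ?S) {x \<in> topspace (top_of_set ?S). wedge_map (\<lambda>_. sphere_base) (l, x) \<in> U}"
      using that by (auto simp: openin_sum_topology)
  qed
  then have "compactin W ((\<lambda>x. wedge_map (\<lambda>_. sphere_base) (l, x)) ` ?S)" if "l < k" for l
    using that compact_unit_sphere by (intro image_compactin[of "top_of_set ?S"]) (auto simp: compactin_subtopology)
  moreover have "compactin W {None}"
    by (simp add: topW)
  ultimately have "compactin W ({None} \<union> (\<Union>l<k. (\<lambda>x. wedge_map (\<lambda>_. sphere_base) (l, x)) ` ?S))"
    by (intro compactin_Un compactin_Union) auto
  then have comp: "compact_space W"
    by (simp add: compact_space_def topW)
  have cont: "continuous_map W (top_of_set (wedge_model k (nat d))) \<omega>"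
    unfolding continuous_map_def
  proof (intro conjI allI impI)
    show "\<omega> \<in> topspace W \<rightarrow> topspace (top_of_set (wedge_model k (nat d)))"
      using sphere_base_in_unit_sphere by (auto simp: topW \<omega> \<omega>_None wedge_model_def) blast
    fix U assume U: "openin (top_of_set (wedge_model k (nat d))) U"
    have "openin (top_of_set ?S) {x \<in> ?S. wedge_point l x \<in> U}" if "l < k" for l
    proof -
      have "continuous_on ?S (wedge_point l)"
        unfolding wedge_point_def by (intro continuous_intros continuous_on_coordinatewise_then_product)
      moreover have "wedge_point l \<in> ?S \<rightarrow> wedge_model k (nat d)"
        using that by (auto simp: wedge_model_def)
      ultimately have "openin (top_of_set ?S) (?S \<inter> wedge_point l -` U)"
        using U by (intro continuous_openin_preimage) auto
      then show ?thesis
        by (simp add: Int_def vimage_def)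
    qed
    then have "openin (sum_topology (\<lambda>_. top_of_set ?S) {..<k}) (Sigma {..<k} (\<lambda>l. {x \<in> ?S. wedge_point l x \<in> U}))"
      by (simp add: openin_disjoint_union)
    also have "Sigma {..<k} (\<lambda>l. {x \<in> ?S. wedge_point l x \<in> U}) =
      {y \<in> topspace (sum_topology (\<lambda>_. top_of_set ?S) {..<k}).
        wedge_map (\<lambda>_. sphere_base) y \<in> {w \<in> topspace W. \<omega> w \<in> U}}"
      by (auto simp: \<omega>[symmetric] topW)
    finally show "openin W {w \<in> topspace W. \<omega> w \<in> U}"
      unfolding W_def openin_wedge_sum topspace_wedge_sum by auto
  qed
  have "homeomorphic_map W (top_of_set (wedge_model k (nat d))) \<omega>"
  proof (rule continuous_imp_homeomorphic_map[OF cont comp])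
    show "Hausdorff_space (top_of_set (wedge_model k (nat d)))"
      by (intro Hausdorff_space_subtopology) simp
    show "\<omega> ` topspace W = topspace (top_of_set (wedge_model k (nat d)))"
    proof
      show "\<omega> ` topspace W \<subseteq> topspace (top_of_set (wedge_model k (nat d)))"
        using cont by (simp add: continuous_map_def image_subset_iff_funcset)
      show "topspace (top_of_set (wedge_model k (nat d))) \<subseteq> \<omega> ` topspace W"
      proof
        fix F assume "F \<in> topspace (top_of_set (wedge_model k (nat d)))"
        then obtain l x where F: "F = wedge_point l x" "x \<in> ?S" "l < k \<or> x = sphere_base"
          by (auto simp: wedge_model_def)
        show "F \<in> \<omega> ` topspace W"
        proof (cases "l < k")
          case True
          then show ?thesis
            using F by (intro image_eqI[of _ _ "wedge_map (\<lambda>_. sphere_base) (l, x)"]) (auto simp: \<omega> topW)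
        next
          case False
          then show ?thesis
            using F by (intro image_eqI[of _ _ None]) (auto simp: \<omega>_def topW wedge_point_sphere_base)
        qed
      qed
    qed
    show "inj_on \<omega> (topspace W)"
    proof -
      have "wedge_map (\<lambda>_. sphere_base) (l, x) = wedge_map (\<lambda>_. sphere_base) (m, y)"
        if "wedge_point l x = wedge_point m y" for l x m y
      proof (cases "l = m")
        case True
        then show ?thesis
          using fun_cong[OF that, of l] by (simp add: wedge_point_def)
      next
        case False
        then show ?thesis
          using fun_cong[OF that, of l] fun_cong[OF that, of m] by (simp add: wedge_point_def wedge_map_def)
      qed
      moreover have "\<exists>l x. w = wedge_map (\<lambda>_. sphere_base) (l, x)" if "w \<in> topspace W" for w
      proof (cases w)
        case None
        then have "w = wedge_map (\<lambda>_. sphere_base) (0, sphere_base)"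
          by (simp add: wedge_map_def)
        then show ?thesis by blast
      qed (use that in \<open>auto simp: topW\<close>)
      ultimately show ?thesis
        unfolding inj_on_def by (metis \<omega>)
    qed
  qed
  then show ?thesis
    unfolding W homeomorphic_space by blast
qed

text \<open>
  For \<open>r = q\<^sup>2 + |y|\<^sup>2\<close> this doubles the angle of \<open>(q, y)\<close> from the pole: it maps the open upper hemisphere
  onto the sphere without its base point, and the equator to the base point.
\<close>

definition bend :: "real \<Rightarrow> real \<Rightarrow> (nat \<Rightarrow> real) \<Rightarrow> nat \<Rightarrow> real"
  where "bend q r y = (\<lambda>i. case i of 0 \<Rightarrow> 1 - 2 * q\<^sup>2 / r | Suc j \<Rightarrow> 2 * q * y j / r)"

lemma bend_0: "bend 0 r y = sphere_base"
  by (auto simp: bend_def sphere_base_def fun_eq_iff split: nat.splits)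

text \<open>For \<open>s > 0\<close> this is the identity
  \<open>(1 - 2 s^2 / r)^2 + 4 s^2 (r - s^2) / r^2 = 1\<close>. For \<open>s \<le> 0\<close> the
  clipped height is \<open>0\<close> and the value is the base point, although \<open>r\<close>
  still contains \<open>s^2\<close>.\<close>

lemma bend_in_unit_sphere:
  assumes "r = s\<^sup>2 + (\<Sum>i<d. (y i)\<^sup>2)" "r > 0" "y \<in> euclid d"
  shows "bend (max s 0) r y \<in> unit_sphere d"
proof (cases "s > 0")
  case True
  have "(\<Sum>i<d. (2 * s * y i / r)\<^sup>2) = (2 * s / r)\<^sup>2 * (\<Sum>i<d. (y i)\<^sup>2)"
    by (simp add: sum_distrib_left power_mult_distrib power_divide)
  also have "\<dots> = (2 * s / r)\<^sup>2 * (r - s\<^sup>2)"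
    using assms(1) by simp
  finally have "(1 - 2 * s\<^sup>2 / r)\<^sup>2 + (\<Sum>i<d. (2 * s * y i / r)\<^sup>2) = 1"
    using assms(2) by (simp add: field_simps power2_eq_square)
  then show ?thesis
    using True assms(3) by (simp add: unit_sphere_iff bend_def euclid_def)
next
  case False
  then show ?thesis
    by (simp add: max_def bend_0 sphere_base_in_unit_sphere)
qed

text \<open>Up to scaling, the punctured product is a union of hemispheres: one lower hemisphere,
  where labels are irrelevant, and \<open>k\<close> upper ones glued to it along the common equator.
  Collapsing the lower hemisphere to the base point turns each upper one into a sphere;
  \<open>f\<close> does this by doubling angles, and \<open>g\<close> places the sphere with index
  \<open>l\<close> as the upper hemisphere \<open>l\<close> together with the lower one.\<close>

lemma punctured_star_homotopy_eqv_wedge_model: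
  "(star {..<k} \<times> euclid d - {(star_centre, \<lambda>_. 0)}) homotopy_eqv (wedge_model k d)"
proof -
  let ?X = "star {..<k} \<times> euclid d - {(star_centre, \<lambda>_. 0)}"
  define r where "r = (\<lambda>z :: (real \<times> (nat \<Rightarrow> real)) \<times> (nat \<Rightarrow> real). (fst (fst z))\<^sup>2 + (\<Sum>i<d. (snd z i)\<^sup>2))"
  have r_pos: "r z > 0" if z: "z \<in> ?X" for z
  proof (rule ccontr)
    assume "\<not> r z > 0"
    moreover have "(\<Sum>i<d. (snd z i)\<^sup>2) \<ge> 0" "(fst (fst z))\<^sup>2 \<ge> 0"
      by (auto intro: sum_nonneg)
    ultimately have 0: "(fst (fst z))\<^sup>2 = 0" "(\<Sum>i<d. (snd z i)\<^sup>2) = 0"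
      unfolding r_def by linarith+
    then have "\<forall>i<d. snd z i = 0"
      by (subst (asm) sum_nonneg_eq_0_iff) auto
    moreover have "\<forall>i\<ge>d. snd z i = 0"
      using z by (auto simp: euclid_def)
    ultimately have "snd z = (\<lambda>_. 0)"
      by (metis not_less)
    moreover have "fst z = star_centre"
      using z 0 by (cases z) (auto simp: star_eq_centre_iff)
    ultimately show False
      using z by (metis Diff_iff prod.collapse singletonI)
  qed
  have XE: "\<exists>l s y. z = (star_point l s, y) \<and> (s > 0 \<longrightarrow> l < k) \<and> y \<in> euclid d"
    if "z \<in> ?X" for z
    using that by (cases z) (auto elim!: starE)
  have WE: "\<exists>l x. F = wedge_point l x \<and> x \<in> unit_sphere d \<and> (l < k \<or> x = sphere_base)"
    if "F \<in> wedge_model k d" for F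
    using that by (auto simp: wedge_model_def)
  define f where "f = (\<lambda>z :: (real \<times> (nat \<Rightarrow> real)) \<times> (nat \<Rightarrow> real). \<lambda>l. bend (snd (fst z) l) (r z) (snd z))"
  \<comment> \<open>All components of \<open>F\<close> except at most one are the base point, which
    contributes \<open>1 - 1 = 0\<close> to the first sum and \<open>0\<close> to the last. An
    exceptional component \<open>x\<close> makes the first sum \<open>1 - x 0\<close>, so the height
    is \<open>- x 0\<close>; the base point itself goes to height \<open>-1\<close>.\<close>
  define g where "g = (\<lambda>F :: nat \<Rightarrow> nat \<Rightarrow> real.
    (((\<Sum>l<k. 1 - F l 0) - 1, \<lambda>l. if l < k then max (- F l 0) 0 else 0), \<lambda>i. \<Sum>l<k. F l (Suc i)))"
  have f: "f (star_point l s, y) = wedge_point l (bend (max s 0) (r (star_point l s, y)) y)" for l s y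
    by (auto simp: f_def star_point_def wedge_point_def fun_eq_iff bend_0)
  have g: "g (wedge_point l x) = (star_point l (- x 0), \<lambda>i. x (Suc i))" if "l < k \<or> x = sphere_base" for l x
  proof (cases "l < k")
    case True
    have "(\<Sum>m<k. 1 - wedge_point l x m 0) = (\<Sum>m<k. if m = l then 1 - x 0 else 0)"
      by (intro sum.cong) (auto simp: wedge_point_def sphere_base_def)
    moreover have "(\<Sum>m<k. wedge_point l x m (Suc i)) = (\<Sum>m<k. if m = l then x (Suc i) else 0)" for i
      by (intro sum.cong) (auto simp: wedge_point_def sphere_base_def)
    ultimately show ?thesis
      using True by (auto simp: g_def star_point_def fun_eq_iff) (auto simp: wedge_point_def sphere_base_def)
  next
    case False
    then have x: "x = sphere_base"
      using that by simp
    show ?thesis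
      unfolding x wedge_point_sphere_base by (simp add: g_def star_point_def fun_eq_iff sphere_base_def)
  qed
  \<comment> \<open>The straight line from \<open>g (f z)\<close> to \<open>z\<close>. The label
    coordinates must be written without knowing the label:
    \<open>2 * snd (fst z) l - \<bar>fst (fst z)\<bar>\<close> is the signed height if
    \<open>l\<close> is the label or the height is not positive, and it is negative for all other
    \<open>l\<close>.\<close>
  define h where "h = (\<lambda>(t::real) (z :: (real \<times> (nat \<Rightarrow> real)) \<times> (nat \<Rightarrow> real)).
    (((1 - t) * (2 * (max (fst (fst z)) 0)\<^sup>2 / r z - 1) + t * fst (fst z),
      \<lambda>l. max ((1 - t) * (2 * (snd (fst z) l)\<^sup>2 / r z - 1) + t * (2 * snd (fst z) l - \<bar>fst (fst z)\<bar>)) 0),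
     \<lambda>i. ((1 - t) * (2 * max (fst (fst z)) 0 / r z) + t) * snd z i))"
  have h: "h t (star_point l s, y) =
      (star_point l ((1 - t) * (2 * (max s 0)\<^sup>2 / r (star_point l s, y) - 1) + t * s),
       \<lambda>i. ((1 - t) * (2 * max s 0 / r (star_point l s, y)) + t) * y i)"
    if "t \<in> {0..1}" for t l s y
  proof -
    have "(1 - t) * -1 + t * - \<bar>s\<bar> \<le> 0"
      by (intro add_nonpos_nonpos mult_nonneg_nonpos) (use that in auto)
    then have "max ((1 - t) * - 1 + t * (- \<bar>s\<bar>)) 0 = 0"
      by (simp add: max_def)
    moreover have "2 * max s 0 - \<bar>s\<bar> = s"
      by (auto simp: max_def)
    ultimately show ?thesis
      by (auto simp: h_def star_point_def fun_eq_iff)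
  qed
  \<comment> \<open>\<open>E\<close> is \<open>f \<circ> g\<close> on a single sphere. Below,
    \<open>N\<close> is the normalised segment from \<open>E x\<close> to \<open>x\<close>, and
    \<open>D\<close> is its squared norm before normalisation.\<close>
  define E where "E = (\<lambda>x :: nat \<Rightarrow> real. bend (max (- x 0) 0) 1 (\<lambda>i. x (Suc i)))"
  define D where "D = (\<lambda>t x. \<Sum>i\<le>d. ((1 - t) * E x i + t * x i)\<^sup>2)"
  have E_sphere: "E x \<in> unit_sphere d" if "x \<in> unit_sphere d" for x
    using that unfolding E_def
    by (intro bend_in_unit_sphere[where s = "- x 0"]) (auto simp: unit_sphere_iff euclid_def)
  have E_base: "E sphere_base = sphere_base"
    by (simp add: E_def bend_0[symmetric] max_def) (simp add: sphere_base_def bend_0)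
  have D_pos: "D t x > 0" if x: "x \<in> unit_sphere d" and t: "t \<in> {0..1}" for t x
  proof -
    \<comment> \<open>The points \<open>E x\<close> and \<open>x\<close> are never antipodal: their
      inner product is \<open>\<bar>x 0\<bar>\<close>.\<close>
    have "(\<Sum>i\<le>d. E x i * x i) \<ge> 0"
    proof (cases "x 0 < 0")
      case True
      have s: "(\<Sum>i<d. (x (Suc i))\<^sup>2) = 1 - (x 0)\<^sup>2"
        using x by (simp add: unit_sphere_iff)
      have "(\<Sum>i\<le>d. E x i * x i) = (1 - 2 * (x 0)\<^sup>2) * x 0 + (\<Sum>i<d. - 2 * x 0 * (x (Suc i))\<^sup>2)"
        unfolding sum_atMost_split_0 using True by (simp add: E_def bend_def power2_eq_square mult.assoc)
      also have "(\<Sum>i<d. - 2 * x 0 * (x (Suc i))\<^sup>2) = - 2 * x 0 * (1 - (x 0)\<^sup>2)"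
        by (simp only: sum_distrib_left[symmetric] s)
      also have "(1 - 2 * (x 0)\<^sup>2) * x 0 + - 2 * x 0 * (1 - (x 0)\<^sup>2) = - x 0"
        by (simp add: algebra_simps)
      finally show ?thesis
        using True by simp
    next
      case False
      then have "E x = sphere_base"
        by (simp add: E_def max_def bend_0)
      then show ?thesis
        using False unfolding sum_atMost_split_0 by (simp add: sphere_base_def)
    qed
    moreover have "D t x = (1 - t)\<^sup>2 * (\<Sum>i\<le>d. (E x i)\<^sup>2) + t\<^sup>2 * (\<Sum>i\<le>d. (x i)\<^sup>2) + 2 * t * (1 - t) * (\<Sum>i\<le>d. E x i * x i)"
      unfolding D_def by (simp add: sum_distrib_left sum.distrib[symmetric] power2_eq_square algebra_simps)
    moreover have "(\<Sum>i\<le>d. (E x i)\<^sup>2) = 1" "(\<Sum>i\<le>d. (x i)\<^sup>2) = 1"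
      using x E_sphere[OF x] by (auto simp: unit_sphere_def)
    ultimately have "D t x \<ge> (1 - t)\<^sup>2 + t\<^sup>2"
      using t by simp
    moreover have "(1 - t)\<^sup>2 + t\<^sup>2 > 0"
      using sum_power2_gt_zero_iff[of "1 - t" t] by auto
    ultimately show ?thesis
      by linarith
  qed
  define N where "N = (\<lambda>t x i. ((1 - t) * E x i + t * x i) / sqrt (D t x))"
  have N_sphere: "N t x \<in> unit_sphere d" if "x \<in> unit_sphere d" "t \<in> {0..1}" for t x
  proof -
    have "(\<Sum>i\<le>d. (N t x i)\<^sup>2) = (\<Sum>i\<le>d. ((1 - t) * E x i + t * x i)\<^sup>2) / D t x"
      using D_pos[OF that] by (simp add: N_def power_divide sum_divide_distrib)
    also have "\<dots> = 1"
      using D_pos[OF that] by (simp add: D_def)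
    finally show ?thesis
      using that(1) E_sphere[OF that(1)] by (simp add: unit_sphere_def N_def)
  qed
  have unit_norm: "(\<Sum>i\<le>d. (x i)\<^sup>2) = 1" if "x \<in> unit_sphere d" for x
    using that by (simp add: unit_sphere_def)
  have N_0: "N 0 x = E x" and N_1: "N 1 x = x" if "x \<in> unit_sphere d" for x
    using unit_norm[OF that] unit_norm[OF E_sphere[OF that]] by (auto simp: N_def D_def)
  have N_base: "N t sphere_base = sphere_base" if "t \<in> {0..1}" for t
  proof -
    have "(1 - t) * sphere_base i + t * sphere_base i = sphere_base i" for i
      by (simp add: algebra_simps)
    then show ?thesis
      using unit_norm[OF sphere_base_in_unit_sphere] by (simp add: N_def D_def E_base)
  qed
  show ?thesis
  proof (rule homotopy_eqvI[where f = f and g = g and h = h and k = "\<lambda>t F l. N t (F l)"])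
    have rne: "r z \<noteq> 0" if "z \<in> ?X" for z
      using r_pos[OF that] by simp
    have rc: "continuous_on S r" for S
      unfolding r_def by (intro continuous_intros)
    show "continuous_on ?X f"
      unfolding f_def bend_def
      by (intro continuous_intros continuous_on_coordinatewise_then_product rc) (use rne in auto)
    show "continuous_on (wedge_model k d) g"
      unfolding g_def by (intro continuous_intros)
    have rc2: "continuous_on S (\<lambda>z. r (snd z))" for S
      unfolding r_def by (intro continuous_intros)
    show "continuous_on ({0..1} \<times> ?X) (\<lambda>z. h (fst z) (snd z))"
      unfolding h_def by (intro continuous_intros rc2) (use rne in auto)
    have Dc: "continuous_on S (\<lambda>z. D (fst z) (snd z l))" for S :: "(real \<times> (nat \<Rightarrow> nat \<Rightarrow> real)) set" and l
      unfolding D_def E_def bend_def by (intro continuous_intros) auto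
    have Dne: "D (fst z) (snd z l) \<noteq> 0" if "z \<in> {0..1} \<times> wedge_model k d" for z l
      using that D_pos[OF wedge_model_coordinate, of "snd z" k "fst z" l] by (auto simp: mem_Times_iff)
    show "continuous_on ({0..1} \<times> wedge_model k d) (\<lambda>z l. N (fst z) (snd z l))"
      unfolding N_def E_def bend_def
      by (intro continuous_intros continuous_on_coordinatewise_then_product Dc) (use Dne in auto)
  next
    fix z assume z: "z \<in> ?X"
    then obtain l s y where zz: "z = (star_point l s, y)" "s > 0 \<longrightarrow> l < k" "y \<in> euclid d"
      using XE by blast
    have b: "bend (max s 0) (r z) y \<in> unit_sphere d"
      using zz r_pos[OF z] by (intro bend_in_unit_sphere) (auto simp: r_def)
    have lb: "l < k \<or> bend (max s 0) (r z) y = sphere_base"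
      using zz(2) by (cases "s > 0") (auto simp: bend_0 max_def)
    show "f z \<in> wedge_model k d"
      using b lb unfolding zz(1) f wedge_model_def by blast
    have "g (f z) = (star_point l (2 * (max s 0)\<^sup>2 / r z - 1), \<lambda>i. 2 * max s 0 * y i / r z)"
      using g[OF lb] unfolding zz(1) f by (simp add: bend_def)
    then show "h 0 z = g (f z)"
      unfolding zz(1) by (subst h) (auto simp: field_simps)
    show "h 1 z = z"
      unfolding zz(1) by (subst h) auto
  next
    fix F assume "F \<in> wedge_model k d"
    then obtain l x where F: "F = wedge_point l x" "x \<in> unit_sphere d" "l < k \<or> x = sphere_base"
      using WE by blast
    have gF: "g F = (star_point l (- x 0), \<lambda>i. x (Suc i))"
      using F(3) unfolding F(1) by (rule g)
    have r1: "r (star_point l (- x 0), \<lambda>i. x (Suc i)) = 1"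
      using F(2) by (simp add: r_def unit_sphere_iff)
    moreover have "r (star_centre, \<lambda>_. 0) = 0"
      by (simp add: r_def star_centre_def)
    ultimately have "(star_point l (- x 0), \<lambda>i. x (Suc i)) \<noteq> (star_centre, \<lambda>_. 0)"
      by (metis zero_neq_one)
    then show "g F \<in> ?X"
      using F(2,3) unfolding gF by (auto intro!: star_pointI simp: unit_sphere_iff euclid_def sphere_base_def)
    have "f (g F) = wedge_point l (E x)"
      unfolding gF f r1 E_def by simp
    moreover have N_F: "(\<lambda>m. N t (F m)) = wedge_point l (N t x)" if "t \<in> {0..1}" for t
      using N_base[OF that] by (auto simp: F(1) wedge_point_def)
    ultimately show "(\<lambda>m. N 0 (F m)) = f (g F)"
      using N_0[OF F(2)] by simp
    show "(\<lambda>m. N 1 (F m)) = F"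
      using N_F[of 1] N_1[OF F(2)] F(1) by simp
  next
    fix t :: real and F assume t: "t \<in> {0..1}" and "F \<in> wedge_model k d"
    then obtain l x where F: "F = wedge_point l x" "x \<in> unit_sphere d" "l < k \<or> x = sphere_base"
      using WE by blast
    have "(\<lambda>m. N t (F m)) = wedge_point l (N t x)"
      using N_base[OF t] by (auto simp: F(1) wedge_point_def)
    then show "(\<lambda>m. N t (F m)) \<in> wedge_model k d"
      using N_sphere[OF F(2) t] F(3) N_base[OF t] unfolding wedge_model_def by auto
  next
    fix t :: real and z assume t: "t \<in> {0..1}" and z: "z \<in> ?X"
    then obtain l s y where zz: "z = (star_point l s, y)" "s > 0 \<longrightarrow> l < k" "y \<in> euclid d"
      using XE by blast
    let ?s = "(1 - t) * (2 * (max s 0)\<^sup>2 / r z - 1) + t * s"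
    let ?c = "(1 - t) * (2 * max s 0 / r z) + t"
    have hz: "h t z = (star_point l ?s, \<lambda>i. ?c * y i)"
      using h[OF t] unfolding zz(1) by blast
    have s_neg: "?s = (1 - t) * -1 + t * s" if "s \<le> 0"
      using that by (simp add: max_def)
    have "?s \<le> 0" if "s \<le> 0"
      unfolding s_neg[OF that] by (intro add_nonpos_nonpos mult_nonneg_nonpos) (use t that in auto)
    then have "star_point l ?s \<in> star {..<k}"
      using zz(2) by (intro star_pointI) force
    moreover have "(\<lambda>i. ?c * y i) \<in> euclid d"
      using zz(3) by (simp add: euclid_def)
    \<comment> \<open>The segment misses the apex. The factor \<open>?c\<close> of \<open>y\<close>
      vanishes only for \<open>t = 0\<close> and \<open>s \<le> 0\<close>, and then the height is
      \<open>-1\<close>; otherwise \<open>y = 0\<close>, so \<open>r z = s^2\<close>, and the height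
      keeps the sign of \<open>s\<close>.\<close>
    moreover have False if 0: "?s = 0" "\<forall>i. ?c * y i = 0"
    proof (cases "?c = 0")
      case True
      have "(1 - t) * (2 * max s 0 / r z) \<ge> 0"
        using t r_pos[OF z] by simp
      moreover have "t \<ge> 0"
        using t by simp
      ultimately have "t = 0"
        using True by linarith
      then have "max s 0 = 0"
        using True r_pos[OF z] by simp
      then show False
        using 0(1) \<open>t = 0\<close> by simp
    next
      case False
      then have "y = (\<lambda>_. 0)"
        using 0(2) by auto
      then have "r z = s\<^sup>2"
        by (simp add: zz(1) r_def)
      moreover from this have "s \<noteq> 0"
        using r_pos[OF z] by auto
      ultimately consider "s > 0" "?s = (1 - t) + t * s" | "s < 0" "?s = (1 - t) * -1 + t * s"
        using s_neg by (cases "s > 0") (auto simp: max_def)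
      then have "?s \<noteq> 0"
      proof cases
        case 1
        then have "?s > 0"
          using t by (cases "t = 0") (auto intro!: add_nonneg_pos mult_pos_pos)
        then show ?thesis by simp
      next
        case 2
        then have "?s < 0"
          using t by (cases "t = 0") (auto intro!: add_nonpos_neg mult_pos_neg)
        then show ?thesis by simp
      qed
      then show False
        using 0(1) by simp
    qed
    ultimately show "h t z \<in> ?X"
      unfolding hz by (auto simp: star_point_eq_centre_iff fun_eq_iff)
  qed
qed

section \<open>Open cones over order complexes\<close>

text \<open>Barycentric coordinates without normalisation: the total mass is the cone parameter, and
  the zero function is the apex, also for empty \<open>P\<close>.\<close>

definition chain_cone :: "'a set \<Rightarrow> ('a \<Rightarrow> 'a \<Rightarrow> bool) \<Rightarrow> ('a \<Rightarrow> real) set"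
  where "chain_cone P r = {x. (\<forall>v. 0 \<le> x v) \<and> (\<forall>v. x v \<noteq> 0 \<longrightarrow> v \<in> P) \<and>
    (\<forall>u v. x u \<noteq> 0 \<longrightarrow> x v \<noteq> 0 \<longrightarrow> r u v \<or> r v u)}"

lemma chain_coneD:
  assumes "x \<in> chain_cone P r"
  shows "0 \<le> x v" "x v \<noteq> 0 \<Longrightarrow> v \<in> P" "v \<notin> P \<Longrightarrow> x v = 0"
    "x u \<noteq> 0 \<Longrightarrow> x v \<noteq> 0 \<Longrightarrow> r u v \<or> r v u"
  using assms by (auto simp: chain_cone_def)

lemma chain_coneI:
  assumes "\<And>v. 0 \<le> x v" "\<And>v. x v \<noteq> 0 \<Longrightarrow> v \<in> P"
    "\<And>u v. x u \<noteq> 0 \<Longrightarrow> x v \<noteq> 0 \<Longrightarrow> r u v \<or> r v u"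
  shows "x \<in> chain_cone P r"
  using assms by (auto simp: chain_cone_def)

lemma chain_cone_empty: "chain_cone {} r = {\<lambda>_. 0}"
  by (auto simp: chain_cone_def)

lemma geometric_realization_order_complex:
  assumes "finite P"
  shows "geometric_realization (order_complex P r) =
    top_of_set {x \<in> chain_cone P r. (\<Sum>v\<in>P. x v) = 1}"
proof -
  have "(\<forall>v. 0 \<le> x v) \<and> {v. x v \<noteq> 0} \<in> order_complex P r \<and> (\<Sum>v | x v \<noteq> 0. x v) = 1 \<longleftrightarrow>
    x \<in> chain_cone P r \<and> (\<Sum>v\<in>P. x v) = 1" (is "?L \<longleftrightarrow> ?R") for x :: "'a \<Rightarrow> real"
  proof (cases "{v. x v \<noteq> 0} \<subseteq> P")
    case True
    then have "(\<Sum>v | x v \<noteq> 0. x v) = (\<Sum>v\<in>P. x v)"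
      using assms by (intro sum.mono_neutral_left) auto
    moreover have "finite {v. x v \<noteq> 0}"
      using True assms finite_subset by blast
    moreover have "{v. x v \<noteq> 0} \<noteq> {}" if "(\<Sum>v\<in>P. x v) = 1"
      using that by (metis (mono_tags, lifting) empty_Collect_eq sum.neutral zero_neq_one)
    ultimately show ?thesis
      using True by (auto simp: chain_cone_def order_complex_def)
  qed (auto simp: chain_cone_def order_complex_def)
  then show ?thesis
    unfolding geometric_realization_def by (simp add: euclidean_product_topology)
qed

text \<open>Every nonzero point can be divided by its total mass, and scaling by a positive factor
  keeps the support and hence the chain.\<close>

lemma geometric_realization_homotopy_eqv_punctured_chain_cone:
  assumes "finite P"
  shows "geometric_realization (order_complex P r)
    homotopy_equivalent_space top_of_set (chain_cone P r - {\<lambda>_. 0})"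
  unfolding geometric_realization_order_complex[OF assms]
proof (rule homotopy_eqvI[where f = "\<lambda>x. x" and g = "\<lambda>x v. x v / (\<Sum>u\<in>P. x u)"
      and h = "\<lambda>_ x. x" and k = "\<lambda>t x v. ((1 - t) / (\<Sum>u\<in>P. x u) + t) * x v"])
  have pos: "(\<Sum>u\<in>P. x u) > 0" if x: "x \<in> chain_cone P r - {\<lambda>_. 0}" for x
  proof -
    have "x \<noteq> (\<lambda>_. 0)" and x': "x \<in> chain_cone P r"
      using x by simp_all
    then obtain v where v: "x v \<noteq> 0"
      by (meson ext)
    have "x v > 0"
      using chain_coneD(1)[OF x', of v] v by simp
    then show ?thesis
      using chain_coneD(1)[OF x'] chain_coneD(2)[OF x' v] assms by (intro sum_pos2[of P v]) simp_all
  qed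
  have scale: "(\<lambda>v. c * x v) \<in> chain_cone P r" if "c \<ge> 0" "x \<in> chain_cone P r" for c :: real and x
    using that by (auto simp: chain_cone_def)
  show "continuous_on (chain_cone P r - {\<lambda>_. 0}) (\<lambda>x v. x v / (\<Sum>u\<in>P. x u))"
    by (intro continuous_intros continuous_on_coordinatewise_then_product) (use pos in force)
  show "continuous_on ({0..1} \<times> (chain_cone P r - {\<lambda>_. 0}))
    (\<lambda>z v. ((1 - fst z) / (\<Sum>u\<in>P. snd z u) + fst z) * snd z v)"
    by (intro continuous_intros continuous_on_coordinatewise_then_product) (use pos in force)
  show "(\<lambda>v. x v / (\<Sum>u\<in>P. x u)) \<in> {x \<in> chain_cone P r. (\<Sum>v\<in>P. x v) = 1}"
    if "x \<in> chain_cone P r - {\<lambda>_. 0}" for x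
    using scale[of "1 / (\<Sum>u\<in>P. x u)" x] pos[OF that] that by (simp add: sum_divide_distrib[symmetric])
  show "(\<lambda>v. ((1 - t) / (\<Sum>u\<in>P. x u) + t) * x v) \<in> chain_cone P r - {\<lambda>_. 0}"
    if "t \<in> {0..1}" and x: "x \<in> chain_cone P r - {\<lambda>_. 0}" for t x
  proof -
    have "(1 - t) / (\<Sum>u\<in>P. x u) + t > 0"
    proof (cases "t = 0")
      case False
      then show ?thesis
        using that pos[OF x] by (intro add_nonneg_pos) auto
    qed (use pos[OF x] in simp)
    then show ?thesis
      using scale[of "(1 - t) / (\<Sum>u\<in>P. x u) + t" x] x by (auto simp: fun_eq_iff)
  qed
  show "x \<in> chain_cone P r - {\<lambda>_. 0}" if "x \<in> {x \<in> chain_cone P r. (\<Sum>v\<in>P. x v) = 1}" for x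
    using that by auto
qed (auto simp: fun_eq_iff intro!: continuous_intros)

lemma cone_equiv_chain_cone_iso:
  assumes bij: "bij_betw \<phi> P Q" and iso: "\<And>u v. u \<in> P \<Longrightarrow> v \<in> P \<Longrightarrow> r u v \<longleftrightarrow> r' (\<phi> u) (\<phi> v)"
  shows "cone_equiv (chain_cone P r) (\<lambda>_. 0) (chain_cone Q r') (\<lambda>_. 0)"
proof -
  have \<phi>: "\<And>u. u \<in> P \<Longrightarrow> \<phi> u \<in> Q" "\<And>u. u \<in> P \<Longrightarrow> inv_into P \<phi> (\<phi> u) = u"
    "\<And>v. v \<in> Q \<Longrightarrow> inv_into P \<phi> v \<in> P" "\<And>v. v \<in> Q \<Longrightarrow> \<phi> (inv_into P \<phi> v) = v"
    using bij by (auto simp: bij_betw_def inv_into_into f_inv_into_f)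
  let ?f = "\<lambda>(x :: 'a \<Rightarrow> real) v. if v \<in> Q then x (inv_into P \<phi> v) else 0"
  let ?g = "\<lambda>(x :: 'b \<Rightarrow> real) u. if u \<in> P then x (\<phi> u) else 0"
  show ?thesis
  proof (rule cone_equivI_inverse[where f = ?f and g = ?g])
    show "cone_map (chain_cone P r) (\<lambda>_. 0) (chain_cone Q r') (\<lambda>_. 0) ?f"
    proof (rule cone_mapI)
      fix x assume x: "x \<in> chain_cone P r"
      show "?f x \<in> chain_cone Q r'"
        using chain_coneD[OF x] iso \<phi> by (intro chain_coneI) (auto split: if_splits, metis)
      show "?f x = (\<lambda>_. 0) \<longleftrightarrow> x = (\<lambda>_. 0)"
        using chain_coneD(3)[OF x] \<phi> by (auto simp: fun_eq_iff) metis
    qed (intro continuous_intros)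
    show "?g x \<in> chain_cone P r" if x: "x \<in> chain_cone Q r'" for x
      using chain_coneD[OF x] iso \<phi> by (intro chain_coneI) (auto split: if_splits)
  qed (auto simp: fun_eq_iff \<phi> chain_coneD(3) intro!: continuous_intros)
qed

lemma chain_cone_antichain_cases:
  assumes "x \<in> chain_cone A r" "\<And>a b. a \<in> A \<Longrightarrow> b \<in> A \<Longrightarrow> r a b \<Longrightarrow> a = b"
  obtains a where "\<And>b. b \<noteq> a \<Longrightarrow> x b = 0" "x a \<noteq> 0 \<Longrightarrow> a \<in> A"
proof (cases "\<exists>a. x a \<noteq> 0")
  case True
  then obtain a where a: "x a \<noteq> 0" by blast
  then have "x b = 0" if "b \<noteq> a" for b
    using chain_coneD(2,4)[OF assms(1)] assms(2) that by metis
  then show ?thesis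
    using that a chain_coneD(2)[OF assms(1)] by blast
qed (use that in auto)

text \<open>The cone over \<open>A\<close> has one ray for each element. The ray of the chosen
  \<open>b\<close> becomes the unlabelled one, with its height counted negatively, so
  \<open>card A - 1\<close> labels remain.\<close>

lemma cone_equiv_chain_cone_antichain:
  assumes "finite A" "b \<in> A" and anti: "\<And>a c. a \<in> A \<Longrightarrow> c \<in> A \<Longrightarrow> r a c \<longleftrightarrow> a = c"
  shows "cone_equiv (chain_cone A r) (\<lambda>_. 0) (star (A - {b})) star_centre"
proof -
  define f where "f = (\<lambda>x :: 'a \<Rightarrow> real. ((\<Sum>a\<in>A - {b}. x a) - x b, \<lambda>a. if a \<in> A - {b} then x a else 0))"
  define g where "g = (\<lambda>z :: real \<times> ('a \<Rightarrow> real). \<lambda>a. if a = b then max (- fst z) 0 else snd z a)"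
  define \<delta> where "\<delta> = (\<lambda>(a :: 'a) (c::real) v. if v = a then c else (0 :: real))"
  have cone: "\<exists>a c. x = \<delta> a c \<and> c \<ge> 0 \<and> (a \<in> A \<or> c = 0)" if x: "x \<in> chain_cone A r" for x
  proof -
    obtain a where "\<And>b. b \<noteq> a \<Longrightarrow> x b = 0" "x a \<noteq> 0 \<Longrightarrow> a \<in> A"
      using chain_cone_antichain_cases[OF x] anti by metis
    then show ?thesis
      using chain_coneD(1)[OF x, of a] by (intro exI[of _ a] exI[of _ "x a"]) (auto simp: \<delta>_def fun_eq_iff)
  qed
  have \<delta>: "\<delta> a c \<in> chain_cone A r" if "c \<ge> 0" "c \<noteq> 0 \<Longrightarrow> a \<in> A" for a c
    using that anti by (intro chain_coneI) (auto simp: \<delta>_def split: if_splits)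
  have \<delta>0: "\<delta> a c = (\<lambda>_. 0) \<longleftrightarrow> c = 0" for a c
    by (auto simp: \<delta>_def fun_eq_iff)
  have f_b: "f (\<delta> b c) = star_point b (- c)" if "c \<ge> 0" for c
    using that by (auto simp: f_def \<delta>_def star_point_def fun_eq_iff)
  have f_a: "f (\<delta> a c) = star_point a c" if "c \<ge> 0" "a \<in> A" "a \<noteq> b" for a c
    using that assms(1) by (auto simp: f_def \<delta>_def star_point_def fun_eq_iff)
  have f_0: "f (\<delta> a 0) = star_point a 0" for a
    by (auto simp: f_def \<delta>_def star_point_def fun_eq_iff)
  have g: "g (star_point l s) = (if s > 0 then \<delta> l s else \<delta> b (- s))" if "s > 0 \<Longrightarrow> l \<noteq> b" for l s
    using that by (auto simp: g_def \<delta>_def star_point_def fun_eq_iff)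
  have f_cases: "\<exists>l s. f x = star_point l s \<and> (s > 0 \<longrightarrow> l \<in> A - {b}) \<and> (s = 0 \<longleftrightarrow> x = (\<lambda>_. 0)) \<and> g (f x) = x"
    if x: "x \<in> chain_cone A r" for x
  proof -
    obtain a c where ac: "x = \<delta> a c" "c \<ge> 0" "a \<in> A \<or> c = 0"
      using cone[OF x] by blast
    consider "c = 0" | "c > 0" "a = b" | "c > 0" "a \<noteq> b" "a \<in> A"
      using ac by linarith
    then show ?thesis
    proof cases
      case 1
      then have "\<delta> b 0 = x" "x = \<delta> a 0"
        using ac by (auto simp: \<delta>_def)
      then show ?thesis
        using f_0[of a] g[of 0 a] \<delta>0 by (intro exI[of _ a] exI[of _ 0]) auto
    next
      case 2
      then show ?thesis
        using ac f_b[of c] g[of "- c" b] \<delta>0 by (intro exI[of _ b] exI[of _ "- c"]) auto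
    next
      case 3
      then show ?thesis
        using ac f_a[of c a] g[of c a] \<delta>0 by (intro exI[of _ a] exI[of _ c]) auto
    qed
  qed
  show ?thesis
  proof (rule cone_equivI_inverse[where f = f and g = g])
    show "cone_map (chain_cone A r) (\<lambda>_. 0) (star (A - {b})) star_centre f"
    proof (rule cone_mapI)
      show "continuous_on (chain_cone A r) f"
        unfolding f_def by (intro continuous_intros)
      fix x assume "x \<in> chain_cone A r"
      from f_cases[OF this] show "f x \<in> star (A - {b})" "f x = star_centre \<longleftrightarrow> x = (\<lambda>_. 0)"
        by (metis star_pointI, metis star_point_eq_centre_iff)
    qed
    show "continuous_on (star (A - {b})) g"
      unfolding g_def by (intro continuous_intros)
    show "g (f x) = x" if "x \<in> chain_cone A r" for x
      using f_cases[OF that] by blast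
    fix z :: "real \<times> ('a \<Rightarrow> real)" assume "z \<in> star (A - {b})"
    then obtain l s where z: "z = star_point l s" "s > 0 \<Longrightarrow> l \<in> A - {b}"
      by (rule starE) metis
    then have gz: "g z = (if s > 0 then \<delta> l s else \<delta> b (- s))"
      using g[of s l] by auto
    show "g z \<in> chain_cone A r"
      unfolding gz using z(2) assms(2) by (auto intro!: \<delta>)
    show "f (g z) = z"
    proof (cases "s > 0")
      case True
      then show ?thesis
        using z gz f_a by simp
    next
      case False
      moreover from this have "star_point b s = star_point l s"
        by (auto simp: star_point_def)
      ultimately show ?thesis
        using z gz f_b[of "- s"] by simp
    qed
  qed
qed

section \<open>Splitting off a set of minimal elements\<close>

text \<open>
  Of a total mass distributed along a chain, \<open>top_mass r Q t x v\<close> is the part sitting at \<open>v\<close> that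
  belongs to the topmost \<open>t\<close>. Moving only the rest along a decreasing map keeps the support a chain.
\<close>

definition top_mass :: "('a \<Rightarrow> 'a \<Rightarrow> bool) \<Rightarrow> 'a set \<Rightarrow> real \<Rightarrow> ('a \<Rightarrow> real) \<Rightarrow> 'a \<Rightarrow> real"
  where "top_mass r Q t x v = max 0 (min (x v) (t - (\<Sum>u\<in>{u \<in> Q. r v u \<and> u \<noteq> v}. x u)))"

lemma top_mass_nonneg: "top_mass r Q t x v \<ge> 0"
  by (simp add: top_mass_def)

lemma top_mass_le: "x v \<ge> 0 \<Longrightarrow> top_mass r Q t x v \<le> x v"
  by (simp add: top_mass_def)

lemma top_mass_eq_0: "t \<le> 0 \<Longrightarrow> (\<And>u. x u \<ge> 0) \<Longrightarrow> top_mass r Q t x v = 0"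
  unfolding top_mass_def by (smt (verit) sum_nonneg)

lemma top_mass_full:
  assumes "finite Q" "v \<in> Q" "\<And>u. x u \<ge> 0" "t \<ge> (\<Sum>u\<in>Q. x u)"
  shows "top_mass r Q t x v = x v"
proof -
  have "x v + (\<Sum>u\<in>{u \<in> Q. r v u \<and> u \<noteq> v}. x u) = (\<Sum>u\<in>insert v {u \<in> Q. r v u \<and> u \<noteq> v}. x u)"
    using assms(1) by simp
  also have "\<dots> \<le> (\<Sum>u\<in>Q. x u)"
    using assms by (intro sum_mono2) auto
  finally show ?thesis
    using assms(3)[of v] assms(4) by (simp add: top_mass_def)
qed

text \<open>If some of the mass at \<open>v\<close> belongs to the topmost \<open>t\<close>, then
  the mass strictly above \<open>v\<close> is less than \<open>t\<close>, and it includes the mass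
  at \<open>u\<close> and everything above \<open>u\<close>.\<close>

lemma top_mass_above:
  assumes "finite Q" "u \<in> Q" "r v u" "u \<noteq> v" "\<And>u. x u \<ge> 0" "top_mass r Q t x v > 0"
    and "\<And>w. w \<in> Q \<Longrightarrow> r u w \<Longrightarrow> w \<noteq> u \<Longrightarrow> r v w \<and> w \<noteq> v"
  shows "top_mass r Q t x u = x u"
proof -
  have "x u + (\<Sum>w\<in>{w \<in> Q. r u w \<and> w \<noteq> u}. x w) = (\<Sum>w\<in>insert u {w \<in> Q. r u w \<and> w \<noteq> u}. x w)"
    using assms(1) by simp
  also have "\<dots> \<le> (\<Sum>w\<in>{w \<in> Q. r v w \<and> w \<noteq> v}. x w)"
    using assms by (intro sum_mono2) auto
  also have "\<dots> < t"
    using assms(6) by (simp add: top_mass_def max_def min_def split: if_splits)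
  finally show ?thesis
    using assms(5)[of u] by (simp add: top_mass_def)
qed

lemma continuous_on_top_mass:
  assumes "continuous_on S t" "\<And>v. continuous_on S (\<lambda>z. x z v)"
  shows "continuous_on S (\<lambda>z. top_mass r Q (t z) (x z) v)"
  unfolding top_mass_def by (intro continuous_intros assms)

text \<open>The combinatorial core of the join decomposition. The last two assumptions, with
  \<open>f_mono\<close> and antisymmetry, say that \<open>f\<close> maps the elements of
  \<open>P - A\<close> above a fixed \<open>a\<close> isomorphically onto its whole image;
  \<open>minimal\<close> makes \<open>A\<close> an antichain whose elements occur only at the bottom
  of a chain.\<close>

locale poset_split =
  fixes P A :: "'a set" and r :: "'a \<Rightarrow> 'a \<Rightarrow> bool" and f :: "'a \<Rightarrow> 'a"
  assumes finite_P: "finite P" and A_subset: "A \<subseteq> P"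
    and refl: "v \<in> P \<Longrightarrow> r v v"
    and trans: "u \<in> P \<Longrightarrow> v \<in> P \<Longrightarrow> w \<in> P \<Longrightarrow> r u v \<Longrightarrow> r v w \<Longrightarrow> r u w"
    and antisym: "u \<in> P \<Longrightarrow> v \<in> P \<Longrightarrow> r u v \<Longrightarrow> r v u \<Longrightarrow> u = v"
    and minimal: "v \<in> P \<Longrightarrow> a \<in> A \<Longrightarrow> r v a \<Longrightarrow> v = a"
    and f_in: "v \<in> P - A \<Longrightarrow> f v \<in> P - A"
    and f_le: "v \<in> P - A \<Longrightarrow> r (f v) v"
    and f_mono: "u \<in> P - A \<Longrightarrow> v \<in> P - A \<Longrightarrow> r u v \<Longrightarrow> r (f u) (f v)"
    and f_idem: "v \<in> P - A \<Longrightarrow> f (f v) = f v"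
    and f_onto: "a \<in> A \<Longrightarrow> v \<in> P - A \<Longrightarrow> \<exists>u\<in>P - A. r a u \<and> f u = f v"
    and f_reflect: "a \<in> A \<Longrightarrow> u \<in> P - A \<Longrightarrow> v \<in> P - A \<Longrightarrow> r a u \<Longrightarrow> r a v \<Longrightarrow> r (f u) (f v) \<Longrightarrow> r u v"
begin

definition "Q = P - A"
definition "W = f ` Q"

lemma Q_P: "v \<in> Q \<Longrightarrow> v \<in> P" and Q_A: "v \<in> Q \<Longrightarrow> v \<notin> A"
  by (auto simp: Q_def)

lemma finite_Q: "finite Q" and finite_A: "finite A" and finite_W: "finite W"
  using finite_P A_subset finite_subset by (auto simp: Q_def W_def)

lemma f_Q: "v \<in> Q \<Longrightarrow> f v \<in> Q"
  using f_in by (simp add: Q_def)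

lemma f_W: "v \<in> Q \<Longrightarrow> f v \<in> W"
  by (simp add: W_def)

lemma W_Q: "w \<in> W \<Longrightarrow> w \<in> Q"
  by (auto simp: W_def f_Q)

lemma f_fix: "w \<in> W \<Longrightarrow> f w = w"
  by (auto simp: W_def f_idem Q_def)

lemma f_inj: "a \<in> A \<Longrightarrow> u \<in> Q \<Longrightarrow> v \<in> Q \<Longrightarrow> r a u \<Longrightarrow> r a v \<Longrightarrow> f u = f v \<Longrightarrow> u = v"
  using f_reflect f_in refl antisym by (metis Diff_iff Q_def)

definition collapse :: "('a \<Rightarrow> real) \<Rightarrow> ('a \<Rightarrow> real) \<times> ('a \<Rightarrow> real)"
  where "collapse x = (\<lambda>a. if a \<in> A then x a else 0, \<lambda>w. \<Sum>v\<in>{v \<in> Q. f v = w}. x v)"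

text \<open>Homotopy inverse of \<open>collapse\<close>. Mass on \<open>W\<close> need not be
  comparable with an atom \<open>a\<close>, so the mass of \<open>a\<close> is a budget: that much
  of the topmost mass on \<open>W\<close> is lifted to the elements above \<open>a\<close> with the
  same image under \<open>f\<close>, the rest stays on \<open>W\<close>, and \<open>a\<close> keeps
  only what exceeds the whole mass on \<open>W\<close>. On the cone over \<open>A\<close> at most
  one atom has a nonzero budget.\<close>

definition expand :: "('a \<Rightarrow> real) \<times> ('a \<Rightarrow> real) \<Rightarrow> 'a \<Rightarrow> real"
  where "expand z v =
    (if v \<in> A then max (fst z v - (\<Sum>w\<in>W. snd z w)) 0
     else if v \<in> Q then
       (if v \<in> W then snd z v - (\<Sum>a\<in>A. top_mass r W (fst z a) (snd z) v) else 0) +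
       (\<Sum>a\<in>A. if r a v then top_mass r W (fst z a) (snd z) (f v) else 0)
     else 0)"

text \<open>The homotopy from \<open>expand \<circ> collapse\<close> at \<open>\<tau> = 0\<close> to
  the identity at \<open>\<tau> = 1\<close>. The topmost mass that stays in place is the mass on
  \<open>A\<close> plus a share \<open>\<tau>\<close> of the mass \<open>X\<close> on
  \<open>Q\<close>, while the amount subtracted from an atom is the remaining share of
  \<open>X\<close>. This coupling lets an atom survive only when nothing is moved.\<close>

definition push :: "real \<Rightarrow> ('a \<Rightarrow> real) \<Rightarrow> 'a \<Rightarrow> real"
  where "push \<tau> x v =
    (let X = \<Sum>u\<in>Q. x u; e = top_mass r Q ((\<Sum>a\<in>A. x a) + \<tau> * X) x in
     if v \<in> A then max (x v - (1 - \<tau>) * X) 0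
     else if v \<in> Q then e v + (\<Sum>u\<in>{u \<in> Q. f u = v}. x u - e u)
     else 0)"

lemma A_cases:
  assumes "\<alpha> \<in> chain_cone A r"
  obtains a where "\<And>b. b \<noteq> a \<Longrightarrow> \<alpha> b = 0" "\<alpha> a \<noteq> 0 \<Longrightarrow> a \<in> A"
  using chain_cone_antichain_cases[OF assms] minimal A_subset by (metis subsetD)

lemma expand_eq:
  assumes z: "\<alpha> \<in> chain_cone A r" "\<beta> \<in> chain_cone W r"
    and a: "\<And>b. b \<noteq> a \<Longrightarrow> \<alpha> b = 0" "\<alpha> a \<noteq> 0 \<Longrightarrow> a \<in> A"
  shows "v \<in> A \<Longrightarrow> expand (\<alpha>, \<beta>) v = max (\<alpha> v - (\<Sum>w\<in>W. \<beta> w)) 0"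
    and "v \<in> Q \<Longrightarrow> expand (\<alpha>, \<beta>) v = (if v \<in> W then \<beta> v - top_mass r W (\<alpha> a) \<beta> v else 0) +
      (if r a v then top_mass r W (\<alpha> a) \<beta> (f v) else 0)"
    and "v \<notin> P \<Longrightarrow> expand (\<alpha>, \<beta>) v = 0"
proof -
  note nn = chain_coneD(1)[OF z(2)]
  have 0: "top_mass r W (\<alpha> b) \<beta> v = 0" if "b \<noteq> a \<or> a \<notin> A" for b v
    using that a nn by (intro top_mass_eq_0) (metis order_refl)+
  have "(\<Sum>b\<in>A. top_mass r W (\<alpha> b) \<beta> v) = top_mass r W (\<alpha> a) \<beta> v" for v
  proof (cases "a \<in> A")
    case True
    then show ?thesis
      using 0 finite_A by (subst sum.remove[of A a]) auto
  qed (simp add: 0)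
  moreover have "(\<Sum>b\<in>A. if r b v then top_mass r W (\<alpha> b) \<beta> (f v) else 0) =
      (if r a v then top_mass r W (\<alpha> a) \<beta> (f v) else 0)" for v
  proof (cases "a \<in> A")
    case True
    then show ?thesis
      using 0 finite_A by (subst sum.remove[of A a]) (simp_all add: sum.neutral)
  qed (simp add: 0 sum.neutral)
  ultimately show "v \<in> Q \<Longrightarrow> expand (\<alpha>, \<beta>) v = (if v \<in> W then \<beta> v - top_mass r W (\<alpha> a) \<beta> v else 0) +
      (if r a v then top_mass r W (\<alpha> a) \<beta> (f v) else 0)"
    unfolding expand_def fst_conv snd_conv using Q_A by simp
qed (use A_subset in \<open>auto simp: expand_def Q_def\<close>)

lemma expand_in_chain_cone:
  assumes z: "\<alpha> \<in> chain_cone A r" "\<beta> \<in> chain_cone W r"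
  shows "expand (\<alpha>, \<beta>) \<in> chain_cone P r"
proof -
  obtain a where a: "\<And>b. b \<noteq> a \<Longrightarrow> \<alpha> b = 0" "\<alpha> a \<noteq> 0 \<Longrightarrow> a \<in> A"
    using A_cases[OF z(1)] by metis
  note E = expand_eq[OF z a]
  note nn = chain_coneD(1)[OF z(2)]
  define K where "K = top_mass r W (\<alpha> a) \<beta>"
  have K_le: "K w \<le> \<beta> w" and K_nn: "K w \<ge> 0" for w
    using nn by (auto simp: K_def top_mass_le top_mass_nonneg)
  have K_0: "a \<in> A" if "K w \<noteq> 0" for w
    using that a(2) top_mass_eq_0[of "\<alpha> a" \<beta> r W w] nn unfolding K_def by fastforce
  \<comment> \<open>The three kinds of support points. A point of \<open>W\<close> with unlifted
    mass cannot lie strictly above one with lifted mass, so \<open>low\<close> points are below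
    \<open>high\<close> ones. A surviving atom excludes \<open>low\<close> points, since its budget
    then exceeds the whole mass on \<open>W\<close>.\<close>
  define low where "low v \<longleftrightarrow> v \<in> W \<and> K v < \<beta> v" for v
  define high where "high v \<longleftrightarrow> v \<in> Q \<and> a \<in> A \<and> r a v \<and> K (f v) > 0" for v
  define bott where "bott v \<longleftrightarrow> v = a \<and> a \<in> A \<and> \<alpha> a > (\<Sum>w\<in>W. \<beta> w)" for v
  have supp: "bott v \<or> low v \<or> high v" if "expand (\<alpha>, \<beta>) v \<noteq> 0" for v
  proof -
    have "v \<in> P"
      using that E(3) by blast
    then consider "v \<in> A" | "v \<in> Q"
      by (auto simp: Q_def)
    then show ?thesis
    proof cases
      case 1
      then have "\<alpha> v > (\<Sum>w\<in>W. \<beta> w)"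
        using that E(1) by (simp add: max_def split: if_splits)
      moreover have "(\<Sum>w\<in>W. \<beta> w) \<ge> 0"
        by (intro sum_nonneg nn)
      ultimately have "v = a"
        using a(1)[of v] by fastforce
      then show ?thesis
        using 1 \<open>\<alpha> v > _\<close> by (simp add: bott_def)
    next
      case 2
      then have "v \<in> W \<and> K v \<noteq> \<beta> v \<or> r a v \<and> K (f v) \<noteq> 0"
        using that E(2) by (fastforce simp: K_def[symmetric] split: if_splits)
      then show ?thesis
        using 2 K_le[of v] K_nn[of "f v"] K_0[of "f v"] by (auto simp: low_def high_def)
    qed
  qed
  have low_high: "r u v" if u: "low u" and v: "high v" for u v
  proof -
    have uW: "u \<in> W" and vQ: "v \<in> Q"
      using that by (auto simp: low_def high_def)
    then have fvW: "f v \<in> W"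
      by (intro f_W)
    have "\<beta> u \<noteq> 0" "\<beta> (f v) \<noteq> 0"
      using u v K_nn[of u] K_le[of "f v"] by (auto simp: low_def high_def)
    then have "r u (f v) \<or> r (f v) u"
      using chain_coneD(4)[OF z(2)] by blast
    moreover have "u = f v" if "r (f v) u"
    proof (rule ccontr)
      assume "u \<noteq> f v"
      then have "K u = \<beta> u"
        unfolding K_def
      proof (intro top_mass_above[of W u r "f v"])
        show "r (f v) w \<and> w \<noteq> f v" if "w \<in> W" "r u w" "w \<noteq> u" for w
          using that \<open>r (f v) u\<close> uW fvW W_Q Q_P trans[of "f v" u w] antisym[of u w] by metis
      qed (use that finite_W uW nn v in \<open>auto simp: K_def[symmetric] high_def\<close>)
      then show False
        using u by (simp add: low_def)
    qed
    ultimately have "r u (f v)"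
      using refl uW W_Q Q_P by blast
    then show ?thesis
      using f_le[of v] trans[of u "f v" v] uW fvW vQ W_Q Q_P by (auto simp: Q_def)
  qed
  have low_low: "r u v \<or> r v u" if "low u" "low v" for u v
    using that K_nn[of u] K_nn[of v] chain_coneD(4)[OF z(2), of u v] by (auto simp: low_def)
  have high_high: "r u v \<or> r v u" if "high u" "high v" for u v
  proof -
    have "\<beta> (f u) \<noteq> 0" "\<beta> (f v) \<noteq> 0"
      using that K_le[of "f u"] K_le[of "f v"] by (auto simp: high_def)
    then have "r (f u) (f v) \<or> r (f v) (f u)"
      using chain_coneD(4)[OF z(2)] by blast
    then show ?thesis
      using that f_reflect[of a] by (auto simp: high_def Q_def)
  qed
  have bott_low: False if "bott u" "low v" for u v
    using that top_mass_full[of W v \<beta> "\<alpha> a" r] finite_W nn by (auto simp: bott_def low_def K_def)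
  have bott_high: "r u v" if "bott u" "high v" for u v
    using that by (auto simp: bott_def high_def)
  have bott_bott: "r u v" if "bott u" "bott v" for u v
    using that A_subset refl by (auto simp: bott_def)
  show ?thesis
  proof (rule chain_coneI)
    show "0 \<le> expand (\<alpha>, \<beta>) v" for v
    proof -
      consider "v \<in> A" | "v \<in> Q" | "v \<notin> P"
        by (auto simp: Q_def)
      then show ?thesis
        using K_le[of v] K_nn[of "f v"] by cases (simp_all add: E K_def[symmetric])
    qed
    show "v \<in> P" if "expand (\<alpha>, \<beta>) v \<noteq> 0" for v
      using that E(3) by blast
    show "r u v \<or> r v u" if "expand (\<alpha>, \<beta>) u \<noteq> 0" "expand (\<alpha>, \<beta>) v \<noteq> 0" for u v
      using supp[OF that(1)] supp[OF that(2)] low_high low_low high_high bott_low bott_high bott_bott by blast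
  qed
qed

text \<open>The fibre of \<open>f\<close> over a point \<open>w\<close> of \<open>W\<close> contains
  \<open>w\<close> with the unlifted mass and, for an atom \<open>a\<close>, exactly one element
  above \<open>a\<close> (possibly \<open>w\<close> itself) with the lifted mass; pushing forward
  adds the two again. Only the budget is spent.\<close>

lemma collapse_expand:
  assumes z: "\<alpha> \<in> chain_cone A r" "\<beta> \<in> chain_cone W r"
  shows "collapse (expand (\<alpha>, \<beta>)) = (\<lambda>a. max (\<alpha> a - (\<Sum>w\<in>W. \<beta> w)) 0, \<beta>)"
proof -
  obtain a where a: "\<And>b. b \<noteq> a \<Longrightarrow> \<alpha> b = 0" "\<alpha> a \<noteq> 0 \<Longrightarrow> a \<in> A"
    using A_cases[OF z(1)] by metis
  note E = expand_eq[OF z a]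
  note nn = chain_coneD(1)[OF z(2)]
  define K where "K = top_mass r W (\<alpha> a) \<beta>"
  have K_0: "a \<in> A" if "K w \<noteq> 0" for w
    using that a(2) top_mass_eq_0[of "\<alpha> a" \<beta> r W w] nn unfolding K_def by fastforce
  have "(\<Sum>w\<in>W. \<beta> w) \<ge> 0"
    by (intro sum_nonneg nn)
  then have 1: "(if b \<in> A then expand (\<alpha>, \<beta>) b else 0) = max (\<alpha> b - (\<Sum>w\<in>W. \<beta> w)) 0" for b
    using E(1) chain_coneD(3)[OF z(1)] by auto
  have 2: "(\<Sum>v\<in>{v \<in> Q. f v = w}. expand (\<alpha>, \<beta>) v) = \<beta> w" for w
  proof (cases "w \<in> W")
    case True
    let ?F = "{v \<in> Q. f v = w}"
    have fin: "finite ?F"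
      using finite_Q by simp
    have "(\<Sum>v\<in>?F. if v \<in> W then \<beta> v - K v else 0) = (\<Sum>v\<in>?F. if v = w then \<beta> w - K w else 0)"
      using f_fix True by (intro sum.cong) auto
    also have "\<dots> = \<beta> w - K w"
      using True fin W_Q f_fix by (subst sum.delta) auto
    finally have low: "(\<Sum>v\<in>?F. if v \<in> W then \<beta> v - K v else 0) = \<beta> w - K w" .
    have high: "(\<Sum>v\<in>?F. if r a v then K (f v) else 0) = K w"
    proof (cases "a \<in> A")
      case a: True
      obtain u where u: "u \<in> Q" "r a u" "f u = w"
        using f_onto[OF a] True by (auto simp: W_def Q_def)
      have "(\<Sum>v\<in>?F. if r a v then K (f v) else 0) = (\<Sum>v\<in>?F. if v = u then K w else 0)"
        using u f_inj[OF a] by (intro sum.cong) auto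
      also have "\<dots> = K w"
        using fin u by (subst sum.delta) auto
      finally show ?thesis .
    next
      case False
      then have "K v = 0" for v
        using K_0 by blast
      then show ?thesis
        by (simp add: sum.neutral)
    qed
    have "(\<Sum>v\<in>?F. expand (\<alpha>, \<beta>) v) =
      (\<Sum>v\<in>?F. (if v \<in> W then \<beta> v - K v else 0) + (if r a v then K (f v) else 0))"
      using E(2) by (intro sum.cong) (auto simp: K_def)
    then show ?thesis
      by (simp add: sum.distrib low high)
  next
    case False
    then have empty: "{v \<in> Q. f v = w} = {}"
      by (auto simp: W_def)
    show ?thesis
      unfolding empty using chain_coneD(3)[OF z(2) False] by simp
  qed
  show ?thesis
    unfolding collapse_def 1 2 ..
qed

lemma support_above:
  assumes x: "x \<in> chain_cone P r" and a: "a \<in> A" "x a \<noteq> 0" and v: "x v \<noteq> 0" "v \<in> Q"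
  shows "r a v"
  using chain_coneD(4)[OF x a(2) v(1)] minimal[of v a] a v Q_P Q_A by blast

lemma sum_fibres:
  assumes "V \<subseteq> W"
  shows "(\<Sum>w\<in>V. \<Sum>v\<in>{v \<in> Q. f v = w}. x v) = (\<Sum>v\<in>{v \<in> Q. f v \<in> V}. (x v :: real))"
proof -
  have "(\<Sum>w\<in>V. \<Sum>v\<in>{v \<in> {v \<in> Q. f v \<in> V}. f v = w}. x v) = (\<Sum>v\<in>{v \<in> Q. f v \<in> V}. x v)"
    using finite_Q finite_W finite_subset[OF assms] by (intro sum.group) auto
  moreover have "{v \<in> {v \<in> Q. f v \<in> V}. f v = w} = {v \<in> Q. f v = w}" if "w \<in> V" for w
    using that by auto
  ultimately show ?thesis
    by simp
qed

lemma collapse_in_chain_cone: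
  assumes x: "x \<in> chain_cone P r"
  shows "fst (collapse x) \<in> chain_cone A r" "snd (collapse x) \<in> chain_cone W r"
proof -
  note nn = chain_coneD(1)[OF x]
  show "fst (collapse x) \<in> chain_cone A r"
    using nn chain_coneD(4)[OF x] by (intro chain_coneI) (simp_all add: collapse_def split: if_splits)
  have ex: "\<exists>v\<in>Q. f v = w \<and> x v \<noteq> 0" if "snd (collapse x) w \<noteq> 0" for w
  proof (rule ccontr)
    assume "\<not> ?thesis"
    then have "snd (collapse x) w = 0"
      unfolding collapse_def snd_conv by (intro sum.neutral) auto
    then show False
      using that by simp
  qed
  show "snd (collapse x) \<in> chain_cone W r"
  proof (rule chain_coneI)
    show "0 \<le> snd (collapse x) w" for w
      by (auto simp: collapse_def intro!: sum_nonneg nn)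
    show "w \<in> W" if "snd (collapse x) w \<noteq> 0" for w
      using ex[OF that] f_W by blast
    show "r u w \<or> r w u" if uw: "snd (collapse x) u \<noteq> 0" "snd (collapse x) w \<noteq> 0" for u w
    proof -
      obtain u' w' where "u' \<in> Q" "f u' = u" "x u' \<noteq> 0" "w' \<in> Q" "f w' = w" "x w' \<noteq> 0"
        using ex[OF uw(1)] ex[OF uw(2)] by blast
      then show ?thesis
        using chain_coneD(4)[OF x, of u' w'] f_mono[of u' w'] f_mono[of w' u'] by (auto simp: Q_def)
    qed
  qed
qed

text \<open>If an atom \<open>a\<close> carries mass, the support in \<open>Q\<close> lies above
  \<open>a\<close>, where \<open>f\<close> is an isomorphism onto \<open>W\<close>; so the topmost
  mass computed on \<open>W\<close> after collapsing is the one computed on \<open>Q\<close> before.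
  Without mass on an atom both are zero.\<close>

lemma expand_collapse:
  assumes x: "x \<in> chain_cone P r"
  shows "expand (collapse x) = push 0 x"
proof -
  note nn = chain_coneD(1)[OF x]
  define \<alpha> \<beta> where "\<alpha> = fst (collapse x)" and "\<beta> = snd (collapse x)"
  have \<alpha>: "\<alpha> v = (if v \<in> A then x v else 0)" and \<beta>: "\<beta> w = (\<Sum>v\<in>{v \<in> Q. f v = w}. x v)" for v w
    by (auto simp: \<alpha>_def \<beta>_def collapse_def)
  have z: "\<alpha> \<in> chain_cone A r" "\<beta> \<in> chain_cone W r"
    using collapse_in_chain_cone[OF x] by (auto simp: \<alpha>_def \<beta>_def)
  obtain a where a: "\<And>b. b \<noteq> a \<Longrightarrow> \<alpha> b = 0" "\<alpha> a \<noteq> 0 \<Longrightarrow> a \<in> A"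
    using A_cases[OF z(1)] by metis
  note E = expand_eq[OF z a]
  have X: "(\<Sum>w\<in>W. \<beta> w) = (\<Sum>u\<in>Q. x u)"
  proof -
    have "{v \<in> Q. f v \<in> W} = Q"
      using f_W by auto
    then show ?thesis
      unfolding \<beta> using sum_fibres[of W x] by simp
  qed
  have "x b = (if b = a then \<alpha> a else 0)" if "b \<in> A" for b
    using a(1)[of b] \<alpha>[of b] that by auto
  then have "(\<Sum>b\<in>A. x b) = (\<Sum>b\<in>A. if b = a then \<alpha> a else 0)"
    by (intro sum.cong) simp_all
  also have "\<dots> = \<alpha> a"
    using finite_A \<alpha> by (auto simp: sum.delta)
  finally have tA: "(\<Sum>b\<in>A. x b) = \<alpha> a" .
  define e where "e = top_mass r Q (\<alpha> a) x"
  define K where "K = top_mass r W (\<alpha> a) \<beta>"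
  have e_x: "e v = 0" if "x v = 0" for v
    using top_mass_le[of x v r Q "\<alpha> a"] top_mass_nonneg[of r Q "\<alpha> a" x v] that by (simp add: e_def)
  have 1: "(if r a v then K (f v) else 0) = e v \<and> (v \<in> W \<longrightarrow> K v = (\<Sum>u\<in>{u \<in> Q. f u = v}. e u))"
    if v: "v \<in> Q" for v
  proof (cases "\<alpha> a = 0")
    case True
    then have "K w = 0" "e w = 0" for w
      using chain_coneD(1)[OF z(2)] nn by (auto simp: K_def e_def intro!: top_mass_eq_0)
    then show ?thesis
      by (simp add: sum.neutral)
  next
    case False
    then have aA: "a \<in> A"
      by (rule a(2))
    with False have xa: "x a \<noteq> 0"
      by (simp add: \<alpha>)
    have above: "r a u" if "x u \<noteq> 0" "u \<in> Q" for u
      using support_above[OF x aA xa that] .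
    have Ke: "K (f v) = e v" if v: "v \<in> Q" "r a v" for v
    proof -
      have "\<beta> (f v) = (\<Sum>u\<in>{v}. x u)"
        unfolding \<beta> using finite_Q v above f_inj[OF aA]
        by (intro sum.mono_neutral_right) auto
      moreover have "(\<Sum>w\<in>{w \<in> W. r (f v) w \<and> w \<noteq> f v}. \<beta> w) = (\<Sum>u\<in>{u \<in> Q. r v u \<and> u \<noteq> v}. x u)"
      proof -
        have "(\<Sum>w\<in>{w \<in> W. r (f v) w \<and> w \<noteq> f v}. \<beta> w) =
          (\<Sum>u\<in>{u \<in> Q. f u \<in> {w \<in> W. r (f v) w \<and> w \<noteq> f v}}. x u)"
          unfolding \<beta> by (rule sum_fibres) auto
        also have "\<dots> = (\<Sum>u\<in>{u \<in> Q. r a u \<and> r v u \<and> u \<noteq> v}. x u)"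
        proof (rule sum.mono_neutral_right)
          show "{u \<in> Q. r a u \<and> r v u \<and> u \<noteq> v} \<subseteq> {u \<in> Q. f u \<in> {w \<in> W. r (f v) w \<and> w \<noteq> f v}}"
            using v f_mono f_W f_inj[OF aA] by (auto simp: Q_def)
          show "\<forall>i\<in>{u \<in> Q. f u \<in> {w \<in> W. r (f v) w \<and> w \<noteq> f v}} - {u \<in> Q. r a u \<and> r v u \<and> u \<noteq> v}. x i = 0"
            using v above f_reflect[OF aA] by (auto simp: Q_def)
        qed (use finite_Q in auto)
        also have "\<dots> = (\<Sum>u\<in>{u \<in> Q. r v u \<and> u \<noteq> v}. x u)"
          using finite_Q above by (intro sum.mono_neutral_left) auto
        finally show ?thesis .
      qed
      ultimately show ?thesis
        by (simp add: K_def e_def top_mass_def)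
    qed
    have "K v = (\<Sum>u\<in>{u \<in> Q. f u = v}. e u)" if vW: "v \<in> W"
    proof -
      obtain u where u: "u \<in> Q" "r a u" "f u = v"
        using f_onto[OF aA] vW by (auto simp: W_def Q_def)
      have "e w = 0" if "w \<in> Q" "f w = v" "w \<noteq> u" for w
        using that u above[of w] f_inj[OF aA that(1) u(1)] e_x[of w] by metis
      then have "(\<Sum>u\<in>{u \<in> Q. f u = v}. e u) = (\<Sum>u\<in>{u}. e u)"
        using finite_Q u(1,3) by (intro sum.mono_neutral_right) simp_all
      then show ?thesis
        using Ke[OF u(1,2)] u(3) by simp
    qed
    moreover have "e v = 0" if "\<not> r a v"
      using that above[OF _ v] e_x by blast
    ultimately show ?thesis
      using Ke[OF v] by auto
  qed
  show ?thesis
  proof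
    fix v
    consider "v \<in> A" | "v \<in> Q" | "v \<notin> P"
      by (auto simp: Q_def)
    then show "expand (collapse x) v = push 0 x v"
    proof cases
      case 1
      then show ?thesis
        using E(1)[of v] X \<alpha> by (simp add: push_def \<alpha>_def \<beta>_def)
    next
      case 2
      have "expand (\<alpha>, \<beta>) v = (if v \<in> W then \<beta> v - K v else 0) + e v"
        using E(2)[of v, folded K_def] 2 1[OF 2] by simp
      also have "(if v \<in> W then \<beta> v - K v else 0) = (\<Sum>u\<in>{u \<in> Q. f u = v}. x u - e u)"
      proof (cases "v \<in> W")
        case True
        then show ?thesis
          using 1[OF 2] by (simp add: \<beta> sum_subtractf)
      next
        case False
        then have empty: "{u \<in> Q. f u = v} = {}"
          by (auto simp: W_def)
        show ?thesis
          unfolding empty using False by simp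
      qed
      finally show ?thesis
        using 2 Q_A[OF 2] by (simp add: push_def tA e_def \<alpha>_def \<beta>_def Let_def)
    next
      case 3
      then show ?thesis
        using E(3)[of v] A_subset Q_P by (auto simp: push_def Let_def \<alpha>_def \<beta>_def)
    qed
  qed
qed

lemma push_1:
  assumes x: "x \<in> chain_cone P r"
  shows "push 1 x = x"
proof
  fix v
  note nn = chain_coneD(1)[OF x]
  have "(\<Sum>a\<in>A. x a) \<ge> 0"
    by (intro sum_nonneg nn)
  then have "top_mass r Q ((\<Sum>a\<in>A. x a) + 1 * (\<Sum>u\<in>Q. x u)) x u = x u" if "u \<in> Q" for u
    using that finite_Q nn by (intro top_mass_full) auto
  then show "push 1 x v = x v"
    using chain_coneD(3)[OF x, of v] nn[of v] by (auto simp: push_def Let_def Q_def)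
qed

lemma push_in_chain_cone:
  assumes x: "x \<in> chain_cone P r" and \<tau>: "\<tau> \<in> {0..1}"
  shows "push \<tau> x \<in> chain_cone P r" "push \<tau> x = (\<lambda>_. 0) \<longleftrightarrow> x = (\<lambda>_. 0)"
proof -
  note nn = chain_coneD(1)[OF x]
  define X where "X = (\<Sum>u\<in>Q. x u)"
  define t where "t = (\<Sum>a\<in>A. x a) + \<tau> * X"
  define e where "e = top_mass r Q t x"
  have X_nn: "X \<ge> 0"
    unfolding X_def by (intro sum_nonneg nn)
  have push_A: "push \<tau> x v = max (x v - (1 - \<tau>) * X) 0" if "v \<in> A" for v
    using that by (simp add: push_def Let_def X_def)
  have push_Q: "push \<tau> x v = e v + (\<Sum>u\<in>{u \<in> Q. f u = v}. x u - e u)" if "v \<in> Q" for v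
    using that Q_A[OF that] by (simp add: push_def X_def e_def t_def Let_def)
  have push_P: "push \<tau> x v = 0" if "v \<notin> P" for v
    using that A_subset Q_P by (auto simp: push_def Let_def)
  have e_le: "e v \<le> x v" and e_nn: "e v \<ge> 0" for v
    using nn by (auto simp: e_def top_mass_le top_mass_nonneg)
  \<comment> \<open>The support again has three kinds of points. Now \<open>moved\<close> points lie
    below \<open>kept\<close> ones, and if an atom keeps some mass then \<open>t\<close> is at least
    \<open>X\<close>, so that nothing is moved.\<close>
  define bott where "bott v \<longleftrightarrow> v \<in> A \<and> x v > (1 - \<tau>) * X" for v
  define kept where "kept v \<longleftrightarrow> v \<in> Q \<and> e v > 0" for v
  define moved where "moved v \<longleftrightarrow> (\<exists>u\<in>Q. f u = v \<and> x u > e u)" for v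
  have supp: "bott v \<or> kept v \<or> moved v" if "push \<tau> x v \<noteq> 0" for v
  proof -
    have "v \<in> P"
      using that push_P by blast
    then consider "v \<in> A" | "v \<in> Q"
      by (auto simp: Q_def)
    then show ?thesis
    proof cases
      case 1
      then show ?thesis
        using that push_A by (auto simp: bott_def max_def split: if_splits)
    next
      case 2
      have "moved v" if "\<not> kept v"
      proof (rule ccontr)
        assume "\<not> moved v"
        then have "x u - e u = 0" if "u \<in> Q" "f u = v" for u
          using that e_le[of u] unfolding moved_def by fastforce
        then have "(\<Sum>u\<in>{u \<in> Q. f u = v}. x u - e u) = 0"
          by (intro sum.neutral) simp
        moreover have "e v = 0"
          using that 2 e_nn[of v] by (auto simp: kept_def)
        ultimately show False
          using \<open>push \<tau> x v \<noteq> 0\<close> push_Q[OF 2] by simp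
      qed
      then show ?thesis
        by blast
    qed
  qed
  have bott_x: "x u \<noteq> 0" if "bott u" for u
  proof -
    have "(1 - \<tau>) * X \<ge> 0"
      using \<tau> X_nn by simp
    then show ?thesis
      using that by (auto simp: bott_def)
  qed
  have bott_moved: False if "bott u" "moved v" for u v
  proof -
    have "x u \<le> (\<Sum>a\<in>A. x a)"
      using that nn finite_A by (intro member_le_sum) (auto simp: bott_def)
    moreover have "(1 - \<tau>) * X = X - \<tau> * X"
      by (simp add: algebra_simps)
    ultimately have "t \<ge> X"
      using that(1) by (simp add: t_def bott_def)
    then have "e w = x w" if "w \<in> Q" for w
      using that finite_Q nn unfolding e_def X_def by (intro top_mass_full) auto
    then show False
      using that(2) by (auto simp: moved_def)
  qed
  have kept_x: "x u \<noteq> 0" if "kept u" for u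
    using that e_le[of u] by (auto simp: kept_def)
  have moved_kept: "r v u" if mk: "moved v" "kept u" for u v
  proof -
    obtain w where w: "w \<in> Q" "f w = v" "x w > e w"
      using mk(1) by (auto simp: moved_def)
    have uQ: "u \<in> Q"
      using mk(2) by (simp add: kept_def)
    have "r w u \<or> r u w"
      using w(3) e_nn[of w] kept_x[OF mk(2)] by (intro chain_coneD(4)[OF x]) auto
    moreover have "w = u" if "r u w"
    proof (rule ccontr)
      assume "w \<noteq> u"
      then have "e w = x w"
        unfolding e_def
      proof (intro top_mass_above[of Q w r u])
        show "r u y \<and> y \<noteq> u" if "y \<in> Q" "r w y" "y \<noteq> w" for y
          using that \<open>r u w\<close> w uQ Q_P trans[of u w y] antisym[of w y] by metis
      qed (use \<open>kept u\<close> \<open>r u w\<close> finite_Q w nn in \<open>auto simp: kept_def e_def\<close>)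
      then show False
        using w(3) by simp
    qed
    ultimately have "r w u"
      using refl Q_P[OF uQ] by blast
    then show ?thesis
      using f_le[of w] trans[of v w u] w uQ Q_P f_Q by (auto simp: Q_def)
  qed
  have moved_moved: "r u v \<or> r v u" if uv: "moved u" "moved v" for u v
  proof -
    obtain u' v' where "u' \<in> Q" "f u' = u" "x u' > e u'" "v' \<in> Q" "f v' = v" "x v' > e v'"
      using uv by (auto simp: moved_def)
    then show ?thesis
      using chain_coneD(4)[OF x, of u' v'] f_mono[of u' v'] f_mono[of v' u'] e_nn[of u'] e_nn[of v']
      by (auto simp: Q_def)
  qed
  show "push \<tau> x \<in> chain_cone P r"
  proof (rule chain_coneI)
    show "0 \<le> push \<tau> x v" for v
    proof -
      consider "v \<in> A" | "v \<in> Q" | "v \<notin> P"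
        by (auto simp: Q_def)
      then show ?thesis
        using e_nn[of v] e_le by cases (auto simp: push_A push_Q push_P intro!: add_nonneg_nonneg sum_nonneg)
    qed
    show "v \<in> P" if "push \<tau> x v \<noteq> 0" for v
      using that push_P by blast
    show "r u v \<or> r v u" if "push \<tau> x u \<noteq> 0" "push \<tau> x v \<noteq> 0" for u v
      using supp[OF that(1)] supp[OF that(2)] bott_x bott_moved kept_x moved_kept moved_moved
        chain_coneD(4)[OF x] by meson
  qed
  show "push \<tau> x = (\<lambda>_. 0) \<longleftrightarrow> x = (\<lambda>_. 0)"
  proof
    assume 0: "push \<tau> x = (\<lambda>_. 0)"
    \<comment> \<open>No mass on \<open>Q\<close> is lost: what does not stay at \<open>u\<close>
      arrives at \<open>f u\<close>. A vanishing value thus forces \<open>x\<close> to vanish on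
      \<open>Q\<close>, and then nothing is subtracted from the atoms either.\<close>
    have xQ: "x u = 0" if u: "u \<in> Q" for u
    proof -
      have s_nn: "(\<Sum>u\<in>{u \<in> Q. f u = v}. x u - e u) \<ge> 0" for v
        using e_le by (intro sum_nonneg) auto
      have "e u = 0"
        using push_Q[OF u] 0 e_nn[of u] s_nn[of u] by simp
      moreover have "x u - e u \<le> (\<Sum>w\<in>{w \<in> Q. f w = f u}. x w - e w)"
        using u finite_Q e_le by (intro member_le_sum) auto
      moreover have "(\<Sum>w\<in>{w \<in> Q. f w = f u}. x w - e w) = 0"
        using push_Q[OF f_Q[OF u]] 0 e_nn[of "f u"] s_nn[of "f u"] by simp
      ultimately show ?thesis
        using nn[of u] by simp
    qed
    then have "X = 0"
      by (simp add: X_def)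
    then have "x a = 0" if "a \<in> A" for a
      using push_A[OF that] 0 nn[of a] by (simp add: max_def split: if_splits)
    then show "x = (\<lambda>_. 0)"
      using xQ chain_coneD(3)[OF x] by (auto simp: Q_def fun_eq_iff)
  next
    assume "x = (\<lambda>_. 0)"
    then have "e = (\<lambda>_. 0)" "X = 0"
      using e_nn e_le by (auto simp: X_def fun_eq_iff intro: antisym_conv[THEN iffD1])
    then show "push \<tau> x = (\<lambda>_. 0)"
      using \<open>x = _\<close> push_A push_Q push_P by (auto simp: fun_eq_iff Q_def) (metis DiffI Q_def)
  qed
qed

theorem cone_equiv_split:
  "cone_equiv (chain_cone P r) (\<lambda>_. 0) (chain_cone A r \<times> chain_cone W r) (\<lambda>_. 0, \<lambda>_. 0)"
proof -
  have collapse_0: "collapse x = (\<lambda>_. 0, \<lambda>_. 0) \<longleftrightarrow> x = (\<lambda>_. 0)" if x: "x \<in> chain_cone P r" for x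
  proof
    assume 0: "collapse x = (\<lambda>_. 0, \<lambda>_. 0)"
    have "x v = 0" if v: "v \<in> Q" for v
    proof -
      have "x v \<le> (\<Sum>u\<in>{u \<in> Q. f u = f v}. x u)"
        using v finite_Q chain_coneD(1)[OF x] by (intro member_le_sum) auto
      also have "\<dots> = 0"
        using 0 by (auto simp: collapse_def fun_eq_iff)
      finally show ?thesis
        using chain_coneD(1)[OF x, of v] by simp
    qed
    moreover have "x a = 0" if "a \<in> A" for a
      using 0 that by (auto simp: collapse_def fun_eq_iff split: if_splits)
    ultimately show "x = (\<lambda>_. 0)"
      using chain_coneD(3)[OF x] by (auto simp: Q_def fun_eq_iff)
  qed (auto simp: collapse_def fun_eq_iff)
  have expand_0: "expand z = (\<lambda>_. 0) \<longleftrightarrow> z = (\<lambda>_. 0, \<lambda>_. 0)" if zC: "z \<in> chain_cone A r \<times> chain_cone W r" for z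
  proof -
    obtain \<alpha> \<beta> where z: "z = (\<alpha>, \<beta>)" "\<alpha> \<in> chain_cone A r" "\<beta> \<in> chain_cone W r"
      using zC by auto
    \<comment> \<open>Since \<open>collapse\<close> vanishes only at the apex, it can be applied
      first, and the composition is known explicitly.\<close>
    have "expand z = (\<lambda>_. 0) \<longleftrightarrow> collapse (expand z) = (\<lambda>_. 0, \<lambda>_. 0)"
      using collapse_0[OF expand_in_chain_cone[OF z(2,3)]] z(1) by simp
    also have "\<dots> \<longleftrightarrow> (\<forall>a. max (\<alpha> a - (\<Sum>w\<in>W. \<beta> w)) 0 = 0) \<and> \<beta> = (\<lambda>_. 0)"
      unfolding z(1) collapse_expand[OF z(2,3)] by (auto simp: fun_eq_iff)
    also have "\<dots> \<longleftrightarrow> \<alpha> = (\<lambda>_. 0) \<and> \<beta> = (\<lambda>_. 0)"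
      using chain_coneD(1)[OF z(2)] by (auto simp: fun_eq_iff max_def intro: order.antisym)
    finally show ?thesis
      using z(1) by simp
  qed
  have "cone_map (chain_cone P r) (\<lambda>_. 0) (chain_cone A r \<times> chain_cone W r) (\<lambda>_. 0, \<lambda>_. 0) collapse"
  proof (rule cone_mapI)
    show "continuous_on (chain_cone P r) collapse"
      unfolding collapse_def by (intro continuous_intros)
  qed (use collapse_in_chain_cone collapse_0 in \<open>auto simp: mem_Times_iff\<close>)
  moreover have "cone_map (chain_cone A r \<times> chain_cone W r) (\<lambda>_. 0, \<lambda>_. 0) (chain_cone P r) (\<lambda>_. 0) expand"
  proof (rule cone_mapI)
    show "continuous_on (chain_cone A r \<times> chain_cone W r) expand"
      by (rule continuous_on_coordinatewise_then_product, unfold expand_def)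
        (intro continuous_intros continuous_on_top_mass)
  qed (use expand_in_chain_cone expand_0 in auto)
  moreover have "cone_homotopic (chain_cone P r) (\<lambda>_. 0) (expand \<circ> collapse) id"
  proof (rule cone_homotopicI[where h = push])
    show "continuous_on ({0..1} \<times> chain_cone P r) (\<lambda>z. push (fst z) (snd z))"
      by (rule continuous_on_coordinatewise_then_product, unfold push_def Let_def)
        (intro continuous_intros continuous_on_top_mass)
  qed (use push_in_chain_cone push_1 expand_collapse in auto)
  moreover have "cone_homotopic (chain_cone A r \<times> chain_cone W r) (\<lambda>_. 0, \<lambda>_. 0) (collapse \<circ> expand) id"
  proof (rule cone_homotopicI[where h = "\<lambda>\<tau> z. (\<lambda>a. max (fst z a - (1 - \<tau>) * (\<Sum>w\<in>W. snd z w)) 0, snd z)"])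
    show "continuous_on ({0..1} \<times> chain_cone A r \<times> chain_cone W r)
      (\<lambda>z. (\<lambda>a. max (fst (snd z) a - (1 - fst z) * (\<Sum>w\<in>W. snd (snd z) w)) 0, snd (snd z)))"
      by (intro continuous_intros)
    fix \<tau> :: real and z :: "('a \<Rightarrow> real) \<times> ('a \<Rightarrow> real)"
    assume \<tau>: "\<tau> \<in> {0..1}" and "z \<in> chain_cone A r \<times> chain_cone W r"
    then obtain \<alpha> \<beta> where z: "z = (\<alpha>, \<beta>)" "\<alpha> \<in> chain_cone A r" "\<beta> \<in> chain_cone W r"
      by auto
    let ?h = "(\<lambda>a. max (fst z a - (1 - \<tau>) * (\<Sum>w\<in>W. snd z w)) 0, snd z)"
    have "(\<Sum>w\<in>W. \<beta> w) \<ge> 0"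
      by (intro sum_nonneg chain_coneD(1)[OF z(3)])
    then have "(1 - \<tau>) * (\<Sum>w\<in>W. \<beta> w) \<ge> 0"
      using \<tau> by simp
    then have supp: "\<alpha> a \<noteq> 0" if "max (\<alpha> a - (1 - \<tau>) * (\<Sum>w\<in>W. \<beta> w)) 0 \<noteq> 0" for a
      using that by (auto simp: max_def split: if_splits)
    have "(\<lambda>a. max (\<alpha> a - (1 - \<tau>) * (\<Sum>w\<in>W. \<beta> w)) 0) \<in> chain_cone A r"
    proof (rule chain_coneI)
      show "a \<in> A" if "max (\<alpha> a - (1 - \<tau>) * (\<Sum>w\<in>W. \<beta> w)) 0 \<noteq> 0" for a
        using chain_coneD(2)[OF z(2)] supp[OF that] by blast
      show "r a b \<or> r b a" if "max (\<alpha> a - (1 - \<tau>) * (\<Sum>w\<in>W. \<beta> w)) 0 \<noteq> 0"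
        "max (\<alpha> b - (1 - \<tau>) * (\<Sum>w\<in>W. \<beta> w)) 0 \<noteq> 0" for a b
        using chain_coneD(4)[OF z(2)] supp[OF that(1)] supp[OF that(2)] by blast
    qed simp
    then show "?h \<in> chain_cone A r \<times> chain_cone W r"
      using z by simp
    show "?h = (\<lambda>_. 0, \<lambda>_. 0) \<longleftrightarrow> z = (\<lambda>_. 0, \<lambda>_. 0)"
      using chain_coneD(1)[OF z(2)] unfolding z(1)
      by (auto simp: fun_eq_iff max_def intro: order.antisym)
  next
    fix z :: "('a \<Rightarrow> real) \<times> ('a \<Rightarrow> real)"
    assume "z \<in> chain_cone A r \<times> chain_cone W r"
    then obtain \<alpha> \<beta> where z: "z = (\<alpha>, \<beta>)" "\<alpha> \<in> chain_cone A r" "\<beta> \<in> chain_cone W r"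
      by auto
    show "(\<lambda>a. max (fst z a - (1 - 0) * (\<Sum>w\<in>W. snd z w)) 0, snd z) = (collapse \<circ> expand) z"
      using collapse_expand[OF z(2,3)] z(1) by simp
    show "(\<lambda>a. max (fst z a - (1 - 1) * (\<Sum>w\<in>W. snd z w)) 0, snd z) = id z"
      using chain_coneD(1)[OF z(2)] z(1) by (simp add: fun_eq_iff)
  qed
  ultimately show ?thesis
    unfolding cone_equiv_def by blast
qed

end

section \<open>Labellings\<close>

text \<open>
  An element of the Dowling poset is encoded by labelling each point of the zero block with its colour,
  and each point \<open>i\<close> of a block with representative \<open>b\<close> and least element \<open>m\<close> with \<open>Blk m (b i \<otimes> inv (b m))\<close>.
  Points outside \<open>{1..n}\<close> are labelled as singletons, so that labellings for \<open>n\<close> are labellings for \<open>n + 1\<close>.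
  A label is read as an equation for the point in terms of \<open>m\<close>, and \<open>x\<close> is below \<open>y\<close> iff \<open>y\<close>
  satisfies the equations of \<open>x\<close>.
\<close>

datatype ('g, 's) label = Col 's | Blk nat 'g

locale dowling_data = group G + group_action G S act
  for G :: "('g, 'm) monoid_scheme" (structure) and S :: "'s set" and act :: "'g \<Rightarrow> 's \<Rightarrow> 's"
begin

fun translate :: "'g \<Rightarrow> ('g, 's) label \<Rightarrow> ('g, 's) label" where
  "translate g (Col s) = Col (act g s)"
| "translate g (Blk m h) = Blk m (g \<otimes> h)"

fun subst :: "(nat \<Rightarrow> ('g, 's) label) \<Rightarrow> ('g, 's) label \<Rightarrow> ('g, 's) label" where
  "subst y (Col s) = Col s"
| "subst y (Blk m g) = translate g (y m)"

definition labels :: "('g, 's) label set"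
  where "labels = Col ` S \<union> {Blk m g | m g. g \<in> carrier G}"

text \<open>The condition \<open>1 \<le> i \<longrightarrow> 1 \<le> m\<close> keeps
  \<open>0\<close> from being the root of a point of \<open>{1..n}\<close>: being outside,
  \<open>0\<close> is labelled as a singleton and would satisfy the other conditions on a
  root.\<close>

definition labelling :: "nat \<Rightarrow> (nat \<Rightarrow> ('g, 's) label) set"
  where "labelling n = {x. (\<forall>i. i \<notin> {1..n} \<longrightarrow> x i = Blk i \<one>) \<and> (\<forall>i s. x i = Col s \<longrightarrow> s \<in> S) \<and>
    (\<forall>i m g. x i = Blk m g \<longrightarrow> g \<in> carrier G \<and> m \<le> i \<and> (1 \<le> i \<longrightarrow> 1 \<le> m) \<and> x m = Blk m \<one>)}"

definition le :: "(nat \<Rightarrow> ('g, 's) label) \<Rightarrow> (nat \<Rightarrow> ('g, 's) label) \<Rightarrow> bool"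
  where "le x y \<longleftrightarrow> (\<forall>i. y i = subst y (x i))"

definition finest :: "nat \<Rightarrow> ('g, 's) label"
  where "finest = (\<lambda>i. Blk i \<one>)"

lemma act_closed: "g \<in> carrier G \<Longrightarrow> s \<in> S \<Longrightarrow> act g s \<in> S"
  using element_image by blast

lemma act_mult: "g \<in> carrier G \<Longrightarrow> h \<in> carrier G \<Longrightarrow> s \<in> S \<Longrightarrow> act (g \<otimes> h) s = act g (act h s)"
  using composition_rule by blast

lemma act_one: "s \<in> S \<Longrightarrow> act \<one> s = s"
  using id_eq_one by (metis restrict_apply')

lemma labels_simps [simp]: "Col s \<in> labels \<longleftrightarrow> s \<in> S" "Blk m g \<in> labels \<longleftrightarrow> g \<in> carrier G"
  by (auto simp: labels_def)

lemma translate_closed: "g \<in> carrier G \<Longrightarrow> c \<in> labels \<Longrightarrow> translate g c \<in> labels"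
  by (cases c) (auto simp: act_closed)

lemma translate_mult:
  "g \<in> carrier G \<Longrightarrow> h \<in> carrier G \<Longrightarrow> c \<in> labels \<Longrightarrow> translate (g \<otimes> h) c = translate g (translate h c)"
  by (cases c) (auto simp: act_mult m_assoc)

lemma translate_one: "c \<in> labels \<Longrightarrow> translate \<one> c = c"
  by (cases c) (auto simp: act_one)

lemma labelling_outside: "x \<in> labelling n \<Longrightarrow> i \<notin> {1..n} \<Longrightarrow> x i = Blk i \<one>"
  unfolding labelling_def by blast

lemma labelling_Col:
  assumes "x \<in> labelling n" "x i = Col s"
  shows "s \<in> S" "i \<in> {1..n}"
proof -
  show "s \<in> S"
    using assms unfolding labelling_def by blast
  show "i \<in> {1..n}"
    using labelling_outside[OF assms(1), of i] assms(2) by (metis label.distinct(1))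
qed

lemma labelling_Blk:
  assumes "x \<in> labelling n" "x i = Blk m g"
  shows "g \<in> carrier G" "m \<le> i" "1 \<le> i \<Longrightarrow> 1 \<le> m" "x m = Blk m \<one>"
  using assms unfolding labelling_def by blast+

lemma labelling_labels: "x \<in> labelling n \<Longrightarrow> x i \<in> labels"
  using labelling_Col(1) labelling_Blk(1) by (cases "x i") auto

lemma labellingI:
  assumes "\<And>i. i \<notin> {1..n} \<Longrightarrow> x i = Blk i \<one>" "\<And>i s. x i = Col s \<Longrightarrow> s \<in> S"
    "\<And>i m g. x i = Blk m g \<Longrightarrow> g \<in> carrier G \<and> m \<le> i \<and> (1 \<le> i \<longrightarrow> 1 \<le> m) \<and> x m = Blk m \<one>"
  shows "x \<in> labelling n"
  unfolding labelling_def using assms by blast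

lemma subst_translate:
  assumes "y \<in> labelling n" "g \<in> carrier G" "c \<in> labels"
  shows "subst y (translate g c) = translate g (subst y c)"
  using assms labelling_labels[OF assms(1)] by (cases c) (auto simp: translate_mult)

lemma le_refl: "x \<in> labelling n \<Longrightarrow> le x x"
  unfolding le_def
proof
  fix i assume x: "x \<in> labelling n"
  show "x i = subst x (x i)"
    using labelling_Blk(1,4)[OF x, of i] by (cases "x i") auto
qed

lemma subst_subst:
  assumes "le x y" "y \<in> labelling n" "x \<in> labelling n" "c \<in> labels"
  shows "subst y (subst x c) = subst y c"
proof (cases c)
  case (Blk m g)
  then show ?thesis
    using assms labelling_labels[OF assms(3)] subst_translate[OF assms(2), of g "x m"]
    by (simp add: le_def)
qed simp

lemma le_trans:
  assumes "le x y" "le y z" "x \<in> labelling n" "y \<in> labelling n" "z \<in> labelling n"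
  shows "le x z"
  unfolding le_def
proof
  fix i
  have "z i = subst z (y i)"
    using assms(2) by (auto simp: le_def)
  also have "y i = subst y (x i)"
    using assms(1) by (auto simp: le_def)
  also have "subst z (subst y (x i)) = subst z (x i)"
    using assms labelling_labels by (intro subst_subst) auto
  finally show "z i = subst z (x i)" .
qed

text \<open>Rests on roots being least elements: if \<open>m\<close> is the root of \<open>i\<close>
  for \<open>x\<close> and \<open>m'\<close> is the root of \<open>m\<close> for \<open>y\<close>,
  then \<open>m' \<le> m\<close>, while \<open>x m'\<close> must again have root \<open>m\<close>,
  so \<open>m \<le> m'\<close>.\<close>

lemma le_antisym:
  assumes "le x y" "le y x" and x: "x \<in> labelling n" and y: "y \<in> labelling n"
  shows "x = y"
proof
  fix i
  have xy: "\<And>i. y i = subst y (x i)" and yx: "\<And>i. x i = subst x (y i)"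
    using assms(1,2) by (auto simp: le_def)
  show "x i = y i"
  proof (cases "x i")
    case (Col s)
    then show ?thesis
      using xy[of i] by simp
  next
    case (Blk m g)
    note B = labelling_Blk[OF x Blk]
    have yi: "y i = translate g (y m)"
      using xy[of i] Blk by simp
    show ?thesis
    proof (cases "y m")
      case (Col s)
      then show ?thesis
        using yi yx[of i] Blk by simp
    next
      case ym: (Blk m' h)
      note B' = labelling_Blk[OF y ym]
      have "x i = translate (g \<otimes> h) (x m')"
        using yx[of i] yi ym by simp
      then obtain h' where "x m' = Blk m h'"
        using Blk by (cases "x m'") auto
      then have "m \<le> m'"
        using labelling_Blk(2)[OF x] by blast
      then have "m' = m"
        using B'(2) by simp
      then show ?thesis
        using yi ym B' B Blk by simp
    qed
  qed
qed

lemma finest_labelling: "finest \<in> labelling n"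
  by (rule labellingI) (auto simp: finest_def)

lemma finite_labelling:
  assumes "finite S" "finite (carrier G)"
  shows "finite (labelling n)"
proof -
  let ?L = "Col ` S \<union> case_prod Blk ` ({..n} \<times> carrier G)"
  have "x i \<in> ?L" if "x \<in> labelling n" "i \<in> {1..n}" for x i
  proof (cases "x i")
    case (Col s)
    then show ?thesis
      using labelling_Col(1)[OF that(1)] by auto
  next
    case (Blk m g)
    have "m \<le> n" "g \<in> carrier G"
      using labelling_Blk(1,2)[OF that(1) Blk] that(2) by auto
    then show ?thesis
      unfolding Blk by (intro UnI2 image_eqI[of _ _ "(m, g)"]) auto
  qed
  then have "(\<lambda>x. restrict x {1..n}) ` labelling n \<subseteq> {1..n} \<rightarrow>\<^sub>E ?L"
    by (intro image_subsetI) (simp only: restrict_PiE_iff, blast)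
  moreover have "finite ({1..n} \<rightarrow>\<^sub>E ?L)"
    using assms by (intro finite_PiE) auto
  moreover have "inj_on (\<lambda>x. restrict x {1..n}) (labelling n)"
  proof (rule inj_onI)
    fix x y assume xy: "x \<in> labelling n" "y \<in> labelling n" "restrict x {1..n} = restrict y {1..n}"
    show "x = y"
    proof
      fix i
      show "x i = y i"
        using labelling_outside[OF xy(1), of i] labelling_outside[OF xy(2), of i] fun_cong[OF xy(3), of i]
        by (cases "i \<in> {1..n}") auto
    qed
  qed
  ultimately show ?thesis
    by (meson finite_imageD finite_subset)
qed

section \<open>Atoms at the last point and its isolation\<close>

definition atom_labels :: "nat \<Rightarrow> ('g, 's) label set"
  where "atom_labels n = Col ` S \<union> {Blk m g | m g. m \<in> {1..<n} \<and> g \<in> carrier G}"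

definition atoms :: "nat \<Rightarrow> (nat \<Rightarrow> ('g, 's) label) set"
  where "atoms n = (\<lambda>c. finest(n := c)) ` atom_labels n"

definition isolate :: "nat \<Rightarrow> (nat \<Rightarrow> ('g, 's) label) \<Rightarrow> nat \<Rightarrow> ('g, 's) label"
  where "isolate n x = x(n := Blk n \<one>)"

lemma card_atoms:
  assumes "finite S" "finite (carrier G)" "n > 0"
  shows "finite (atoms n)" "card (atoms n) = card S + card (carrier G) * (n - 1)"
proof -
  have eq: "{Blk m g | m g. m \<in> {1..<n} \<and> g \<in> carrier G} = case_prod Blk ` ({1..<n} \<times> carrier G)"
    by (auto simp: image_iff)
  have "card (case_prod Blk ` ({1..<n} \<times> carrier G) :: ('g, 's) label set) = card ({1..<n} \<times> carrier G)"
    by (intro card_image) (auto simp: inj_on_def)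
  moreover have "card (Col ` S :: ('g, 's) label set) = card S"
    by (intro card_image) (auto simp: inj_on_def)
  ultimately have "card (atom_labels n) = card S + card ({1..<n} \<times> carrier G)"
    unfolding atom_labels_def eq using assms by (subst card_Un_disjoint) auto
  moreover have "card (atoms n) = card (atom_labels n)"
    unfolding atoms_def by (intro card_image inj_onI) (metis fun_upd_same)
  ultimately show "card (atoms n) = card S + card (carrier G) * (n - 1)"
    by (simp add: card_cartesian_product)
  show "finite (atoms n)"
    unfolding atoms_def atom_labels_def eq using assms by auto
qed

text \<open>As roots are least elements, the last point \<open>n\<close> is never the root of
  another one, so its label can be changed without affecting the rest.\<close>

lemma root_neq:
  assumes "x \<in> labelling n" "i \<noteq> n" "x i = Blk m g"
  shows "m \<noteq> n"
  using labelling_Blk(2)[OF assms(1,3)] labelling_outside[OF assms(1), of i] assms(2,3)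
  by (cases "i < n") auto

lemma subst_isolate:
  assumes "x \<in> labelling n" "i \<noteq> n"
  shows "subst (isolate n v) (x i) = subst v (x i)"
  using root_neq[OF assms] by (cases "x i") (auto simp: isolate_def)

lemma subst_upd_atom_label: "c \<in> atom_labels n \<Longrightarrow> subst (v(n := d)) c = subst v c"
  by (auto simp: atom_labels_def)

lemma isolate_labelling:
  assumes x: "x \<in> labelling (Suc k)"
  shows "isolate (Suc k) x \<in> labelling k"
proof (rule labellingI)
  fix i
  show "isolate (Suc k) x i = Blk i \<one>" if "i \<notin> {1..k}"
    using that labelling_outside[OF x, of i] by (auto simp: isolate_def)
  show "s \<in> S" if "isolate (Suc k) x i = Col s" for s
    using that labelling_Col[OF x] by (auto simp: isolate_def split: if_splits)
  show "g \<in> carrier G \<and> m \<le> i \<and> (1 \<le> i \<longrightarrow> 1 \<le> m) \<and> isolate (Suc k) x m = Blk m \<one>"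
    if "isolate (Suc k) x i = Blk m g" for m g
    using that labelling_Blk[OF x, of i m g] by (auto simp: isolate_def split: if_splits)
qed

lemma labelling_mono: "labelling k \<subseteq> labelling (Suc k)"
proof
  fix x assume x: "x \<in> labelling k"
  show "x \<in> labelling (Suc k)"
  proof (rule labellingI)
    show "x i = Blk i \<one>" if "i \<notin> {1..Suc k}" for i
      by (rule labelling_outside[OF x]) (use that in auto)
  qed (use labelling_Col(1)[OF x] labelling_Blk[OF x] in blast)+
qed

text \<open>The last point takes the value that the equation \<open>c\<close> prescribes. This
  yields the element above the atom with label \<open>c\<close> that becomes \<open>w\<close> when
  the last point is isolated.\<close>

lemma upd_labelling:
  assumes w: "w \<in> labelling k" and c: "c \<in> atom_labels (Suc k)"
  shows "w(Suc k := subst w c) \<in> labelling (Suc k)"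
proof (rule labellingI)
  fix i
  let ?u = "w(Suc k := subst w c)"
  have wk: "w (Suc k) = Blk (Suc k) \<one>"
    using labelling_outside[OF w] by simp
  have sl: "subst w c \<in> labels"
    using c labelling_labels[OF w] by (auto simp: atom_labels_def intro!: translate_closed)
  show "?u i = Blk i \<one>" if "i \<notin> {1..Suc k}"
    using that labelling_outside[OF w, of i] by auto
  show "s \<in> S" if "?u i = Col s" for s
    using that labelling_Col[OF w, of i s] sl by (auto split: if_splits)
  show "g \<in> carrier G \<and> m \<le> i \<and> (1 \<le> i \<longrightarrow> 1 \<le> m) \<and> ?u m = Blk m \<one>" if ui: "?u i = Blk m g" for m g
  proof (cases "i = Suc k")
    case True
    then have e: "subst w c = Blk m g"
      using ui by simp
    then obtain m' g' where c': "c = Blk m' g'" "m' \<in> {1..<Suc k}" "g' \<in> carrier G"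
      using c by (auto simp: atom_labels_def)
    then obtain h where h: "w m' = Blk m h"
      using e by (cases "w m'") auto
    note B = labelling_Blk[OF w h]
    show ?thesis
      using B c' e h True sl by auto
  next
    case False
    then have wi: "w i = Blk m g"
      using ui by simp
    note B = labelling_Blk[OF w wi]
    have "m \<noteq> Suc k"
    proof
      assume "m = Suc k"
      then have "i \<notin> {1..k}"
        using B(2) by simp
      then show False
        using labelling_outside[OF w, of i] wi \<open>m = Suc k\<close> False by simp
    qed
    then show ?thesis
      using B by simp
  qed
qed

text \<open>Isolation loses only the label of the last point. Once the atoms and the bottom are
  removed, it therefore never produces the bottom.\<close>

lemma isolate_eq_finest_iff:
  assumes x: "x \<in> labelling (Suc k)"
  shows "isolate (Suc k) x = finest \<longleftrightarrow> x = finest \<or> x \<in> atoms (Suc k)"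
proof
  assume "isolate (Suc k) x = finest"
  then have x_eq: "x = finest(Suc k := x (Suc k))"
    by (metis fun_upd_triv fun_upd_upd isolate_def)
  show "x = finest \<or> x \<in> atoms (Suc k)"
  proof (cases "x (Suc k)")
    case (Col s)
    then have "x (Suc k) \<in> atom_labels (Suc k)"
      using labelling_Col[OF x] by (auto simp: atom_labels_def)
    then show ?thesis
      using x_eq unfolding atoms_def by blast
  next
    case (Blk m g)
    note B = labelling_Blk[OF x Blk]
    show ?thesis
    proof (cases "m = Suc k")
      case True
      then have "x (Suc k) = finest (Suc k)"
        using B by (simp add: finest_def)
      then show ?thesis
        using x_eq by (metis fun_upd_triv)
    next
      case False
      then have "x (Suc k) \<in> atom_labels (Suc k)"
        using B Blk by (auto simp: atom_labels_def)
      then show ?thesis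
        using x_eq unfolding atoms_def by blast
    qed
  qed
next
  show "x = finest \<or> x \<in> atoms (Suc k) \<Longrightarrow> isolate (Suc k) x = finest"
    by (auto simp: isolate_def finest_def atoms_def)
qed

lemma atoms_neq_isolated:
  assumes "x (Suc k) = Blk (Suc k) \<one>"
  shows "x \<notin> atoms (Suc k)"
proof
  assume "x \<in> atoms (Suc k)"
  then obtain c where "x = finest(Suc k := c)" "c \<in> atom_labels (Suc k)"
    by (auto simp: atoms_def)
  then show False
    using assms by (auto simp: atom_labels_def)
qed

lemma poset_split_labelling:
  assumes "finite S" "finite (carrier G)"
  shows "poset_split (labelling (Suc k) - {finest}) (atoms (Suc k)) le (isolate (Suc k))"
proof
  let ?n = "Suc k"
  let ?P = "labelling ?n - {finest}"
  show "finite ?P"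
    using finite_labelling[OF assms] by simp
  show "atoms ?n \<subseteq> ?P"
  proof
    fix a assume "a \<in> atoms ?n"
    then obtain c where a: "a = finest(?n := c)" "c \<in> atom_labels ?n"
      by (auto simp: atoms_def)
    have "subst finest c = c"
      using a(2) by (auto simp: atom_labels_def finest_def)
    then have "a \<in> labelling ?n"
      using upd_labelling[OF finest_labelling a(2)] a(1) by simp
    moreover have "finest \<notin> atoms ?n"
      by (rule atoms_neq_isolated) (simp add: finest_def)
    ultimately show "a \<in> ?P"
      using \<open>a \<in> atoms ?n\<close> by auto
  qed
  show "le v v" if "v \<in> ?P" for v
    using that le_refl by blast
  show "le u w" if "u \<in> ?P" "v \<in> ?P" "w \<in> ?P" "le u v" "le v w" for u v w
    using that le_trans by blast
  show "u = v" if "u \<in> ?P" "v \<in> ?P" "le u v" "le v u" for u v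
    using that le_antisym by blast
  show "v = a" if "v \<in> ?P" "a \<in> atoms ?n" "le v a" for v a
  proof -
    have v: "v \<in> labelling ?n"
      using that by simp
    obtain c where a: "a = finest(?n := c)" "c \<in> atom_labels ?n"
      using \<open>a \<in> atoms ?n\<close> by (auto simp: atoms_def)
    have av: "a i = subst a (v i)" for i
      using that by (auto simp: le_def)
    have vi: "v i = a i" if "i \<noteq> ?n" for i
    proof -
      have ai: "subst a (v i) = Blk i \<one>"
        using av[of i] a that by (simp add: finest_def)
      then obtain m g where vi: "v i = Blk m g"
        by (cases "v i") auto
      then show ?thesis
        using ai root_neq[OF v that vi] labelling_Blk(1)[OF v vi] a that by (auto simp: finest_def)
    qed
    moreover have "v ?n = a ?n"
    proof (cases "v ?n")
      case (Col s)
      then show ?thesis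
        using av[of ?n] by simp
    next
      case (Blk m g)
      note B = labelling_Blk[OF v Blk]
      \<comment> \<open>If the last point were its own root, \<open>v\<close> would be the bottom
        element, which has been removed.\<close>
      have "m \<noteq> ?n"
      proof
        assume "m = ?n"
        then have "v i = finest i" for i
          using vi[of i] B a(1) by (cases "i = ?n") (auto simp: finest_def)
        then show False
          using \<open>v \<in> ?P\<close> by auto
      qed
      then show ?thesis
        using av[of ?n] Blk B(1) a(1) by (simp add: finest_def)
    qed
    ultimately show ?thesis
      by (metis ext)
  qed
  show f_in: "isolate ?n v \<in> ?P - atoms ?n" if "v \<in> ?P - atoms ?n" for v
    using that isolate_labelling[of v k] isolate_eq_finest_iff[of v k] labelling_mono[of k]
      atoms_neq_isolated[of "isolate ?n v" k] by (auto simp: isolate_def)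
  show "le (isolate ?n v) v" if "v \<in> ?P - atoms ?n" for v
  proof -
    have v: "v \<in> labelling ?n"
      using that by simp
    have "v i = subst v (isolate ?n v i)" for i
      using le_refl[OF v] translate_one[OF labelling_labels[OF v]] by (auto simp: le_def isolate_def)
    then show ?thesis
      by (simp add: le_def)
  qed
  show "le (isolate ?n u) (isolate ?n v)" if "u \<in> ?P - atoms ?n" "v \<in> ?P - atoms ?n" "le u v" for u v
  proof -
    have "isolate ?n v i = subst (isolate ?n v) (isolate ?n u i)" for i
    proof (cases "i = ?n")
      case False
      then show ?thesis
        using that subst_isolate[of u ?n i v] by (simp add: le_def) (simp add: isolate_def)
    qed (simp add: isolate_def)
    then show ?thesis
      by (simp add: le_def)
  qed
  show "isolate ?n (isolate ?n v) = isolate ?n v" for v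
    by (simp add: isolate_def)
  show "\<exists>u\<in>?P - atoms ?n. le a u \<and> isolate ?n u = isolate ?n v" if "a \<in> atoms ?n" "v \<in> ?P - atoms ?n" for a v
  proof -
    have v: "v \<in> labelling ?n"
      using that by simp
    obtain c where a: "a = finest(?n := c)" "c \<in> atom_labels ?n"
      using \<open>a \<in> atoms ?n\<close> by (auto simp: atoms_def)
    define u where "u = (isolate ?n v)(?n := subst (isolate ?n v) c)"
    have u: "u \<in> labelling ?n"
      unfolding u_def by (intro upd_labelling isolate_labelling v a)
    have iso: "isolate ?n u = isolate ?n v"
      by (simp add: u_def isolate_def)
    then have "u \<in> ?P - atoms ?n"
      using u isolate_eq_finest_iff[OF u] isolate_eq_finest_iff[OF v] that by auto
    moreover have "u i = subst u (a i)" for i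
      using translate_one[OF labelling_labels[OF u, of i]] subst_upd_atom_label[OF a(2)] a(1)
      by (cases "i = ?n") (auto simp: finest_def u_def)
    ultimately show ?thesis
      using iso by (auto simp: le_def)
  qed
  show "le u v" if "a \<in> atoms ?n" "u \<in> ?P - atoms ?n" "v \<in> ?P - atoms ?n" "le a u" "le a v"
    "le (isolate ?n u) (isolate ?n v)" for a u v
  proof -
    have u: "u \<in> labelling ?n" and v: "v \<in> labelling ?n"
      using that by auto
    obtain c where a: "a = finest(?n := c)" "c \<in> atom_labels ?n"
      using \<open>a \<in> atoms ?n\<close> by (auto simp: atoms_def)
    have un: "u ?n = subst u c" and vn: "v ?n = subst v c"
      using that(4,5) a(1) unfolding le_def by (metis fun_upd_same)+
    have vi: "v i = subst v (u i)" if "i \<noteq> ?n" for i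
    proof -
      have "isolate ?n v i = subst (isolate ?n v) (isolate ?n u i)"
        using \<open>le (isolate ?n u) (isolate ?n v)\<close> unfolding le_def by blast
      then show ?thesis
        using that subst_isolate[OF u that, of v] by (simp add: isolate_def)
    qed
    \<comment> \<open>Both labels at the last point are values of the same equation
      \<open>c\<close>, so the comparison there reduces to the one at the root of \<open>c\<close>,
      which is a different point.\<close>
    moreover have "v ?n = subst v (u ?n)"
    proof (cases c)
      case (Col s)
      then show ?thesis
        using un vn by simp
    next
      case (Blk m g)
      then have "m \<noteq> ?n" "g \<in> carrier G"
        using a(2) by (auto simp: atom_labels_def)
      then show ?thesis
        using un vn Blk vi[of m] subst_translate[OF v _ labelling_labels[OF u], of g m] by simp
    qed
    ultimately show ?thesis
      unfolding le_def by metis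
  qed
qed

lemma isolate_image:
  "isolate (Suc k) ` (labelling (Suc k) - {finest} - atoms (Suc k)) = labelling k - {finest}"
proof (intro Set.set_eqI iffI)
  fix w assume "w \<in> isolate (Suc k) ` (labelling (Suc k) - {finest} - atoms (Suc k))"
  then show "w \<in> labelling k - {finest}"
    by (auto simp: isolate_labelling isolate_eq_finest_iff)
next
  fix w assume w: "w \<in> labelling k - {finest}"
  then have "w (Suc k) = Blk (Suc k) \<one>"
    using labelling_outside[of w k "Suc k"] by simp
  then have "isolate (Suc k) w = w" "w \<notin> atoms (Suc k)"
    using atoms_neq_isolated by (auto simp: isolate_def)
  then show "w \<in> isolate (Suc k) ` (labelling (Suc k) - {finest} - atoms (Suc k))"
    using w labelling_mono[of k] by (metis DiffD1 DiffD2 DiffI image_eqI subsetD)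
qed

lemma cone_equiv_labelling_Suc:
  assumes "finite S" "finite (carrier G)"
  shows "cone_equiv (chain_cone (labelling (Suc k) - {finest}) le) (\<lambda>_. 0)
    (chain_cone (atoms (Suc k)) le \<times> chain_cone (labelling k - {finest}) le) (\<lambda>_. 0, \<lambda>_. 0)"
proof -
  interpret poset_split "labelling (Suc k) - {finest}" "atoms (Suc k)" le "isolate (Suc k)"
    by (rule poset_split_labelling[OF assms])
  show ?thesis
    using cone_equiv_split unfolding W_def Q_def isolate_image .
qed

lemma cone_equiv_atoms:
  assumes "finite S" "finite (carrier G)" "atoms (Suc k) \<noteq> {}"
  shows "cone_equiv (chain_cone (atoms (Suc k)) le) (\<lambda>_. 0) (star {..<card (atoms (Suc k)) - 1}) star_centre"
proof -
  interpret poset_split "labelling (Suc k) - {finest}" "atoms (Suc k)" le "isolate (Suc k)"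
    by (rule poset_split_labelling[OF assms(1,2)])
  obtain b where b: "b \<in> atoms (Suc k)"
    using assms(3) by blast
  obtain h where h: "bij_betw h (atoms (Suc k) - {b}) {..<card (atoms (Suc k)) - 1}"
    using finite_same_card_bij[of "atoms (Suc k) - {b}" "{..<card (atoms (Suc k)) - 1}"] finite_A b by auto
  have "le a c \<longleftrightarrow> a = c" if "a \<in> atoms (Suc k)" "c \<in> atoms (Suc k)" for a c
    using that minimal A_subset refl by blast
  then show ?thesis
    by (rule cone_equiv_trans[OF cone_equiv_chain_cone_antichain[OF finite_A b] cone_equiv_star_bij[OF h]])
qed

end

section \<open>The Dowling poset in terms of labellings\<close>

lemma fst_gblock [simp]: "fst (gblock G B b) = B"
  by (simp add: gblock_def)

lemma gblock_cong:
  assumes "\<And>i. i \<in> B \<Longrightarrow> b i = b' i"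
  shows "gblock G B b = gblock G B b'"
proof -
  have "(\<lambda>i\<in>B. b i \<otimes>\<^bsub>G\<^esub> g) = (\<lambda>i\<in>B. b' i \<otimes>\<^bsub>G\<^esub> g)" for g
    using assms by (intro restrict_ext) simp
  then show ?thesis
    by (simp add: gblock_def)
qed

context dowling_data
begin

lemma snd_gblockE:
  assumes "\<phi> \<in> snd (gblock G B b)"
  obtains g where "g \<in> carrier G" "\<And>i. i \<in> B \<Longrightarrow> \<phi> i = b i \<otimes> g"
  using assms by (auto simp: gblock_def)

text \<open>The ratios of a representative are unchanged under \<open>b \<sim> b g\<close>. They are
  what a \<open>G\<close>-block records beyond its set, and they allow comparisons without fixing a
  representative.\<close>

lemma ratio_cancel:
  "a \<in> carrier G \<Longrightarrow> b \<in> carrier G \<Longrightarrow> g \<in> carrier G \<Longrightarrow> (a \<otimes> g) \<otimes> inv (b \<otimes> g) = a \<otimes> inv b"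
  by (simp add: inv_mult_group m_assoc) (simp add: m_assoc[symmetric])

lemma gblock_translate:
  assumes b: "b \<in> B \<rightarrow> carrier G" and h: "h \<in> carrier G"
  shows "gblock G B (\<lambda>i. b i \<otimes> h) = gblock G B b"
proof -
  have "(\<exists>g\<in>carrier G. \<phi> = (\<lambda>i\<in>B. b i \<otimes> h \<otimes> g)) \<longleftrightarrow> (\<exists>g\<in>carrier G. \<phi> = (\<lambda>i\<in>B. b i \<otimes> g))" for \<phi>
  proof
    assume "\<exists>g\<in>carrier G. \<phi> = (\<lambda>i\<in>B. b i \<otimes> h \<otimes> g)"
    then obtain g where g: "g \<in> carrier G" "\<phi> = (\<lambda>i\<in>B. b i \<otimes> h \<otimes> g)" by blast
    have "\<phi> = (\<lambda>i\<in>B. b i \<otimes> (h \<otimes> g))"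
      unfolding g(2) using b h g(1) by (intro restrict_ext) (auto simp: m_assoc Pi_iff)
    then show "\<exists>g\<in>carrier G. \<phi> = (\<lambda>i\<in>B. b i \<otimes> g)"
      using h g(1) by blast
  next
    assume "\<exists>g\<in>carrier G. \<phi> = (\<lambda>i\<in>B. b i \<otimes> g)"
    then obtain g where g: "g \<in> carrier G" "\<phi> = (\<lambda>i\<in>B. b i \<otimes> g)" by blast
    have "\<phi> = (\<lambda>i\<in>B. b i \<otimes> h \<otimes> (inv h \<otimes> g))"
      unfolding g(2)
    proof (rule restrict_ext)
      fix i assume "i \<in> B"
      then have "b i \<in> carrier G"
        using b by auto
      then show "b i \<otimes> g = b i \<otimes> h \<otimes> (inv h \<otimes> g)"
        using h g(1) by (metis inv_closed inv_solve_left m_assoc m_closed)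
    qed
    then show "\<exists>g\<in>carrier G. \<phi> = (\<lambda>i\<in>B. b i \<otimes> h \<otimes> g)"
      using h g(1) by blast
  qed
  then show ?thesis
    by (auto simp: gblock_def)
qed

section \<open>From labellings to partial G-partitions\<close>

definition block :: "(nat \<Rightarrow> ('g, 's) label) \<Rightarrow> nat \<Rightarrow> nat set"
  where "block x m = {i. \<exists>g. x i = Blk m g}"

definition gain :: "(nat \<Rightarrow> ('g, 's) label) \<Rightarrow> nat \<Rightarrow> 'g"
  where "gain x i = (case x i of Col s \<Rightarrow> \<one> | Blk m g \<Rightarrow> g)"

definition colour :: "(nat \<Rightarrow> ('g, 's) label) \<Rightarrow> nat \<Rightarrow> 's"
  where "colour x i = (case x i of Col s \<Rightarrow> s | Blk m g \<Rightarrow> undefined)"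

definition roots :: "nat \<Rightarrow> (nat \<Rightarrow> ('g, 's) label) \<Rightarrow> nat set"
  where "roots n x = {m \<in> {1..n}. x m = Blk m \<one>}"

definition blocks :: "nat \<Rightarrow> (nat \<Rightarrow> ('g, 's) label) \<Rightarrow> (nat set \<times> (nat \<Rightarrow> 'g) set) set"
  where "blocks n x = (\<lambda>m. gblock G (block x m) (gain x)) ` roots n x"

definition to_dowling :: "nat \<Rightarrow> (nat \<Rightarrow> ('g, 's) label) \<Rightarrow> ('g, 's) dowling_elem"
  where "to_dowling n x = (blocks n x, colour x)"

lemma gain_Blk: "x i = Blk m g \<Longrightarrow> gain x i = g"
  by (simp add: gain_def)

lemma gain_closed: "x \<in> labelling n \<Longrightarrow> gain x i \<in> carrier G"
  using labelling_Blk(1)[of x n i] by (cases "x i") (auto simp: gain_def)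

lemma block_gain: "i \<in> block x m \<Longrightarrow> x i = Blk m (gain x i)"
  by (auto simp: block_def gain_def)

lemma root_in_roots:
  assumes x: "x \<in> labelling n" and i: "i \<in> {1..n}" and xi: "x i = Blk m g"
  shows "m \<in> roots n x"
  using labelling_Blk[OF x xi] i by (auto simp: roots_def)

lemma block_subset:
  assumes x: "x \<in> labelling n" and m: "m \<in> roots n x"
  shows "block x m \<subseteq> {1..n}" "m \<in> block x m"
proof -
  show "m \<in> block x m"
    using m by (auto simp: roots_def block_def)
  show "block x m \<subseteq> {1..n}"
  proof
    fix i assume "i \<in> block x m"
    then obtain g where "x i = Blk m g"
      by (auto simp: block_def)
    then show "i \<in> {1..n}"
      using labelling_outside[OF x, of i] m unfolding roots_def by fastforce
  qed
qed

lemma Union_blocks: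
  assumes x: "x \<in> labelling n"
  shows "(\<Union>X\<in>blocks n x. fst X) = {i \<in> {1..n}. \<exists>m g. x i = Blk m g}"
proof (intro Set.set_eqI iffI)
  fix i assume "i \<in> (\<Union>X\<in>blocks n x. fst X)"
  then obtain m where "m \<in> roots n x" "i \<in> block x m"
    by (auto simp: blocks_def)
  then show "i \<in> {i \<in> {1..n}. \<exists>m g. x i = Blk m g}"
    using block_subset(1)[OF x, of m] block_gain[of i x m] by blast
next
  fix i assume "i \<in> {i \<in> {1..n}. \<exists>m g. x i = Blk m g}"
  then obtain m g where "i \<in> {1..n}" "x i = Blk m g"
    by blast
  then have "m \<in> roots n x" "i \<in> block x m"
    using root_in_roots[OF x] by (auto simp: block_def)
  then show "i \<in> (\<Union>X\<in>blocks n x. fst X)"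
    by (auto simp: blocks_def)
qed

lemma zero_block_blocks:
  assumes x: "x \<in> labelling n"
  shows "i \<in> zero_block n (blocks n x) \<longleftrightarrow> x i = Col (colour x i)"
proof -
  have "i \<in> zero_block n (blocks n x) \<longleftrightarrow> i \<in> {1..n} \<and> \<not> (\<exists>m g. x i = Blk m g)"
    unfolding zero_block_def Union_blocks[OF x] by blast
  also have "\<dots> \<longleftrightarrow> x i = Col (colour x i)"
    using labelling_Col(2)[OF x, of i] by (cases "x i") (auto simp: colour_def)
  finally show ?thesis .
qed

lemma to_dowling_in_dowling:
  assumes x: "x \<in> labelling n"
  shows "to_dowling n x \<in> dowling n G S"
proof -
  have "\<exists>B b. B \<subseteq> {1..n} \<and> B \<noteq> {} \<and> b \<in> B \<rightarrow> carrier G \<and> X = gblock G B b" if X: "X \<in> blocks n x" for X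
  proof -
    obtain m where m: "m \<in> roots n x" "X = gblock G (block x m) (gain x)"
      using X by (auto simp: blocks_def)
    show ?thesis
      using block_subset[OF x m(1)] gain_closed[OF x] m(2)
      by (intro exI[of _ "block x m"] exI[of _ "gain x"]) auto
  qed
  moreover have "fst X \<inter> fst Y = {}" if "X \<in> blocks n x" "Y \<in> blocks n x" "X \<noteq> Y" for X Y
    using that by (auto simp: blocks_def block_def)
  ultimately have "blocks n x \<in> partial_G_partitions G n"
    unfolding partial_G_partitions_def by blast
  moreover have "colour x \<in> zero_block n (blocks n x) \<rightarrow>\<^sub>E S"
  proof (rule PiE_I)
    show "colour x i \<in> S" if "i \<in> zero_block n (blocks n x)" for i
      using that zero_block_blocks[OF x] labelling_Col(1)[OF x] by blast
    show "colour x i = undefined" if "i \<notin> zero_block n (blocks n x)" for i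
      using that zero_block_blocks[OF x, of i] by (cases "x i") (auto simp: colour_def)
  qed
  ultimately show ?thesis
    by (simp add: to_dowling_def dowling_def)
qed

section \<open>Ratios within blocks and covering relations\<close>

lemma block_ratio:
  assumes y: "y \<in> labelling n" and X: "X \<in> blocks n y" "\<phi> \<in> snd X" "i \<in> fst X" "j \<in> fst X"
  shows "y i = translate (\<phi> i \<otimes> inv (\<phi> j)) (y j)"
proof -
  obtain m where m: "m \<in> roots n y" "X = gblock G (block y m) (gain y)"
    using X(1) by (auto simp: blocks_def)
  then have ij: "i \<in> block y m" "j \<in> block y m"
    using X by auto
  obtain g where g: "g \<in> carrier G" "\<And>i. i \<in> block y m \<Longrightarrow> \<phi> i = gain y i \<otimes> g"
    using X(2) unfolding m(2) by (auto elim: snd_gblockE)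
  have c: "gain y i \<in> carrier G" "gain y j \<in> carrier G"
    using gain_closed[OF y] by auto
  have "translate (\<phi> i \<otimes> inv (\<phi> j)) (y j) = translate (gain y i \<otimes> inv (gain y j)) (Blk m (gain y j))"
    using g ij c ratio_cancel block_gain[OF ij(2)] by simp
  also have "\<dots> = y i"
    using c block_gain[OF ij(1)] by (simp add: m_assoc)
  finally show ?thesis ..
qed

text \<open>A criterion without roots: covering relations mention blocks with arbitrary
  representatives, where ratios are at hand but least elements are not singled out.\<close>

lemma le_if_ratios:
  assumes x: "x \<in> labelling n" and y: "y \<in> labelling n"
    and ratio: "\<And>X \<phi> i j. X \<in> blocks n x \<Longrightarrow> \<phi> \<in> snd X \<Longrightarrow> i \<in> fst X \<Longrightarrow> j \<in> fst X \<Longrightarrow>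
      y i = translate (\<phi> i \<otimes> inv (\<phi> j)) (y j)"
    and col: "\<And>i s. x i = Col s \<Longrightarrow> y i = Col s"
  shows "le x y"
  unfolding le_def
proof
  fix i
  show "y i = subst y (x i)"
  proof (cases "x i")
    case (Col s)
    then show ?thesis
      using col by simp
  next
    case (Blk m g)
    note B = labelling_Blk[OF x Blk]
    show ?thesis
    proof (cases "i \<in> {1..n}")
      case True
      then have m: "m \<in> roots n x"
        using root_in_roots[OF x _ Blk] by blast
      let ?B = "block x m"
      \<comment> \<open>This representative is \<open>\<one>\<close> at the root, so its ratio
        between \<open>i\<close> and \<open>m\<close> is the label \<open>g\<close> itself.\<close>
      let ?\<phi> = "\<lambda>i\<in>?B. gain x i \<otimes> \<one>"
      have im: "i \<in> ?B" "m \<in> ?B"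
        using Blk B(4) by (auto simp: block_def)
      have "gblock G ?B (gain x) \<in> blocks n x"
        using m by (auto simp: blocks_def)
      moreover have "?\<phi> \<in> snd (gblock G ?B (gain x))"
        by (auto simp: gblock_def)
      ultimately have "y i = translate (?\<phi> i \<otimes> inv (?\<phi> m)) (y m)"
        by (rule ratio) (simp_all add: im)
      moreover have "?\<phi> i = g" "?\<phi> m = \<one>"
        using im B(1) gain_Blk[of x i m g, OF Blk] gain_Blk[of x m m \<one>, OF B(4)] by auto
      ultimately show ?thesis
        using B(1) Blk by simp
    next
      case False
      then show ?thesis
        using labelling_outside[OF x False] labelling_outside[OF y False] by simp
    qed
  qed
qed

text \<open>Equal colours alone would not suffice: off the zero block \<open>colour y\<close> is
  \<open>undefined\<close>, which may be an element of \<open>S\<close>.\<close>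

lemma colour_eqD:
  assumes x: "x \<in> labelling n" and y: "y \<in> labelling n"
    and xi: "x i = Col s" and i: "i \<in> zero_block n (blocks n y)" and eq: "colour y i = colour x i"
  shows "y i = Col s"
  using zero_block_blocks[OF y, of i] i eq xi by (simp add: colour_def)

lemma Col_in_zero_block: "x \<in> labelling n \<Longrightarrow> x i = Col s \<Longrightarrow> i \<in> zero_block n (blocks n x)"
  by (simp add: zero_block_blocks colour_def)

lemma to_dowling_eq_imp_le:
  assumes x: "x \<in> labelling n" and y: "y \<in> labelling n" and eq: "to_dowling n x = to_dowling n y"
  shows "le x y"
proof -
  have b: "blocks n x = blocks n y" and c: "colour x = colour y"
    using eq by (auto simp: to_dowling_def)
  show ?thesis
  proof (rule le_if_ratios[OF x y])
    show "y i = translate (\<phi> i \<otimes> inv (\<phi> j)) (y j)"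
      if "X \<in> blocks n x" "\<phi> \<in> snd X" "i \<in> fst X" "j \<in> fst X" for X \<phi> i j
      using that unfolding b by (rule block_ratio[OF y])
    show "y i = Col s" if "x i = Col s" for i s
      using Col_in_zero_block[OF x that] colour_eqD[OF x y that] b c by simp
  qed
qed

text \<open>Two labellings with the same image are below each other, so antisymmetry gives
  injectivity.\<close>

lemma inj_on_to_dowling: "inj_on (to_dowling n) (labelling n)"
  by (rule inj_onI) (metis le_antisym to_dowling_eq_imp_le)

text \<open>A merge keeps all ratios inside \<open>A\<close> and inside \<open>B\<close>, since
  \<open>c\<close> is \<open>a\<close> on one and a right translate of \<open>b\<close> on the
  other. A newly coloured block has the colours \<open>act (b i) s\<close>, which are related by the
  ratios of \<open>b\<close>.\<close>

lemma dowling_cover_imp_le: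
  assumes x: "x \<in> labelling n" and y: "y \<in> labelling n"
    and cover: "dowling_cover n G S act (to_dowling n x) (to_dowling n y)"
  shows "le x y"
  using cover
proof (cases rule: dowling_cover.cases)
  case (merge \<beta> A a B b z C c g)
  have bx: "blocks n x = \<beta> \<union> {gblock G A a, gblock G B b}" and "colour x = z"
    and by': "blocks n y = \<beta> \<union> {gblock G C c}" and "colour y = z"
    using merge(1,2) by (auto simp: to_dowling_def)
  then have col: "colour y = colour x"
    by simp
  have zero: "zero_block n (blocks n x) = zero_block n (blocks n y)"
    unfolding bx by' zero_block_def using merge by auto
  have ratio: "y i = translate (c i \<otimes> inv (c j)) (y j)" if "i \<in> C" "j \<in> C" for i j
  proof -
    have cc: "c k \<in> carrier G" if "k \<in> C" for k
      using that merge by (auto simp: Pi_iff)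
    have "gblock G C c \<in> blocks n y" "(\<lambda>i\<in>C. c i \<otimes> \<one>) \<in> snd (gblock G C c)"
      unfolding by' by (auto simp: gblock_def)
    from block_ratio[OF y this, of i j] show ?thesis
      using that cc by simp
  qed
  show ?thesis
  proof (rule le_if_ratios[OF x y])
    fix X \<phi> i j assume X: "X \<in> blocks n x" "\<phi> \<in> snd X" "i \<in> fst X" "j \<in> fst X"
    consider "X \<in> \<beta>" | "X = gblock G A a" | "X = gblock G B b"
      using X(1) bx by auto
    then show "y i = translate (\<phi> i \<otimes> inv (\<phi> j)) (y j)"
    proof cases
      case 1
      then show ?thesis
        using X by' by (intro block_ratio[OF y]) auto
    next
      case 2
      then obtain g0 where g0: "g0 \<in> carrier G" "\<And>i. i \<in> A \<Longrightarrow> \<phi> i = a i \<otimes> g0"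
        using X(2) by (auto elim: snd_gblockE)
      have ij: "i \<in> A" "j \<in> A"
        using X 2 by auto
      then have "a i \<in> carrier G" "a j \<in> carrier G"
        using merge by auto
      then have "\<phi> i \<otimes> inv (\<phi> j) = c i \<otimes> inv (c j)"
        using g0 ij merge ratio_cancel by auto
      then show ?thesis
        using ratio[of i j] ij merge by auto
    next
      case 3
      then obtain g0 where g0: "g0 \<in> carrier G" "\<And>i. i \<in> B \<Longrightarrow> \<phi> i = b i \<otimes> g0"
        using X(2) by (auto elim: snd_gblockE)
      have ij: "i \<in> B" "j \<in> B"
        using X 3 by auto
      then have "b i \<in> carrier G" "b j \<in> carrier G"
        using merge by auto
      then have "\<phi> i \<otimes> inv (\<phi> j) = c i \<otimes> inv (c j)"
        using g0 ij merge ratio_cancel by auto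
      then show ?thesis
        using ratio[of i j] ij merge by auto
    qed
  next
    show "y i = Col s" if "x i = Col s" for i s
      using Col_in_zero_block[OF x that] colour_eqD[OF x y that] zero col by simp
  qed
next
  case (color \<beta> B b z z' s)
  have bx: "blocks n x = \<beta> \<union> {gblock G B b}" and zx: "colour x = z"
    and by': "blocks n y = \<beta>" and zy: "colour y = z'"
    using color(1,2) by (auto simp: to_dowling_def)
  have part: "blocks n x \<in> partial_G_partitions G n"
    using to_dowling_in_dowling[OF x] by (simp add: to_dowling_def dowling_def)
  have disj: "B \<inter> fst X = {}" if "X \<in> \<beta>" for X
  proof -
    have "gblock G B b \<in> blocks n x" "X \<in> blocks n x" "gblock G B b \<noteq> X"
      using that bx color by auto
    moreover have "\<forall>X\<in>blocks n x. \<forall>Y\<in>blocks n x. X \<noteq> Y \<longrightarrow> fst X \<inter> fst Y = {}"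
      using part unfolding partial_G_partitions_def mem_Collect_eq by (rule conjunct2)
    ultimately have "fst (gblock G B b) \<inter> fst X = {}"
      by blast
    then show ?thesis
      by simp
  qed
  have "\<exists>B' b'. B' \<subseteq> {1..n} \<and> gblock G B b = gblock G B' b'"
    using part bx unfolding partial_G_partitions_def by blast
  then have Bn: "B \<subseteq> {1..n}"
    by (metis fst_gblock)
  have yB: "y i = Col (act (b i) s)" if "i \<in> B" for i
  proof -
    have "i \<in> zero_block n (blocks n y)"
      using that Bn disj unfolding by' zero_block_def by auto
    then show ?thesis
      using zero_block_blocks[OF y, of i] that zy color by simp
  qed
  show ?thesis
  proof (rule le_if_ratios[OF x y])
    fix X \<phi> i j assume X: "X \<in> blocks n x" "\<phi> \<in> snd X" "i \<in> fst X" "j \<in> fst X"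
    consider "X \<in> \<beta>" | "X = gblock G B b"
      using X(1) bx by auto
    then show "y i = translate (\<phi> i \<otimes> inv (\<phi> j)) (y j)"
    proof cases
      case 1
      then show ?thesis
        using X by' by (intro block_ratio[OF y]) auto
    next
      case 2
      then obtain g0 where g0: "g0 \<in> carrier G" "\<And>i. i \<in> B \<Longrightarrow> \<phi> i = b i \<otimes> g0"
        using X(2) by (auto elim: snd_gblockE)
      have ij: "i \<in> B" "j \<in> B"
        using X 2 by auto
      then have bij: "b i \<in> carrier G" "b j \<in> carrier G"
        using color by auto
      then have "\<phi> i \<otimes> inv (\<phi> j) = b i \<otimes> inv (b j)"
        using g0 ij ratio_cancel by auto
      moreover have "act (b i \<otimes> inv (b j)) (act (b j) s) = act (b i) s"
        using bij color(7) by (simp add: act_mult[symmetric] m_assoc)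
      ultimately show ?thesis
        using yB ij by simp
    qed
  next
    show "y i = Col s'" if "x i = Col s'" for i s'
    proof (rule colour_eqD[OF x y that])
      have i: "i \<in> zero_block n (blocks n x)"
        by (rule Col_in_zero_block[OF x that])
      then show "i \<in> zero_block n (blocks n y)"
        unfolding bx by' zero_block_def by auto
      show "colour y i = colour x i"
        using i color unfolding bx zx zy by simp
    qed
  qed
qed

section \<open>Single covering steps on labellings\<close>

definition relabel :: "nat \<Rightarrow> ('g, 's) label \<Rightarrow> (nat \<Rightarrow> ('g, 's) label) \<Rightarrow> nat \<Rightarrow> ('g, 's) label"
  where "relabel m c x i = (case x i of Col s \<Rightarrow> Col s | Blk k g \<Rightarrow> if k = m then translate g c else Blk k g)"

lemma relabel_block: "x i = Blk m g \<Longrightarrow> relabel m c x i = translate g c"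
  by (simp add: relabel_def)

lemma relabel_other: "i \<notin> block x m \<Longrightarrow> relabel m c x i = x i"
  by (auto simp: relabel_def block_def split: label.splits)

text \<open>For \<open>c = Blk k h\<close> the new root has to be a smaller point that is already a
  root; this keeps roots least in their blocks.\<close>

lemma relabel_labelling:
  assumes x: "x \<in> labelling n" and m: "m \<in> roots n x" and c: "c \<in> labels"
    and root: "\<And>k h. c = Blk k h \<Longrightarrow> k < m \<and> 1 \<le> k \<and> x k = Blk k \<one>"
  shows "relabel m c x \<in> labelling n"
proof (rule labellingI)
  let ?x = "relabel m c x"
  fix i
  show "?x i = Blk i \<one>" if "i \<notin> {1..n}"
    using that labelling_outside[OF x that] m by (auto simp: relabel_def roots_def)
  have lab: "?x i \<in> labels"
    using labelling_labels[OF x, of i] c by (auto simp: relabel_def translate_closed split: label.splits)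
  then show "s \<in> S" if "?x i = Col s" for s
    using that by simp
  have fixed: "?x k = Blk k \<one>" if "x k = Blk k \<one>" "k \<noteq> m" for k
    using that by (simp add: relabel_def)
  show "g \<in> carrier G \<and> k \<le> i \<and> (1 \<le> i \<longrightarrow> 1 \<le> k) \<and> ?x k = Blk k \<one>" if xi: "?x i = Blk k g" for k g
  proof (cases "i \<in> block x m")
    case True
    then obtain g' where g': "x i = Blk m g'"
      by (auto simp: block_def)
    then obtain h where h: "c = Blk k h"
      using xi relabel_block[of x i m g' c, OF g'] by (cases c) auto
    have "m \<le> i"
      using labelling_Blk(2)[OF x g'] .
    then show ?thesis
      using root[OF h] lab xi fixed[of k] by auto
  next
    case False
    then have "x i = Blk k g"
      using xi relabel_other by metis
    moreover have "k \<noteq> m"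
      using False calculation by (auto simp: block_def)
    ultimately show ?thesis
      using labelling_Blk[OF x, of i k g] fixed[of k] by auto
  qed
qed

text \<open>\<open>y\<close> satisfies its own equations, so replacing the unknown \<open>m\<close>
  by its value \<open>y m\<close> in the equations of \<open>x\<close> gives equations that
  \<open>y\<close> still satisfies.\<close>

lemma relabel_le:
  assumes x: "x \<in> labelling n" and y: "y \<in> labelling n" and "le x y"
  shows "le (relabel m (y m) x) y"
  unfolding le_def
proof
  fix i
  have yx: "y i = subst y (x i)" and yy: "y m = subst y (y m)"
    using \<open>le x y\<close> le_refl[OF y] by (auto simp: le_def)
  show "y i = subst y (relabel m (y m) x i)"
  proof (cases "i \<in> block x m")
    case True
    then obtain g where g: "x i = Blk m g"
      by (auto simp: block_def)
    have "subst y (translate g (y m)) = translate g (subst y (y m))"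
      using labelling_Blk(1)[OF x g] labelling_labels[OF y] by (intro subst_translate[OF y])
    then show ?thesis
      using yx yy g by (simp add: relabel_block)
  next
    case False
    then show ?thesis
      using yx by (simp add: relabel_other)
  qed
qed

text \<open>The number of blocks drops by one; this is the measure for the induction that reaches
  \<open>y\<close> from \<open>x\<close> by covers.\<close>

lemma roots_relabel:
  assumes x: "x \<in> labelling n" and m: "m \<in> roots n x" and c: "c \<in> labels" "c \<noteq> Blk m \<one>"
    and root: "\<And>k h. c = Blk k h \<Longrightarrow> k < m"
  shows "roots n (relabel m c x) = roots n x - {m}"
proof (intro Set.set_eqI iffI)
  fix k assume k: "k \<in> roots n (relabel m c x)"
  then have rk: "relabel m c x k = Blk k \<one>" and kn: "k \<in> {1..n}"
    by (auto simp: roots_def)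
  have "k \<notin> block x m"
  proof
    assume "k \<in> block x m"
    then obtain g where g: "x k = Blk m g"
      by (auto simp: block_def)
    then obtain h where "c = Blk k h"
      using rk relabel_block[of x k m g c, OF g] by (cases c) auto
    then show False
      using root labelling_Blk(2)[OF x g] by fastforce
  qed
  then show "k \<in> roots n x - {m}"
    using rk kn relabel_other[of k x m c] block_subset(2)[OF x m] by (auto simp: roots_def)
next
  fix k assume "k \<in> roots n x - {m}"
  then show "k \<in> roots n (relabel m c x)"
    by (auto simp: roots_def relabel_def)
qed

lemma gblock_relabel:
  assumes "k \<noteq> m" "\<And>h. c \<noteq> Blk k h"
  shows "gblock G (block (relabel m c x) k) (gain (relabel m c x)) = gblock G (block x k) (gain x)"
proof -
  have eq: "relabel m c x i = Blk k g \<longleftrightarrow> x i = Blk k g" for i g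
  proof (cases "x i")
    case (Blk k' g')
    then show ?thesis
      using assms by (cases c) (auto simp: relabel_def)
  qed (simp add: relabel_def)
  then have block_eq: "block (relabel m c x) k = block x k"
    by (simp add: block_def)
  have "gain (relabel m c x) i = gain x i" if "i \<in> block x k" for i
    using eq[of i "gain x i"] block_gain[OF that] by (metis gain_Blk)
  then show ?thesis
    unfolding block_eq by (rule gblock_cong)
qed

lemma gblock_neq:
  assumes "x \<in> labelling n" "k \<in> roots n x" "m \<in> roots n x" "k \<noteq> m"
  shows "gblock G (block x k) b \<noteq> gblock G (block x m) b'"
proof
  assume "gblock G (block x k) b = gblock G (block x m) b'"
  then have "block x k = block x m"
    by (metis fst_gblock)
  then have "k \<in> block x m"
    using block_subset(2)[OF assms(1,2)] by simp
  then show False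
    using assms by (auto simp: block_def roots_def)
qed

lemma dowling_cover_relabel_Col:
  assumes x: "x \<in> labelling n" and m: "m \<in> roots n x" and s: "s \<in> S"
  shows "dowling_cover n G S act (to_dowling n x) (to_dowling n (relabel m (Col s) x))"
proof -
  let ?x = "relabel m (Col s) x"
  let ?B = "gblock G (block x m) (gain x)"
  have x': "?x \<in> labelling n"
    using x m s by (intro relabel_labelling) auto
  have b: "blocks n ?x = (\<lambda>k. gblock G (block x k) (gain x)) ` (roots n x - {m})"
    unfolding blocks_def using s by (subst roots_relabel[OF x m]) (auto simp: gblock_relabel intro!: image_cong)
  then have bx: "blocks n x = blocks n ?x \<union> {?B}"
    using m by (auto simp: blocks_def)
  have "dowling_cover n G S act (blocks n ?x \<union> {?B}, colour x) (blocks n ?x, colour ?x)"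
  proof (rule dowling_cover.color[where s = s])
    show "(blocks n ?x \<union> {?B}, colour x) \<in> dowling n G S"
      using to_dowling_in_dowling[OF x] bx by (simp add: to_dowling_def)
    show "(blocks n ?x, colour ?x) \<in> dowling n G S"
      using to_dowling_in_dowling[OF x'] by (simp add: to_dowling_def)
    show "?B \<notin> blocks n ?x"
      unfolding b using gblock_neq[OF x m] by blast
    show "gain x \<in> block x m \<rightarrow> carrier G"
      using gain_closed[OF x] by auto
    show "\<forall>i\<in>zero_block n (blocks n ?x \<union> {?B}). colour ?x i = colour x i"
    proof
      fix i assume "i \<in> zero_block n (blocks n ?x \<union> {?B})"
      then have "x i = Col (colour x i)"
        using zero_block_blocks[OF x] bx by simp
      then show "colour ?x i = colour x i"
        by (cases "x i") (simp_all add: colour_def relabel_def)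
    qed
    show "\<forall>i\<in>block x m. colour ?x i = act (gain x i) s"
      by (auto simp: block_def relabel_block colour_def gain_def)
  qed (rule s)
  then show ?thesis
    using bx by (simp add: to_dowling_def)
qed

lemma dowling_cover_relabel_Blk:
  assumes x: "x \<in> labelling n" and m: "m \<in> roots n x" and k: "k \<in> roots n x" "k < m"
    and h: "h \<in> carrier G"
  shows "dowling_cover n G S act (to_dowling n x) (to_dowling n (relabel m (Blk k h) x))"
proof -
  let ?x = "relabel m (Blk k h) x"
  let ?A = "gblock G (block x k) (gain x)" and ?B = "gblock G (block x m) (gain x)"
  let ?C = "gblock G (block ?x k) (gain ?x)"
  define \<beta> where "\<beta> = (\<lambda>j. gblock G (block x j) (gain x)) ` (roots n x - {k, m})"
  have k': "1 \<le> k" "x k = Blk k \<one>"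
    using k by (auto simp: roots_def)
  have x': "?x \<in> labelling n"
    using x m h k k' by (intro relabel_labelling) auto
  have "roots n ?x = roots n x - {m}"
    using x m h k by (intro roots_relabel) auto
  also have "\<dots> = insert k (roots n x - {k, m})"
    using k by auto
  finally have bx': "blocks n ?x = \<beta> \<union> {?C}"
    unfolding blocks_def \<beta>_def by (auto simp: gblock_relabel intro!: image_eqI)
  have bx: "blocks n x = \<beta> \<union> {?A, ?B}"
    using m k unfolding blocks_def \<beta>_def by auto
  have col: "colour ?x = colour x"
    by (auto simp: colour_def relabel_def fun_eq_iff split: label.splits)
  \<comment> \<open>A point of the block of \<open>m\<close> with gain \<open>g\<close> gets the
    gain \<open>g \<otimes> h\<close>, so the right factor of the merge is \<open>h\<close>.\<close>
  have "dowling_cover n G S act (\<beta> \<union> {?A, ?B}, colour x) (\<beta> \<union> {?C}, colour x)"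
  proof (rule dowling_cover.merge[where g = h])
    show "(\<beta> \<union> {?A, ?B}, colour x) \<in> dowling n G S"
      using to_dowling_in_dowling[OF x] bx by (simp add: to_dowling_def)
    show "(\<beta> \<union> {?C}, colour x) \<in> dowling n G S"
      using to_dowling_in_dowling[OF x'] bx' col by (simp add: to_dowling_def)
    show "?A \<notin> \<beta>" "?B \<notin> \<beta>"
      unfolding \<beta>_def using gblock_neq[OF x m] gblock_neq[OF x k(1)] by blast+
    show "?A \<noteq> ?B"
      using gblock_neq[OF x k(1) m] k(2) by simp
    show "gain x \<in> block x k \<rightarrow> carrier G" "gain x \<in> block x m \<rightarrow> carrier G"
      using gain_closed[OF x] by auto
    show "block ?x k = block x k \<union> block x m"
    proof (intro Set.set_eqI)
      show "i \<in> block ?x k \<longleftrightarrow> i \<in> block x k \<union> block x m" for i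
        using k(2) by (cases "x i") (auto simp: block_def relabel_def)
    qed
    show "\<forall>i\<in>block x k. gain ?x i = gain x i"
      using k(2) by (auto simp: block_def relabel_def gain_def)
    show "\<forall>i\<in>block x m. gain ?x i = gain x i \<otimes> h"
      by (auto simp: block_def relabel_def gain_def)
  qed (rule h)
  then show ?thesis
    using bx bx' col by (simp add: to_dowling_def)
qed

lemma finite_roots: "finite (roots n x)"
  by (simp add: roots_def)

text \<open>Induction on the number of blocks of \<open>x\<close>. A root \<open>m\<close> of
  \<open>x\<close> that is not a root of \<open>y\<close> is given its label in \<open>y\<close>;
  this is a merge or a colouring and stays below \<open>y\<close>. If there is no such root, the
  labellings agree.\<close>

lemma le_imp_dowling_le:
  assumes "x \<in> labelling n" and y: "y \<in> labelling n" and "le x y"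
  shows "dowling_le n G S act (to_dowling n x) (to_dowling n y)"
  using assms(1,3)
proof (induction "card (roots n x)" arbitrary: x rule: less_induct)
  case (less x)
  note x = \<open>x \<in> labelling n\<close>
  have yx: "y i = subst y (x i)" for i
    using \<open>le x y\<close> by (auto simp: le_def)
  show ?case
  proof (cases "\<forall>m\<in>roots n x. y m = Blk m \<one>")
    case True
    have "y i = x i" for i
    proof (cases "i \<in> {1..n}")
      case i: True
      show ?thesis
      proof (cases "x i")
        case (Col s)
        then show ?thesis
          using yx[of i] by simp
      next
        case (Blk m g)
        then show ?thesis
          using yx[of i] True root_in_roots[OF x i Blk] labelling_Blk(1)[OF x Blk] by simp
      qed
    next
      case False
      then show ?thesis
        using labelling_outside[OF x] labelling_outside[OF y] by metis
    qed
    then have "y = x"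
      by blast
    then show ?thesis
      by (simp add: dowling_le_def)
  next
    case False
    then obtain m where m: "m \<in> roots n x" "y m \<noteq> Blk m \<one>"
      by blast
    let ?x = "relabel m (y m) x"
    \<comment> \<open>The root \<open>k\<close> of \<open>m\<close> in \<open>y\<close> is also a
      root in \<open>x\<close>: if \<open>j\<close> is the root of \<open>k\<close> in
      \<open>x\<close>, then \<open>j \<le> k\<close>, and \<open>y j\<close> has root
      \<open>k\<close>, so \<open>k \<le> j\<close>. Hence the step merges two existing blocks of
      \<open>x\<close>.\<close>
    have root: "k < m \<and> 1 \<le> k \<and> k \<in> roots n x" if ym: "y m = Blk k h" for k h
    proof -
      note B = labelling_Blk[OF y ym]
      have mn: "m \<in> {1..n}"
        using m by (simp add: roots_def)
      have k1: "1 \<le> k" and "k \<le> m"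
        using B mn by auto
      have "k \<noteq> m"
        using B(4) m(2) by auto
      obtain j g where xk: "x k = Blk j g"
        using yx[of k] B(4) by (cases "x k") auto
      note X = labelling_Blk[OF x xk]
      have "translate g (y j) = Blk k \<one>"
        using yx[of k] xk B(4) by simp
      then obtain g' where "y j = Blk k g'"
        by (cases "y j") auto
      then have "k \<le> j"
        using labelling_Blk(2)[OF y] by blast
      then have "j = k"
        using X(2) by simp
      then have "x k = Blk k \<one>"
        using X(4) by simp
      then show ?thesis
        using k1 \<open>k \<le> m\<close> \<open>k \<noteq> m\<close> mn by (auto simp: roots_def)
    qed
    have ym: "y m \<in> labels"
      by (rule labelling_labels[OF y])
    have x': "?x \<in> labelling n"
      using root by (intro relabel_labelling[OF x m(1) ym]) (auto simp: roots_def)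
    have "roots n ?x = roots n x - {m}"
      using root by (intro roots_relabel[OF x m(1) ym m(2)]) auto
    then have "card (roots n ?x) < card (roots n x)"
      using m(1) finite_roots by (metis card_Diff1_less)
    then have "dowling_le n G S act (to_dowling n ?x) (to_dowling n y)"
      using less.hyps x' relabel_le[OF x y \<open>le x y\<close>] by blast
    moreover have "dowling_cover n G S act (to_dowling n x) (to_dowling n ?x)"
    proof (cases "y m")
      case (Col s)
      then show ?thesis
        using dowling_cover_relabel_Col[OF x m(1)] ym by simp
    next
      case (Blk k h)
      then show ?thesis
        using dowling_cover_relabel_Blk[OF x m(1)] root[OF Blk] ym by simp
    qed
    ultimately show ?thesis
      unfolding dowling_le_def by (rule converse_rtranclp_into_rtranclp[rotated])
  qed
qed

section \<open>Every element of the poset comes from a labelling\<close>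

lemma to_dowling_onto:
  assumes "(\<beta>, z) \<in> dowling n G S"
  shows "\<exists>x\<in>labelling n. to_dowling n x = (\<beta>, z)"
proof -
  have part: "\<forall>X\<in>\<beta>. \<exists>B b. B \<subseteq> {1..n} \<and> B \<noteq> {} \<and> b \<in> B \<rightarrow> carrier G \<and> X = gblock G B b"
    and disj: "\<And>X Y. X \<in> \<beta> \<Longrightarrow> Y \<in> \<beta> \<Longrightarrow> X \<noteq> Y \<Longrightarrow> fst X \<inter> fst Y = {}"
    and z: "z \<in> zero_block n \<beta> \<rightarrow>\<^sub>E S"
    using assms by (auto simp: dowling_def partial_G_partitions_def)
  have "\<forall>X\<in>\<beta>. \<exists>b. fst X \<subseteq> {1..n} \<and> fst X \<noteq> {} \<and> b \<in> fst X \<rightarrow> carrier G \<and> X = gblock G (fst X) b"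
    using part by (metis fst_gblock)
  then obtain b where b: "\<And>X. X \<in> \<beta> \<Longrightarrow> fst X \<subseteq> {1..n}" "\<And>X. X \<in> \<beta> \<Longrightarrow> fst X \<noteq> {}"
    "\<And>X. X \<in> \<beta> \<Longrightarrow> b X \<in> fst X \<rightarrow> carrier G" "\<And>X. X \<in> \<beta> \<Longrightarrow> X = gblock G (fst X) (b X)"
    by metis
  define mn where "mn X = Min (fst X)" for X :: "nat set \<times> (nat \<Rightarrow> 'g) set"
  have fin: "finite (fst X)" if "X \<in> \<beta>" for X
    using b(1)[OF that] finite_subset by blast
  have mn: "mn X \<in> fst X" "\<And>i. i \<in> fst X \<Longrightarrow> mn X \<le> i" if "X \<in> \<beta>" for X
    using fin[OF that] b(2)[OF that] by (auto simp: mn_def)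
  \<comment> \<open>Blocks are disjoint, so the definite description picks the unique block of
    \<open>i\<close>.\<close>
  define x where "x i = (if \<exists>X\<in>\<beta>. i \<in> fst X
      then (let X = (THE X. X \<in> \<beta> \<and> i \<in> fst X) in Blk (mn X) (b X i \<otimes> inv (b X (mn X))))
      else if i \<in> {1..n} then Col (z i) else Blk i \<one>)" for i
  have x_blk: "x i = Blk (mn X) (b X i \<otimes> inv (b X (mn X)))" if X: "X \<in> \<beta>" "i \<in> fst X" for X i
  proof -
    have "Y = X" if "Y \<in> \<beta>" "i \<in> fst Y" for Y
      using that X disj[of Y X] by blast
    then have "(THE X. X \<in> \<beta> \<and> i \<in> fst X) = X"
      using X by (intro the_equality) blast+
    then show ?thesis
      using X by (auto simp: x_def)
  qed
  have x_col: "x i = Col (z i)" if "i \<in> zero_block n \<beta>" for i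
    using that by (auto simp: x_def zero_block_def)
  have x_out: "x i = Blk i \<one>" if "i \<notin> {1..n}" for i
  proof -
    have "(\<exists>X\<in>\<beta>. i \<in> fst X) = False" "(i \<in> {1..n}) = False"
      using that b(1) by blast+
    then show ?thesis
      unfolding x_def by (simp only: if_False)
  qed
  have cases: "(\<exists>X\<in>\<beta>. i \<in> fst X) \<or> i \<in> zero_block n \<beta> \<or> i \<notin> {1..n}" for i
    by (auto simp: zero_block_def)
  have bc: "b X i \<in> carrier G" if "X \<in> \<beta>" "i \<in> fst X" for X i
    using b(3)[OF that(1)] that(2) by auto
  have x_mn: "x (mn X) = Blk (mn X) \<one>" if "X \<in> \<beta>" for X
    using x_blk[OF that mn(1)[OF that]] bc[OF that mn(1)[OF that]] by simp
  have x: "x \<in> labelling n"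
  proof (rule labellingI)
    fix i
    show "x i = Blk i \<one>" if "i \<notin> {1..n}"
      by (rule x_out[OF that])
    show "s \<in> S" if "x i = Col s" for s
      using cases[of i] that x_blk[of _ i] x_col[of i] x_out[of i] z by auto
    show "g \<in> carrier G \<and> m \<le> i \<and> (1 \<le> i \<longrightarrow> 1 \<le> m) \<and> x m = Blk m \<one>" if xi: "x i = Blk m g" for m g
    proof -
      consider X where "X \<in> \<beta>" "i \<in> fst X" | "i \<notin> {1..n}"
        using cases[of i] x_col[of i] xi by auto
      then show ?thesis
      proof cases
        case (1 X)
        then have "m = mn X" "g = b X i \<otimes> inv (b X (mn X))"
          using x_blk xi by auto
        moreover have "mn X \<in> {1..n}"
          using mn(1) b(1) 1 by blast
        ultimately show ?thesis
          using 1 mn(2) x_mn bc mn(1) by auto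
      next
        case 2
        then have "m = i" "g = \<one>"
          using x_out xi by auto
        then show ?thesis
          using xi by simp
      qed
    qed
  qed
  have roots: "roots n x = mn ` \<beta>"
  proof (intro Set.set_eqI iffI)
    fix k assume k: "k \<in> roots n x"
    then obtain X where "X \<in> \<beta>" "k \<in> fst X"
      using cases[of k] x_col[of k] by (auto simp: roots_def)
    then show "k \<in> mn ` \<beta>"
      using x_blk k by (auto simp: roots_def)
  next
    fix k assume "k \<in> mn ` \<beta>"
    then obtain X where X: "X \<in> \<beta>" "k = mn X"
      by blast
    then have "k \<in> {1..n}"
      using mn(1)[OF X(1)] b(1)[OF X(1)] by blast
    then show "k \<in> roots n x"
      using x_mn[OF X(1)] X(2) by (simp add: roots_def)
  qed
  have blk: "gblock G (block x (mn X)) (gain x) = X" if X: "X \<in> \<beta>" for X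
  proof -
    have "block x (mn X) = fst X"
    proof (intro Set.set_eqI iffI)
      fix i assume "i \<in> block x (mn X)"
      then obtain g where g: "x i = Blk (mn X) g"
        by (auto simp: block_def)
      have "i \<in> {1..n}"
      proof (rule ccontr)
        assume "i \<notin> {1..n}"
        then have "mn X = i"
          using x_out g by auto
        then show False
          using mn(1)[OF X] b(1)[OF X] \<open>i \<notin> {1..n}\<close> by blast
      qed
      then obtain Y where Y: "Y \<in> \<beta>" "i \<in> fst Y"
        using cases[of i] x_col[of i] g by auto
      then have "mn Y = mn X"
        using x_blk g by auto
      then have "Y = X"
        using disj[OF Y(1) X] mn(1)[OF X] mn(1)[OF Y(1)] by auto
      then show "i \<in> fst X"
        using Y by simp
    next
      fix i assume "i \<in> fst X"
      then show "i \<in> block x (mn X)"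
        using x_blk[OF X] by (auto simp: block_def)
    qed
    moreover have "gblock G (fst X) (gain x) = gblock G (fst X) (\<lambda>i. b X i \<otimes> inv (b X (mn X)))"
      using x_blk[OF X] by (intro gblock_cong) (simp add: gain_def)
    \<comment> \<open>Dividing by the value at the least element is a right translation and changes
      only the representative.\<close>
    moreover have "\<dots> = gblock G (fst X) (b X)"
      using b(3)[OF X] bc[OF X mn(1)[OF X]] by (intro gblock_translate) auto
    ultimately show ?thesis
      using b(4)[OF X] by simp
  qed
  have blocks: "blocks n x = \<beta>"
    unfolding blocks_def roots using blk by (force simp: image_iff)
  have "colour x i = z i" for i
  proof (cases "i \<in> zero_block n \<beta>")
    case True
    then show ?thesis
      using x_col by (simp add: colour_def)
  next
    case False
    then have "z i = undefined"
      using z by (rule PiE_arb[rotated])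
    moreover have "x i \<noteq> Col (colour x i)"
      using zero_block_blocks[OF x, of i] blocks False by simp
    then have "colour x i = undefined"
      by (cases "x i") (auto simp: colour_def)
    ultimately show ?thesis
      by simp
  qed
  then have "to_dowling n x = (\<beta>, z)"
    using blocks by (auto simp: to_dowling_def)
  then show ?thesis
    using x by blast
qed

lemma bij_betw_to_dowling: "bij_betw (to_dowling n) (labelling n) (dowling n G S)"
proof (rule bij_betw_imageI[OF inj_on_to_dowling])
  show "to_dowling n ` labelling n = dowling n G S"
  proof
    show "to_dowling n ` labelling n \<subseteq> dowling n G S"
      using to_dowling_in_dowling by blast
    show "dowling n G S \<subseteq> to_dowling n ` labelling n"
    proof
      fix w assume "w \<in> dowling n G S"
      then show "w \<in> to_dowling n ` labelling n"
        using to_dowling_onto[of "fst w" "snd w" n] by force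
    qed
  qed
qed

text \<open>Along a sequence of covers every intermediate element is the image of a labelling, so
  each cover yields an instance of \<open>le\<close>, and these compose.\<close>

lemma dowling_le_iff:
  assumes x: "x \<in> labelling n" and y: "y \<in> labelling n"
  shows "dowling_le n G S act (to_dowling n x) (to_dowling n y) \<longleftrightarrow> le x y"
proof
  have "\<exists>y'\<in>labelling n. to_dowling n y' = w \<and> le x y'" if "(dowling_cover n G S act)\<^sup>*\<^sup>* (to_dowling n x) w" for w
    using that
  proof (induction rule: rtranclp_induct)
    case base
    then show ?case
      using x le_refl by blast
  next
    case (step v w)
    then obtain v' where v': "v' \<in> labelling n" "to_dowling n v' = v" "le x v'"
      by blast
    have "w \<in> dowling n G S"
      using step(2) by (auto elim: dowling_cover.cases)
    then obtain w' where w': "w' \<in> labelling n" "to_dowling n w' = w"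
      using to_dowling_onto by (cases w) blast
    then have "le v' w'"
      using dowling_cover_imp_le step(2) v' by blast
    then show ?case
      using le_trans v' w' x by blast
  qed
  then show "le x y" if "dowling_le n G S act (to_dowling n x) (to_dowling n y)"
    using that y inj_on_to_dowling unfolding dowling_le_def by (metis inj_onD)
qed (rule le_imp_dowling_le[OF x y])

lemma to_dowling_finest: "to_dowling n finest = dowling_bot n G"
proof -
  have "roots n finest = {1..n}" "\<And>m. block finest m = {m}"
    by (auto simp: roots_def finest_def block_def)
  moreover have "gain finest = (\<lambda>_. \<one>)" "colour finest = (\<lambda>_. undefined)"
    by (auto simp: gain_def colour_def finest_def)
  ultimately show ?thesis
    by (simp add: to_dowling_def blocks_def dowling_bot_def)
qed

lemma cone_equiv_dowling_labelling:
  "cone_equiv (chain_cone (dowling n G S - {dowling_bot n G}) (dowling_le n G S act)) (\<lambda>_. 0)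
    (chain_cone (labelling n - {finest}) le) (\<lambda>_. 0)"
proof (rule cone_equiv_sym, rule cone_equiv_chain_cone_iso)
  show "bij_betw (to_dowling n) (labelling n - {finest}) (dowling n G S - {dowling_bot n G})"
  proof (rule bij_betw_imageI)
    show "inj_on (to_dowling n) (labelling n - {finest})"
      by (rule inj_on_subset[OF inj_on_to_dowling]) blast
    have "to_dowling n ` (labelling n - {finest}) = to_dowling n ` labelling n - to_dowling n ` {finest}"
      using finest_labelling by (intro inj_on_image_set_diff[OF inj_on_to_dowling]) auto
    then show "to_dowling n ` (labelling n - {finest}) = dowling n G S - {dowling_bot n G}"
      using bij_betw_to_dowling[of n] by (simp add: bij_betw_def to_dowling_finest)
  qed
  show "le u v \<longleftrightarrow> dowling_le n G S act (to_dowling n u) (to_dowling n v)"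
    if "u \<in> labelling n - {finest}" "v \<in> labelling n - {finest}" for u v
    using that dowling_le_iff by simp
qed

end

section \<open>Induction on the number of points\<close>

context dowling_data
begin

lemma labelling_0: "labelling 0 = {finest}"
proof
  show "labelling 0 \<subseteq> {finest}"
    using labelling_outside[of _ 0] by (auto simp: finest_def)
qed (simp add: finest_labelling)

lemma labelling_Suc_trivial:
  assumes "labelling k = {finest}" "atoms (Suc k) = {}"
  shows "labelling (Suc k) = {finest}"
  using isolate_labelling[of _ k] isolate_eq_finest_iff[of _ k] assms finest_labelling[of "Suc k"] by blast

lemma atoms_1_trivial: "S = {} \<Longrightarrow> atoms (Suc 0) = {}"
  unfolding atoms_def atom_labels_def by simp

text \<open>Stage \<open>k\<close> contributes the cone over the empty complex, which is just its
  apex and hence \<open>euclid 0\<close>; the join with it leaves the discrete set of atoms.\<close>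

lemma cone_equiv_labelling_base:
  assumes fin: "finite S" "finite (carrier G)" and "labelling k = {finest}" "atoms (Suc k) \<noteq> {}"
  shows "cone_equiv (chain_cone (labelling (Suc k) - {finest}) le) (\<lambda>_. 0)
    (star {..<card (atoms (Suc k)) - 1} \<times> euclid 0) (star_centre, \<lambda>_. 0)"
proof -
  have "chain_cone (labelling k - {finest}) le = {\<lambda>_. 0}"
    using assms(3) by (simp add: chain_cone_empty)
  moreover have "euclid 0 = {\<lambda>_. 0}"
    by (auto simp: euclid_def)
  ultimately have "cone_equiv (chain_cone (labelling k - {finest}) le) (\<lambda>_. 0) (euclid 0) (\<lambda>_. 0)"
    by (intro cone_equivI_inverse[where f = "\<lambda>_ _. 0" and g = "\<lambda>_ _. 0"]) (auto simp: cone_map_def)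
  then show ?thesis
    by (rule cone_equiv_trans[OF cone_equiv_labelling_Suc[OF fin]
          cone_equiv_Times[OF cone_equiv_atoms[OF fin assms(4)]]])
qed

lemma cone_equiv_labelling_step:
  assumes fin: "finite S" "finite (carrier G)" and "atoms (Suc j) \<noteq> {}"
    and IH: "cone_equiv (chain_cone (labelling j - {finest}) le) (\<lambda>_. 0)
      (star {..<k} \<times> euclid d) (star_centre, \<lambda>_. 0)"
  shows "cone_equiv (chain_cone (labelling (Suc j) - {finest}) le) (\<lambda>_. 0)
    (star {..<(card (atoms (Suc j)) - 1) * k} \<times> euclid (Suc d)) (star_centre, \<lambda>_. 0)"
proof -
  let ?a = "card (atoms (Suc j)) - 1"
  obtain h where h: "bij_betw h ({..<?a} \<times> {..<k}) {..<?a * k}"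
    using finite_same_card_bij[of "{..<?a} \<times> {..<k}" "{..<?a * k}"] by (auto simp: card_cartesian_product)
  have "cone_equiv (star {..<?a} \<times> star {..<k} \<times> euclid d) (star_centre, star_centre, \<lambda>_. 0)
    (star {..<?a * k} \<times> euclid (Suc d)) (star_centre, \<lambda>_. 0)"
    by (rule cone_equiv_trans[OF cone_equiv_star_Times_star_euclid
          cone_equiv_Times[OF cone_equiv_star_bij[OF h] cone_equiv_refl]]) auto
  then show ?thesis
    by (rule cone_equiv_trans[OF cone_equiv_trans[OF cone_equiv_labelling_Suc[OF fin]
          cone_equiv_Times[OF cone_equiv_atoms[OF fin assms(3)] IH]]])
qed

text \<open>The index \<open>j\<close> is the last stage at which only the bottom exists:
  \<open>0\<close> for nonempty \<open>S\<close> and \<open>1\<close> otherwise. Each later stage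
  \<open>i + 1\<close> contributes the factor \<open>|S| + |G| i - 1\<close>, one less than its
  number of atoms, and every stage after the first of these raises the dimension by one.\<close>

lemma cone_equiv_labelling_star:
  assumes fin: "finite S" "finite (carrier G)" and "labelling j = {finest}" "atoms (Suc j) \<noteq> {}"
  shows "\<exists>k. int k = (\<Prod>i = j..j + n. int (card S) - 1 + int (order G) * int i) \<and>
    cone_equiv (chain_cone (labelling (Suc (j + n)) - {finest}) le) (\<lambda>_. 0)
      (star {..<k} \<times> euclid n) (star_centre, \<lambda>_. 0)"
proof (induction n)
  have card: "card (atoms (Suc i)) = card S + order G * i" for i
    using card_atoms[OF fin, of "Suc i"] by (simp add: order_def)
  \<comment> \<open>Natural subtraction of one from the number of atoms is exact: atoms exist at
    stage \<open>j + 1\<close>, and their number does not decrease afterwards.\<close>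
  have pos: "card S + order G * j > 0"
    using card_atoms(1)[OF fin, of "Suc j"] assms(4) card[of j] by (metis card_gt_0_iff zero_less_Suc)
  have int_pred: "int (a - 1) = int a - 1" if "a > 0" for a
    using that by (simp add: of_nat_diff)
  {
    case 0
    have "int (card (atoms (Suc j)) - 1) = int (card S) - 1 + int (order G) * int j"
      unfolding card int_pred[OF pos] by simp
    then show ?case
      using cone_equiv_labelling_base[OF assms] by (intro exI[of _ "card (atoms (Suc j)) - 1"]) simp
  next
    case (Suc n)
    then obtain k where k: "int k = (\<Prod>i = j..j + n. int (card S) - 1 + int (order G) * int i)"
      "cone_equiv (chain_cone (labelling (Suc (j + n)) - {finest}) le) (\<lambda>_. 0)
        (star {..<k} \<times> euclid n) (star_centre, \<lambda>_. 0)"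
      by blast
    let ?a = "card (atoms (Suc (Suc (j + n))))"
    have "order G * j \<le> order G * Suc (j + n)"
      by (intro mult_left_mono) auto
    then have "?a > 0"
      using pos unfolding card by linarith
    then have "int (?a - 1) = int ?a - 1"
      by (rule int_pred)
    moreover have "int ?a = int (card S) + int (order G) * int (Suc (j + n))"
      by (simp only: card of_nat_add of_nat_mult)
    ultimately have "int (?a - 1) = int (card S) - 1 + int (order G) * int (Suc (j + n))"
      by linarith
    moreover have "(\<Prod>i = j..j + Suc n. int (card S) - 1 + int (order G) * int i) =
      (\<Prod>i = j..j + n. int (card S) - 1 + int (order G) * int i) * (int (card S) - 1 + int (order G) * int (Suc (j + n)))"
      by (simp add: prod.nat_ivl_Suc')
    ultimately have "int ((?a - 1) * k) = (\<Prod>i = j..j + Suc n. int (card S) - 1 + int (order G) * int i)"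
      by (simp only: of_nat_mult k(1) mult.commute)
    moreover have "atoms (Suc (Suc (j + n))) \<noteq> {}"
      using \<open>?a > 0\<close> by auto
    ultimately show ?case
      using cone_equiv_labelling_step[OF fin _ k(2)]
      by (intro exI[of _ "(?a - 1) * k"]) simp
  }
qed

lemma dowling_homotopy_equivalent_sphere_wedge:
  assumes fin: "finite S" "finite (carrier G)"
    and "cone_equiv (chain_cone (labelling n - {finest}) le) (\<lambda>_. 0) (star {..<k} \<times> euclid d) (star_centre, \<lambda>_. 0)"
  shows "geometric_realization (order_complex (dowling n G S - {dowling_bot n G}) (dowling_le n G S act))
    homotopy_equivalent_space sphere_wedge k (int d)"
proof -
  have "finite (dowling n G S)"
    using bij_betw_finite[OF bij_betw_to_dowling] finite_labelling[OF fin] by blast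
  then have 1: "geometric_realization (order_complex (dowling n G S - {dowling_bot n G}) (dowling_le n G S act))
    homotopy_equivalent_space
    top_of_set (chain_cone (dowling n G S - {dowling_bot n G}) (dowling_le n G S act) - {\<lambda>_. 0})"
    by (intro geometric_realization_homotopy_eqv_punctured_chain_cone) simp
  have 2: "(chain_cone (dowling n G S - {dowling_bot n G}) (dowling_le n G S act) - {\<lambda>_. 0})
    homotopy_eqv (star {..<k} \<times> euclid d - {(star_centre, \<lambda>_. 0)})"
    by (rule cone_equiv_imp_punctured_homotopy_eqv[OF cone_equiv_trans[OF cone_equiv_dowling_labelling assms(3)]])
  have "sphere_wedge k (int d) homeomorphic_space top_of_set (wedge_model k d)"
    using sphere_wedge_homeomorphic_wedge_model[of k "int d"] by simp
  then have 3: "top_of_set (wedge_model k d) homotopy_equivalent_space sphere_wedge k (int d)"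
    using homeomorphic_imp_homotopy_equivalent_space homotopy_equivalent_space_sym by blast
  show ?thesis
    by (rule homotopy_eqv_trans[OF 1 homotopy_eqv_trans[OF 2
          homotopy_eqv_trans[OF punctured_star_homotopy_eqv_wedge_model 3]]])
qed

end

theorem theoremB:
  fixes n :: nat
    and G :: "('g, 'm) monoid_scheme"
    and S :: "'s set"
    and act :: "'g \<Rightarrow> 's \<Rightarrow> 's"
    and \<epsilon> :: nat
  assumes "n > 0"
    and "group G" and "finite (carrier G)"
    and "finite S" and "group_action G S act"
    and "\<not> (n = 1 \<and> carrier G = {\<one>\<^bsub>G\<^esub>} \<and> S = {})"
    and "\<epsilon> = (if S \<noteq> {} then 0 else 1)"
  shows "\<exists>k::nat.
    int k = (-1) ^ \<epsilon> * (\<Prod>i = 0..n - 1. int (card S) - 1 + int (order G) * int i) \<and>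
    geometric_realization
        (order_complex (dowling n G S - {dowling_bot n G}) (dowling_le n G S act))
      homotopy_equivalent_space
    sphere_wedge k (int n - 1 - int \<epsilon>)"
proof -
  interpret dowling_data G S act
    using assms by (intro dowling_data.intro)
  note fin = \<open>finite S\<close> \<open>finite (carrier G)\<close>
  have card: "card (atoms (Suc i)) = card S + order G * i" for i
    using card_atoms[OF fin, of "Suc i"] by (simp add: order_def)
  have "order G > 0"
    using fin by (simp add: order_gt_0_iff_finite)
  consider "S \<noteq> {}" | "S = {}" "n = 1" | m where "S = {}" "n = Suc (Suc m)"
    using \<open>n > 0\<close> by (metis One_nat_def not0_implies_Suc not_gr_zero)
  then show ?thesis
  proof cases
    case 1
    then have "card (atoms (Suc 0)) > 0"
      using card[of 0] fin by (simp add: card_gt_0_iff)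
    then have "atoms (Suc 0) \<noteq> {}"
      by auto
    then obtain k where k: "int k = (\<Prod>i = 0..0 + (n - 1). int (card S) - 1 + int (order G) * int i)"
      "cone_equiv (chain_cone (labelling (Suc (0 + (n - 1))) - {finest}) le) (\<lambda>_. 0)
        (star {..<k} \<times> euclid (n - 1)) (star_centre, \<lambda>_. 0)"
      using cone_equiv_labelling_star[OF fin labelling_0, of "n - 1"] by blast
    have "geometric_realization (order_complex (dowling n G S - {dowling_bot n G}) (dowling_le n G S act))
      homotopy_equivalent_space sphere_wedge k (int (n - 1))"
      using k(2) \<open>n > 0\<close> by (intro dowling_homotopy_equivalent_sphere_wedge[OF fin]) simp
    moreover have "int (n - 1) = int n - 1 - int \<epsilon>"
      using 1 assms(1,7) by (simp add: of_nat_diff)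
    ultimately show ?thesis
      using k(1) 1 assms(7) by (intro exI[of _ k]) simp
  next
    case 2
    \<comment> \<open>Only the bottom exists, so the complex is empty. The formula gives
      \<open>(-1) * (-1) = 1\<close> sphere of dimension \<open>-1\<close>, which is the empty
      space.\<close>
    have "labelling n = {finest}"
      using labelling_Suc_trivial[OF labelling_0 atoms_1_trivial] 2 by simp
    then have "dowling n G S = {dowling_bot n G}"
      using bij_betw_to_dowling[of n] by (simp add: bij_betw_def to_dowling_finest)
    then have "geometric_realization (order_complex (dowling n G S - {dowling_bot n G}) (dowling_le n G S act))
      = trivial_topology"
      by (simp add: geometric_realization_order_complex chain_cone_empty)
    moreover have "sphere_wedge 1 (int n - 1 - int \<epsilon>) = trivial_topology"
      using 2 assms(7) by (simp add: sphere_wedge_def)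
    ultimately show ?thesis
      using 2 assms(7)
      by (intro exI[of _ 1])
        (simp add: homeomorphic_imp_homotopy_equivalent_space homeomorphic_empty_space_eq)
  next
    case 3
    have triv: "labelling (Suc 0) = {finest}"
      using labelling_Suc_trivial[OF labelling_0 atoms_1_trivial] 3 by simp
    have "card (atoms (Suc (Suc 0))) > 0"
      using card[of "Suc 0"] \<open>order G > 0\<close> by simp
    then have "atoms (Suc (Suc 0)) \<noteq> {}"
      by auto
    then obtain k where k: "int k = (\<Prod>i = Suc 0..Suc 0 + m. int (card S) - 1 + int (order G) * int i)"
      "cone_equiv (chain_cone (labelling (Suc (Suc 0 + m)) - {finest}) le) (\<lambda>_. 0)
        (star {..<k} \<times> euclid m) (star_centre, \<lambda>_. 0)"
      using cone_equiv_labelling_star[OF fin triv, of m] by blast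
    \<comment> \<open>The induction has started at \<open>i = 1\<close>. The factor for
      \<open>i = 0\<close> is \<open>int (card S) - 1 = -1\<close>, and the sign cancels it.\<close>
    have "(\<Prod>i = 0..n - 1. int (card S) - 1 + int (order G) * int i) =
      (int (card S) - 1 + int (order G) * int 0) * (\<Prod>i = Suc 0..n - 1. int (card S) - 1 + int (order G) * int i)"
      by (rule prod.atLeast_Suc_atMost) simp
    also have "\<dots> = - int k"
      unfolding k(1) using 3 by simp
    finally have prod_eq: "(\<Prod>i = 0..n - 1. int (card S) - 1 + int (order G) * int i) = - int k" .
    have "\<epsilon> = 1"
      using 3(1) assms(7) by simp
    then have "int k = (-1) ^ \<epsilon> * (\<Prod>i = 0..n - 1. int (card S) - 1 + int (order G) * int i)"
      unfolding prod_eq by simp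
    moreover have "geometric_realization (order_complex (dowling n G S - {dowling_bot n G}) (dowling_le n G S act))
      homotopy_equivalent_space sphere_wedge k (int m)"
      using k(2) 3(2) by (intro dowling_homotopy_equivalent_sphere_wedge[OF fin]) simp
    moreover have "int n - 1 - int \<epsilon> = int m"
      using 3(2) \<open>\<epsilon> = 1\<close> by simp
    ultimately show ?thesis
      by metis
  qed
qed

end
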